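(* Let $n,p,l$ be integers with $n\geq 3$, $p\geq 1$, $l\geq 0$ and $p+l=n+3$. Let $P_1,\ldots,P_p$ be points of $\mathbb{P}^n$ and let $\Lambda_1,\ldots,\Lambda_l$ be codimension two linear subspaces of $\mathbb{P}^n$, in generic position. Then: (i) if $$(p,l)\in\{(n+3,0),\ (n+2,1),\ (3,n),\ (2,n+1),\ (1,n+2)\},$$ there exists a unique rational normal curve in $\mathbb{P}^n$ passing through $P_1,\ldots,P_p$ and $(n-1)$-secant to each of $\Lambda_1,\ldots,\Lambda_l$; (ii) in all the other cases, that is, if $p\geq 4$ and $l\geq 2$, there exists no rational normal curve in $\mathbb{P}^n$ passing through $P_1,\ldots,P_p$ and $(n-1)$-secant to each of $\Lambda_1,\ldots,\Lambda_l$.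
   Context: The base field is $\mathbb{C}$. A rational normal curve in $\mathbb{P}^n$ is an irreducible, reduced, smooth, rational, linearly normal curve $\mathcal{C}\subset\mathbb{P}^n$ of degree $n$ (spanning $\mathbb{P}^n$), i.e. a linearly normal embedding of $\mathbb{P}^1$ by the complete linear series of degree $n$. A codimension two linear space $\Lambda\subset\mathbb{P}^n$ and a rational normal curve $\mathcal{C}$ are said to be $(n-1)$-secant to each other if $\Lambda\cap\mathcal{C}$ is a set of $n-1$ distinct points. "In generic position" means: there is a non-empty Zariski open subset $U$ of the data space $\mathcal{D}=G(n-2,\mathbb{P}^n)^l\times(\mathbb{P}^n)^p$, where $G(n-2,\mathbb{P}^n)$ is the Grassmannian of codimension two linear subspaces of $\mathbb{P}^n$, such that the conclusion holds for all $(\Lambda_1,\ldots,\Lambda_l,P_1,\ldots,P_p)\in U$. *)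

theory Defs
  imports "HOL-Analysis.Cartesian_Space" "HOL-Library.FuncSet"
begin

text \<open>
  Complex projective space of dimension \<open>n\<close> is the projectivisation of \<open>complex^'m\<close> with
  \<open>CARD('m) = n + 1\<close>.  A linear subspace of projective space is identified with the vector subspace
  over it, whose (vector space) dimension is one larger; a point lies on a linear subspace iff the
  corresponding line is contained in the corresponding vector subspace.
\<close>

definition proj_points :: "(complex^'m::finite) set set" where
  "proj_points = {L. vec.subspace L \<and> vec.dim L = 1}"

definition codim2_spaces :: "(complex^'m::finite) set set" where
  "codim2_spaces = {W. vec.subspace W \<and> vec.dim W + 2 = CARD('m)}"


section \<open>The Zariski topology on the data space\<close>

text \<open>The functions \<open>\<Lambda>\<close> and \<open>P\<close> list the \<open>l\<close> codimension two spaces and the \<open>p\<close> points,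
  indexed from 1.\<close>

definition data_space ::
    "nat \<Rightarrow> nat \<Rightarrow> ((nat \<Rightarrow> (complex^'m::finite) set) \<times> (nat \<Rightarrow> (complex^'m) set)) set" where
  "data_space l p = ({1..l} \<rightarrow>\<^sub>E codim2_spaces) \<times> ({1..p} \<rightarrow>\<^sub>E proj_points)"

definition homogeneous_coords :: "('m::finite \<Rightarrow> complex) \<Rightarrow> (complex^'m) set \<Rightarrow> bool" where
  "homogeneous_coords v L \<longleftrightarrow> L = vec.span {vec_lambda v}"

text \<open>A codimension two space is the common zero space of two linear forms, which are
  automatically independent.  Its (dual) Pluecker coordinates are the 2 by 2 minors of the
  coefficient matrix of the two forms; up to sign they are the complementary maximal minors of a
  basis of the space, so this is the Pluecker embedding of the Grassmannian.\<close>

definition pluecker_coords :: "('m::finite \<Rightarrow> 'm \<Rightarrow> complex) \<Rightarrow> (complex^'m) set \<Rightarrow> bool" where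
  "pluecker_coords q W \<longleftrightarrow>
     (\<exists>a b :: complex^'m.
        W = {x. (\<Sum>i\<in>UNIV. a $ i * x $ i) = 0 \<and> (\<Sum>i\<in>UNIV. b $ i * x $ i) = 0} \<and>
        q = (\<lambda>i j. a $ i * b $ j - a $ j * b $ i))"

text \<open>\<open>multiform l p d e f\<close>: \<open>f\<close> is a polynomial in the coordinates \<open>q k i j\<close> (\<open>1 \<le> k \<le> l\<close>)
  and \<open>v k i\<close> (\<open>1 \<le> k \<le> p\<close>), homogeneous of degree \<open>d k\<close> in the block \<open>q k\<close> and of degree \<open>e k\<close>
  in the block \<open>v k\<close>, for every \<open>k\<close>.\<close>

inductive multiform ::
    "nat \<Rightarrow> nat \<Rightarrow> (nat \<Rightarrow> nat) \<Rightarrow> (nat \<Rightarrow> nat) \<Rightarrow>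
     ((nat \<Rightarrow> 'm \<Rightarrow> 'm \<Rightarrow> complex) \<Rightarrow> (nat \<Rightarrow> 'm \<Rightarrow> complex) \<Rightarrow> complex) \<Rightarrow> bool"
  for l p :: nat where
  const: "multiform l p (\<lambda>_. 0) (\<lambda>_. 0) (\<lambda>q v. c)"
| space_coord: "k \<in> {1..l} \<Longrightarrow> multiform l p ((\<lambda>_. 0)(k := 1)) (\<lambda>_. 0) (\<lambda>q v. q k i j)"
| point_coord: "k \<in> {1..p} \<Longrightarrow> multiform l p (\<lambda>_. 0) ((\<lambda>_. 0)(k := 1)) (\<lambda>q v. v k i)"
| add: "multiform l p d e f \<Longrightarrow> multiform l p d e g \<Longrightarrow> multiform l p d e (\<lambda>q v. f q v + g q v)"
| mult: "multiform l p d e f \<Longrightarrow> multiform l p d' e' g \<Longrightarrow>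
    multiform l p (\<lambda>k. d k + d' k) (\<lambda>k. e k + e' k) (\<lambda>q v. f q v * g q v)"

text \<open>The coordinates of each component are unique up to a nonzero factor, so for a multiform
  vanishing does not depend on their choice.\<close>

definition vanishes_at ::
    "nat \<Rightarrow> nat \<Rightarrow> ((nat \<Rightarrow> 'm::finite \<Rightarrow> 'm \<Rightarrow> complex) \<Rightarrow> (nat \<Rightarrow> 'm \<Rightarrow> complex) \<Rightarrow> complex) \<Rightarrow>
     (nat \<Rightarrow> (complex^'m) set) \<Rightarrow> (nat \<Rightarrow> (complex^'m) set) \<Rightarrow> bool" where
  "vanishes_at l p f \<Lambda> P \<longleftrightarrow>
     (\<forall>q v. (\<forall>k\<in>{1..l}. pluecker_coords (q k) (\<Lambda> k)) \<longrightarrow>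
            (\<forall>k\<in>{1..p}. homogeneous_coords (v k) (P k)) \<longrightarrow> f q v = 0)"

definition zariski_closed ::
    "nat \<Rightarrow> nat \<Rightarrow> ((nat \<Rightarrow> (complex^'m::finite) set) \<times> (nat \<Rightarrow> (complex^'m) set)) set \<Rightarrow> bool" where
  "zariski_closed l p Z \<longleftrightarrow>
     (\<exists>F. (\<forall>f\<in>F. \<exists>d e. multiform l p d e f) \<and>
          Z = {(\<Lambda>, P) \<in> data_space l p. \<forall>f\<in>F. vanishes_at l p f \<Lambda> P})"

definition zariski_open ::
    "nat \<Rightarrow> nat \<Rightarrow> ((nat \<Rightarrow> (complex^'m::finite) set) \<times> (nat \<Rightarrow> (complex^'m) set)) set \<Rightarrow> bool" where
  "zariski_open l p U \<longleftrightarrow> U \<subseteq> data_space l p \<and> zariski_closed l p (data_space l p - U)"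

definition in_generic_position ::
    "nat \<Rightarrow> nat \<Rightarrow> ((nat \<Rightarrow> (complex^'m::finite) set) \<Rightarrow> (nat \<Rightarrow> (complex^'m) set) \<Rightarrow> bool) \<Rightarrow> bool" where
  "in_generic_position l p Q \<longleftrightarrow>
     (\<exists>U. zariski_open l p U \<and> U \<noteq> {} \<and> (\<forall>(\<Lambda>, P)\<in>U. Q \<Lambda> P))"


section \<open>Rational normal curves\<close>

definition binary_forms :: "nat \<Rightarrow> (complex \<Rightarrow> complex \<Rightarrow> complex) set" where
  "binary_forms d = {G. \<exists>a. G = (\<lambda>s t. \<Sum>k\<le>d. a k * s ^ k * t ^ (d - k))}"

text \<open>The image of the projective line under the map given by the complete linear series of degree
  \<open>n = CARD('m) - 1\<close>, that is, by a basis of the space of binary forms of degree \<open>n\<close>.  Curves are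
  reduced, hence identified with their sets of points.\<close>

definition rational_normal_curve :: "(complex^'m::finite) set set \<Rightarrow> bool" where
  "rational_normal_curve C \<longleftrightarrow>
     (\<exists>F :: 'm \<Rightarrow> complex \<Rightarrow> complex \<Rightarrow> complex.
        (\<forall>i. F i \<in> binary_forms (CARD('m) - 1)) \<and>
        (\<forall>G \<in> binary_forms (CARD('m) - 1).
           \<exists>!c :: complex^'m. G = (\<lambda>s t. \<Sum>i\<in>UNIV. c $ i * F i s t)) \<and>
        C = {vec.span {\<chi> i. F i s t} | s t. (s, t) \<noteq> (0, 0)})"

definition secant :: "nat \<Rightarrow> (complex^'m::finite) set \<Rightarrow> (complex^'m) set set \<Rightarrow> bool" where
  "secant k W C \<longleftrightarrow> finite {x \<in> C. x \<subseteq> W} \<and> card {x \<in> C. x \<subseteq> W} = k"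

end

theory Submission
  imports Defs "HOL-Analysis.Determinants" "HOL-Computational_Algebra.Polynomial_Factorial"
    "HOL-Computational_Algebra.Fundamental_Theorem_Algebra" "HOL-Computational_Algebra.Field_as_Ring"
begin

text \<open>
  Let \<open>\<pi>\<close> be the projection from \<open>P\<^sub>1\<close>.  A rational normal curve \<open>G(s, t)\<close> with
  \<open>G(0, 1) = P\<^sub>1\<close> satisfies \<open>s E G = t \<pi> G\<close> for a matrix \<open>E\<close> that is unique modulo
  \<open>\<pi>\<close>.  That the curve meets \<open>P\<^sub>k\<close> means that \<open>E P\<^sub>k\<close> is a multiple of \<open>\<pi> P\<^sub>k\<close>, and
  \<open>(n - 1)\<close>-secancy to \<open>\<Lambda>\<^sub>k\<close> means that \<open>E\<close> pulls the hyperplane spanned by \<open>\<Lambda>\<^sub>k\<close> and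
  \<open>P\<^sub>1\<close> back to a hyperplane containing \<open>\<Lambda>\<^sub>k\<close>.  In all cases this is a homogeneous linear system for
  \<open>E\<close> and the factors \<open>\<rho>\<^sub>k\<close>, with one unknown more than equations once \<open>E = \<pi>\<close> is
  excluded.  Where its solution is unique up to a factor, it depends polynomially on the data, and the
  curve is recovered as the kernel of \<open>s E - t \<pi>\<close>, that is, by maximal minors.  All conditions
  are open, so it suffices to verify them for one configuration on the standard curve; only there do the
  five cases of (i) differ.  In (ii), a curve would force the cross-ratios of
  \<open>P\<^sub>1, \<dots>, P\<^sub>4\<close> seen from \<open>\<Lambda>\<^sub>1\<close> and from \<open>\<Lambda>\<^sub>2\<close> to agree.
\<close>

section \<open>Generic properties\<close>

text \<open>The surplus of one unknown does not depend on how n + 3 splits. A point after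
  \<open>P\<^sub>1\<close> costs n equations and brings one unknown \<rho>, so its net cost is n -
  1, exactly that of a space. The net total (n + 2)(n - 1) is one less than the n(n + 1) - 1 free
  entries of E. Counting gives a nonzero solution for all data, but no upper bound on the solutions.
  Elimination near one configuration gives the bound, but no solution there. Only together do they
  give a line of solutions. On the standard curve the rows of E are polynomials in the parameter,
  and the claim becomes that only multiplication by a linear polynomial solves the system. The
  spaces are chosen so that their coefficients are monomials in k: the conditions from all
  \<open>\<Lambda>\<^sub>k\<close> together are then an interpolation problem in the variable k.
  Finally, elimination yields polynomials of mixed multidegree, whereas Zariski closed sets are cut
  out by multihomogeneous ones. Rescaling the coordinates of each component bridges this
  gap.\<close>

locale function_ring =
  fixes R :: "('x \<Rightarrow> complex) set"
  assumes const_closed: "(\<lambda>_. c) \<in> R"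
    and add_closed: "f \<in> R \<Longrightarrow> g \<in> R \<Longrightarrow> (\<lambda>x. f x + g x) \<in> R"
    and mult_closed: "f \<in> R \<Longrightarrow> g \<in> R \<Longrightarrow> (\<lambda>x. f x * g x) \<in> R"
begin

lemma uminus_closed: "f \<in> R \<Longrightarrow> (\<lambda>x. - f x) \<in> R"
  using mult_closed[OF const_closed[of "-1"], of f] by simp

lemma diff_closed: "f \<in> R \<Longrightarrow> g \<in> R \<Longrightarrow> (\<lambda>x. f x - g x) \<in> R"
  using add_closed[of f "\<lambda>x. - g x"] uminus_closed[of g] by simp

lemma sum_closed: "(\<And>i. i \<in> A \<Longrightarrow> f i \<in> R) \<Longrightarrow> (\<lambda>x. \<Sum>i\<in>A. f i x) \<in> R"
  by (induction A rule: infinite_finite_induct) (auto intro: const_closed add_closed)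

lemma prod_closed: "(\<And>i. i \<in> A \<Longrightarrow> f i \<in> R) \<Longrightarrow> (\<lambda>x. \<Prod>i\<in>A. f i x) \<in> R"
  by (induction A rule: infinite_finite_induct) (auto intro: const_closed mult_closed)

lemma if_closed: "(b \<Longrightarrow> f \<in> R) \<Longrightarrow> (\<not> b \<Longrightarrow> g \<in> R) \<Longrightarrow> (\<lambda>x. if b then f x else g x) \<in> R"
  by (cases b) simp_all

lemmas closed = const_closed add_closed mult_closed uminus_closed diff_closed
  sum_closed prod_closed if_closed

text \<open>Basic open neighbourhoods, so that finite intersections are products in R. The property
  is asked for all \<open>x\<close>, also for values that are coordinates of no actual data; the
  properties used later are therefore conditional on that.\<close>

definition near :: "'x \<Rightarrow> ('x \<Rightarrow> bool) \<Rightarrow> bool" where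
  "near x0 Q \<longleftrightarrow> (\<exists>f\<in>R. f x0 \<noteq> 0 \<and> (\<forall>x. f x \<noteq> 0 \<longrightarrow> Q x))"

lemma near_True: "near x0 (\<lambda>_. True)"
  unfolding near_def by (rule bexI[OF _ const_closed[of 1]]) simp

lemma near_mono: "near x0 P \<Longrightarrow> (\<And>x. P x \<Longrightarrow> Q x) \<Longrightarrow> near x0 Q"
  unfolding near_def by blast

lemma near_conj: "near x0 P \<Longrightarrow> near x0 Q \<Longrightarrow> near x0 (\<lambda>x. P x \<and> Q x)"
  unfolding near_def
proof (elim bexE conjE)
  fix f g assume fg: "f \<in> R" "g \<in> R" "f x0 \<noteq> 0" "g x0 \<noteq> 0"
    "\<forall>x. f x \<noteq> 0 \<longrightarrow> P x" "\<forall>x. g x \<noteq> 0 \<longrightarrow> Q x"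
  show "\<exists>h\<in>R. h x0 \<noteq> 0 \<and> (\<forall>x. h x \<noteq> 0 \<longrightarrow> P x \<and> Q x)"
    by (rule bexI[OF _ mult_closed[OF fg(1,2)]]) (use fg in auto)
qed

lemma near_ball: "finite I \<Longrightarrow> (\<And>i. i \<in> I \<Longrightarrow> near x0 (Q i)) \<Longrightarrow> near x0 (\<lambda>x. \<forall>i\<in>I. Q i x)"
proof (induction I rule: finite_induct)
  case empty
  show ?case using near_True by simp
next
  case (insert i I)
  show ?case
    using near_mono[OF near_conj[OF insert.prems[of i] insert.IH]] insert.prems by simp
qed

lemma near_nonzero: "f \<in> R \<Longrightarrow> f x0 \<noteq> 0 \<Longrightarrow> near x0 (\<lambda>x. f x \<noteq> 0)"
  unfolding near_def by blast

definition sols :: "'j set \<Rightarrow> ('j \<Rightarrow> 'x \<Rightarrow> complex) set \<Rightarrow> 'x \<Rightarrow> ('j \<Rightarrow> complex) set" where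
  "sols J \<M> x = {y. \<forall>M\<in>\<M>. (\<Sum>j\<in>J. M j x * y j) = 0}"

text \<open>Gaussian elimination: a pivot that is nonzero at \<open>x0\<close> stays nonzero near \<open>x0\<close>.\<close>

lemma near_kernel_line:
  fixes J :: "'j set"
  assumes "finite J" "\<And>M j. M \<in> \<M> \<Longrightarrow> j \<in> J \<Longrightarrow> M j \<in> R"
    and "y0 \<in> sols J \<M> x0" "\<exists>j\<in>J. y0 j \<noteq> 0"
    and "\<And>y. y \<in> sols J \<M> x0 \<Longrightarrow> \<exists>c. \<forall>j\<in>J. y j = c * y0 j"
  obtains Y where "\<And>j. j \<in> J \<Longrightarrow> Y j \<in> R" "\<And>j. j \<in> J \<Longrightarrow> Y j x0 = y0 j"
    "near x0 (\<lambda>x. \<forall>y\<in>sols J \<M> x. \<exists>c. \<forall>j\<in>J. y j = c * Y j x)"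
proof -
  \<comment> \<open>R has no division, so every elimination round multiplies the solution by its
    pivot. The induction hence allows a constant factor \<open>c0\<close> at \<open>x0\<close>,
    which is divided out at the end.\<close>
  have "\<exists>Y c0. (\<forall>j\<in>J. Y j \<in> R) \<and> c0 \<noteq> 0 \<and> (\<forall>j\<in>J. Y j x0 = c0 * y0 j) \<and>
      near x0 (\<lambda>x. \<forall>y\<in>sols J \<M> x. \<exists>c. \<forall>j\<in>J. y j = c * Y j x)"
    using assms
  proof (induction "card J" arbitrary: J \<M>)
    case 0
    then show ?case by simp
  next
    case (Suc N)
    show ?case
    proof (cases "N = 0")
      case True
      then obtain j where J: "J = {j}" using Suc.hyps(2) by (metis One_nat_def card_1_singletonE)
      show ?thesis
      proof (intro exI conjI)
        show "\<forall>i\<in>J. (\<lambda>_. 1) \<in> R" using const_closed by simp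
        show "1 / y0 j \<noteq> 0" "\<forall>i\<in>J. 1 = 1 / y0 j * y0 i" using Suc.prems(4) J by auto
        show "near x0 (\<lambda>x. \<forall>y\<in>sols J \<M> x. \<exists>c. \<forall>j\<in>J. y j = c * 1)"
          using J by (intro near_mono[OF near_True]) auto
      qed
    next
      case False
      \<comment> \<open>Otherwise every vector solves the system at \<open>x0\<close>, and with at
        least two unknowns these do not form a line.\<close>
      have "\<exists>M\<in>\<M>. \<exists>j\<in>J. M j x0 \<noteq> 0"
      proof (rule ccontr)
        assume "\<not> ?thesis"
        then have all: "y \<in> sols J \<M> x0" for y by (auto simp: sols_def)
        obtain j1 where j1: "j1 \<in> J" "y0 j1 \<noteq> 0" using Suc.prems(4) by blast
        have "card (J - {j1}) \<noteq> 0" using Suc.hyps(2) Suc.prems(1) j1 False by simp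
        then obtain j2 where j2: "j2 \<in> J" "j2 \<noteq> j1"
          by (metis DiffE all_not_in_conv card.empty insertI1)
        obtain c where c: "\<forall>j\<in>J. (if j = j2 then 1 else 0) = c * y0 j"
          using Suc.prems(5)[OF all[of "\<lambda>j. if j = j2 then 1 else 0"]] by blast
        show False using c[rule_format, OF j1(1)] c[rule_format, OF j2(1)] j1 j2 by auto
      qed
      then obtain M j where M: "M \<in> \<M>" and j: "j \<in> J" and piv: "M j x0 \<noteq> 0" by blast
      define J' where "J' = J - {j}"
      \<comment> \<open>Fraction-free elimination of the unknown \<open>j\<close>; the pivot
        equation itself becomes zero.\<close>
      define elim where "elim N k x = M j x * N k x - N j x * M k x" for N k x
      define \<M>' where "\<M>' = elim ` \<M>"
      have fin: "finite J'" "j \<notin> J'" "J = insert j J'" "card J' = N"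
        using Suc.prems(1) Suc.hyps(2) j by (auto simp: J'_def)
      have split: "(\<Sum>k\<in>J. f k) = f j + (\<Sum>k\<in>J'. f k)" for f :: "'j \<Rightarrow> complex"
        using fin by simp
      have elim_sum: "(\<Sum>k\<in>J'. elim N k x * y k) =
          M j x * (\<Sum>k\<in>J'. N k x * y k) - N j x * (\<Sum>k\<in>J'. M k x * y k)" for N x y
        by (simp add: elim_def algebra_simps sum_distrib_left sum_subtractf)
      have red: "y \<in> sols J' \<M>' x" "M j x * y j = - (\<Sum>k\<in>J'. M k x * y k)"
        if "y \<in> sols J \<M> x" for x y
      proof -
        have eq: "N j x * y j + (\<Sum>k\<in>J'. N k x * y k) = 0" if "N \<in> \<M>" for N
          using \<open>y \<in> sols J \<M> x\<close> that split by (auto simp: sols_def)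
        then have eq': "(\<Sum>k\<in>J'. N k x * y k) = - (N j x * y j)" if "N \<in> \<M>" for N
          using that by (simp add: add_eq_0_iff)
        show "M j x * y j = - (\<Sum>k\<in>J'. M k x * y k)" using eq'[OF M] by simp
        show "y \<in> sols J' \<M>' x"
          by (auto simp: sols_def \<M>'_def elim_sum eq' M)
      qed
      \<comment> \<open>Back substitution, multiplied by the pivot to stay in R.\<close>
      define lift where "lift x y k = (if k = j then - (\<Sum>i\<in>J'. M i x * y i) else M j x * y k)"
        for x :: 'x and y :: "'j \<Rightarrow> complex" and k
      have lift: "lift x y \<in> sols J \<M> x" if "y \<in> sols J' \<M>' x" for x y
      proof -
        have "(\<Sum>k\<in>J. N k x * lift x y k) = 0" if N: "N \<in> \<M>" for N
        proof -
          have "(\<Sum>k\<in>J'. N k x * lift x y k) = (\<Sum>k\<in>J'. M j x * (N k x * y k))"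
            using fin by (intro sum.cong) (auto simp: lift_def)
          then have "(\<Sum>k\<in>J. N k x * lift x y k) = (\<Sum>k\<in>J'. elim N k x * y k)"
            unfolding split elim_sum by (simp add: lift_def sum_distrib_left)
          then show ?thesis using N \<open>y \<in> sols J' \<M>' x\<close> by (auto simp: sols_def \<M>'_def)
        qed
        then show ?thesis by (simp add: sols_def)
      qed
      have ex: "\<exists>Y c0. (\<forall>j\<in>J'. Y j \<in> R) \<and> c0 \<noteq> 0 \<and> (\<forall>j\<in>J'. Y j x0 = c0 * y0 j) \<and>
          near x0 (\<lambda>x. \<forall>y\<in>sols J' \<M>' x. \<exists>c. \<forall>j\<in>J'. y j = c * Y j x)"
      proof (rule Suc.hyps(1))
        show "N = card J'" "finite J'" using fin by auto
        show "N' k \<in> R" if "N' \<in> \<M>'" "k \<in> J'" for N' k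
          using that Suc.prems(2) M j
          by (auto simp: \<M>'_def elim_def[abs_def] J'_def intro!: closed)
        show "y0 \<in> sols J' \<M>' x0" using red Suc.prems(3) by blast
        show "\<exists>j\<in>J'. y0 j \<noteq> 0"
        proof (rule ccontr)
          assume no: "\<not> ?thesis"
          then have "y0 j = 0" using red(2)[OF Suc.prems(3)] piv by simp
          with no Suc.prems(4) fin show False by auto
        qed
        show "\<exists>c. \<forall>k\<in>J'. y k = c * y0 k" if y: "y \<in> sols J' \<M>' x0" for y
        proof -
          obtain c where c: "\<forall>k\<in>J. lift x0 y k = c * y0 k"
            using Suc.prems(5)[OF lift[OF y]] by blast
          have "y k = c / M j x0 * y0 k" if "k \<in> J'" for k
          proof -
            have "lift x0 y k = c * y0 k" "k \<noteq> j" using c that fin by auto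
            then show ?thesis using piv by (simp add: lift_def field_simps)
          qed
          then show ?thesis by blast
        qed
      qed
      then obtain Y' c0 where Y': "\<And>k. k \<in> J' \<Longrightarrow> Y' k \<in> R" "c0 \<noteq> 0"
        "\<And>k. k \<in> J' \<Longrightarrow> Y' k x0 = c0 * y0 k"
        and nr: "near x0 (\<lambda>x. \<forall>y\<in>sols J' \<M>' x. \<exists>c. \<forall>j\<in>J'. y j = c * Y' j x)"
        by blast
      define Y where "Y k x = lift x (\<lambda>i. Y' i x) k" for k x
      have "\<forall>k\<in>J. Y k \<in> R"
        using Y'(1) Suc.prems(2)[OF M] fin
        by (auto simp: Y_def[abs_def] lift_def[abs_def] intro!: closed)
      moreover have "Y k x0 = (c0 * M j x0) * y0 k" if "k \<in> J" for k
      proof (cases "k = j")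
        case True
        have "(\<Sum>i\<in>J'. M i x0 * Y' i x0) = c0 * (\<Sum>i\<in>J'. M i x0 * y0 i)"
          unfolding sum_distrib_left by (intro sum.cong) (auto simp: Y'(3))
        moreover have "c0 * (\<Sum>i\<in>J'. M i x0 * y0 i) = - (c0 * (M j x0 * y0 j))"
          using red(2)[OF Suc.prems(3)] by simp
        ultimately show ?thesis using True by (simp add: Y_def lift_def mult.assoc)
      next
        case False
        then show ?thesis using that Y'(3)[of k] fin by (simp add: Y_def lift_def)
      qed
      moreover have "near x0 (\<lambda>x. \<forall>y\<in>sols J \<M> x. \<exists>c. \<forall>j\<in>J. y j = c * Y j x)"
      proof (rule near_mono[OF near_conj[OF nr near_nonzero[where f = "M j"]]])
        show "M j \<in> R" "M j x0 \<noteq> 0" using Suc.prems(2) M j piv by auto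
        fix x
        assume H: "(\<forall>y\<in>sols J' \<M>' x. \<exists>c. \<forall>j\<in>J'. y j = c * Y' j x) \<and> M j x \<noteq> 0"
        show "\<forall>y\<in>sols J \<M> x. \<exists>c. \<forall>j\<in>J. y j = c * Y j x"
        proof
          fix y assume y: "y \<in> sols J \<M> x"
          obtain c where c: "\<forall>k\<in>J'. y k = c * Y' k x" using H red(1)[OF y] by blast
          have "(\<Sum>k\<in>J'. M k x * y k) = c * (\<Sum>k\<in>J'. M k x * Y' k x)"
            unfolding sum_distrib_left using c by (intro sum.cong) auto
          then have "y j = c / M j x * Y j x"
            using red(2)[OF y] H by (simp add: Y_def lift_def field_simps)
          moreover have "y k = c / M j x * Y k x" if "k \<in> J'" for k
            using that c H fin by (auto simp: Y_def lift_def)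
          ultimately have "\<forall>k\<in>J. y k = c / M j x * Y k x" using fin by auto
          then show "\<exists>c. \<forall>j\<in>J. y j = c * Y j x" by blast
        qed
      qed
      ultimately show ?thesis
        using Y'(2) piv by (intro exI[of _ Y] exI[of _ "c0 * M j x0"]) auto
    qed
  qed
  then obtain Y c0 where Y: "\<And>j. j \<in> J \<Longrightarrow> Y j \<in> R" "c0 \<noteq> 0" "\<And>j. j \<in> J \<Longrightarrow> Y j x0 = c0 * y0 j"
    and nr: "near x0 (\<lambda>x. \<forall>y\<in>sols J \<M> x. \<exists>c. \<forall>j\<in>J. y j = c * Y j x)" by blast
  show thesis
  proof (rule that[of "\<lambda>j x. 1 / c0 * Y j x"])
    show "(\<lambda>x. 1 / c0 * Y j x) \<in> R" "1 / c0 * Y j x0 = y0 j" if "j \<in> J" for j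
      using Y that mult_closed[OF const_closed[of "1 / c0"]] by auto
    have eq: "c * Y j x = c * c0 * (1 / c0 * Y j x)" for c j x
      using Y(2) by (simp add: field_simps)
    show "near x0 (\<lambda>x. \<forall>y\<in>sols J \<M> x. \<exists>c. \<forall>j\<in>J. y j = c * (1 / c0 * Y j x))"
      using nr by (rule near_mono) (metis eq)
  qed
qed

lemma near_trivial_kernel:
  fixes J :: "'j set"
  assumes "finite J" "\<And>M j. M \<in> \<M> \<Longrightarrow> j \<in> J \<Longrightarrow> M j \<in> R"
    and triv: "\<And>y j. y \<in> sols J \<M> x0 \<Longrightarrow> j \<in> J \<Longrightarrow> y j = 0"
  shows "near x0 (\<lambda>x. \<forall>y\<in>sols J \<M> x. \<forall>j\<in>J. y j = 0)"
proof -
  \<comment> \<open>A dummy unknown that occurs in no equation makes the kernel a line.\<close>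
  define ext :: "('j \<Rightarrow> 'x \<Rightarrow> complex) \<Rightarrow> 'j option \<Rightarrow> 'x \<Rightarrow> complex"
    where "ext M = case_option (\<lambda>_. 0) M" for M
  define unit :: "'j option \<Rightarrow> complex" where "unit = case_option 1 (\<lambda>_. 0)"
  let ?J = "insert None (Some ` J)" and ?M = "ext ` \<M>"
  have sols: "y \<in> sols ?J ?M x \<longleftrightarrow> (\<lambda>j. y (Some j)) \<in> sols J \<M> x" for x y
    using assms(1) by (auto simp: sols_def ext_def sum.reindex)
  have unit: "unit \<in> sols ?J ?M x" for x
    by (simp add: sols unit_def) (simp add: sols_def)
  obtain Y where Y: "near x0 (\<lambda>x. \<forall>y\<in>sols ?J ?M x. \<exists>c. \<forall>j\<in>?J. y j = c * Y j x)"
  proof (rule near_kernel_line[of ?J ?M unit x0])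
    show "finite ?J" using assms(1) by simp
    show "M j \<in> R" if "M \<in> ?M" "j \<in> ?J" for M j
      using that assms(2) by (auto simp: ext_def intro: closed)
    show "unit \<in> sols ?J ?M x0" by (rule unit)
    show "\<exists>j\<in>?J. unit j \<noteq> 0" by (simp add: unit_def)
    show "\<exists>c. \<forall>j\<in>?J. y j = c * unit j" if "y \<in> sols ?J ?M x0" for y
      using triv[of "\<lambda>j. y (Some j)"] that
      by (intro exI[of _ "y None"]) (auto simp: sols unit_def)
  qed blast
  show ?thesis
  proof (rule near_mono[OF Y], intro ballI)
    fix x y j assume H: "\<forall>y\<in>sols ?J ?M x. \<exists>c. \<forall>j\<in>?J. y j = c * Y j x"
      and y: "y \<in> sols J \<M> x" and j: "j \<in> J"
    obtain c where c: "\<forall>j\<in>?J. unit j = c * Y j x" using H unit by blast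
    have "case_option 0 y \<in> sols ?J ?M x" using y by (simp add: sols)
    then obtain c' where c': "\<forall>j\<in>?J. case_option 0 y j = c' * Y j x" using H by blast
    \<comment> \<open>\<open>unit\<close> and the extension of \<open>y\<close> by zero are
      multiples of the same vector. The entry 1 at \<open>None\<close> makes \<open>c\<close>
      nonzero, so \<open>Y\<close> vanishes on all old unknowns.\<close>
    have "c * Y None x = 1" "c * Y (Some j) x = 0" "c' * Y (Some j) x = y j"
      using c[rule_format, of None] c[rule_format, of "Some j"] c'[rule_format, of "Some j"] j
      by (auto simp: unit_def)
    then show "y j = 0" by auto
  qed
qed

end

section \<open>Squarefree polynomials and linear systems\<close>

lemma poly_upto:
  fixes p :: "complex poly"
  assumes "degree p \<le> d"
  shows "poly p z = (\<Sum>k\<le>d. coeff p k * z ^ k)"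
proof -
  have "(\<Sum>k\<le>d. coeff p k * z ^ k) = (\<Sum>k\<le>degree p. coeff p k * z ^ k)"
    by (rule sum.mono_neutral_right) (use assms in \<open>auto simp: coeff_eq_0\<close>)
  then show ?thesis by (simp add: poly_altdef)
qed

text \<open>The polynomials on which \<open>ev\<close> is assumed to vanish are the rows of the
  Sylvester matrix of \<open>p\<close> and its derivative. For squarefree \<open>p\<close> they span
  all polynomials of degree at most 2d - 2.\<close>

lemma functional_vanishing:
  fixes p :: "complex poly" and y :: "nat \<Rightarrow> complex" and d :: nat
  defines "ev \<equiv> \<lambda>g. \<Sum>k\<le>2 * d - 2. coeff g k * y k"
  assumes d: "d \<ge> 1" "degree p = d" and sq: "rsquarefree p"
    and p: "\<And>i. i + 2 \<le> d \<Longrightarrow> ev (monom 1 i * p) = 0"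
    and p': "\<And>i. i + 1 \<le> d \<Longrightarrow> ev (monom 1 i * pderiv p) = 0"
    and k: "k \<le> 2 * d - 2"
  shows "y k = 0"
proof -
  have lin: "ev (f + g) = ev f + ev g" "ev (smult c f) = c * ev f" for f g c
    by (simp_all add: ev_def algebra_simps sum.distrib sum_distrib_left)
  have lin_sum: "ev (\<Sum>i\<in>I. f i) = (\<Sum>i\<in>I. ev (f i))" if "finite I" for f :: "nat \<Rightarrow> complex poly" and I
    using that by (induction I rule: finite_induct) (auto simp: lin, simp add: ev_def)
  have expand: "u * g = (\<Sum>i\<le>degree u. smult (coeff u i) (monom 1 i * g))" for u g :: "complex poly"
  proof -
    have "u * g = (\<Sum>i\<le>degree u. monom (coeff u i) i) * g"
      using poly_as_sum_of_monoms[of u] by simp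
    also have "\<dots> = (\<Sum>i\<le>degree u. smult (coeff u i) (monom 1 i * g))"
      by (simp add: sum_distrib_right smult_monom flip: mult_smult_left)
    finally show ?thesis .
  qed
  have mult_p: "ev (u * p) = 0" if "u = 0 \<or> degree u + 2 \<le> d" for u
    using that by (subst expand) (auto simp: lin_sum lin p)
  have mult_p': "ev (v * pderiv p) = 0" if "degree v + 1 \<le> d" for v
    using that by (subst expand) (auto simp: lin_sum lin p')
  have "coprime p (pderiv p)"
  proof (rule ccontr)
    assume "\<not> ?thesis"
    then obtain g where g: "g dvd p" "g dvd pderiv p" "\<not> is_unit g"
      by (auto simp: coprime_def)
    have "degree g \<noteq> 0" using g d by (metis degree_0 dvd_0_left is_unit_iff_degree not_one_le_zero)
    then obtain z where "poly g z = 0"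
      using fundamental_theorem_of_algebra[of g] constant_degree[of g] by auto
    then have "poly p z = 0" "poly (pderiv p) z = 0" using g by (auto elim!: dvdE)
    then show False using sq by (auto simp: rsquarefree_roots)
  qed
  then obtain u v where uv: "u * p + v * pderiv p = 1"
    using bezout_coefficients_fst_snd[of p "pderiv p"] by (metis coprime_iff_gcd_eq_1)
  \<comment> \<open>The Bezout cofactors have no useful degree bound. Reducing one of them modulo
    \<open>p\<close> bounds it, and comparing degrees then bounds the other.\<close>
  define w where "w = monom 1 k * v mod p"
  have p0: "p \<noteq> 0" using d by auto
  have degw: "degree w + 1 \<le> d"
    using degree_mod_less[OF p0, of "monom 1 k * v"] d by (auto simp: w_def)
  define u' where "u' = monom 1 k * u + (monom 1 k * v div p) * pderiv p"
  have "monom 1 k = monom 1 k * u * p + (monom 1 k * v) * pderiv p"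
    using arg_cong[OF uv, of "\<lambda>f. monom 1 k * f"] by (simp add: algebra_simps)
  also have "monom 1 k * v = (monom 1 k * v div p) * p + w" by (simp add: w_def)
  finally have eq: "monom 1 k = u' * p + w * pderiv p"
    by (simp add: u'_def algebra_simps)
  have "u' = 0 \<or> degree u' + 2 \<le> d"
  proof (rule ccontr)
    assume no: "\<not> ?thesis"
    then have "degree (u' * p) = degree u' + d" using d p0 by (simp add: degree_mult_eq)
    moreover have "degree (u' * p) \<le> 2 * d - 2"
    proof -
      have "u' * p = monom 1 k - w * pderiv p" using eq by simp
      moreover have "degree (w * pderiv p) \<le> 2 * d - 2"
        using degree_mult_le[of w "pderiv p"] degw d by (simp add: degree_pderiv)
      ultimately show ?thesis
        using degree_diff_le[of "monom 1 k" "2 * d - 2" "w * pderiv p"] k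
        by (metis degree_monom_eq one_neq_zero)
    qed
    ultimately show False using no d by auto
  qed
  then have "ev (monom 1 k) = 0" unfolding eq lin using mult_p mult_p' degw by simp
  moreover have "ev (monom 1 k) = (\<Sum>i\<le>2 * d - 2. if i = k then y i else 0)"
    unfolding ev_def by (intro sum.cong) auto
  ultimately show ?thesis using k by simp
qed

lemma card_roots_rsquarefree:
  fixes p :: "complex poly"
  assumes "rsquarefree p"
  shows "card {z. poly p z = 0} = degree p"
proof -
  have p: "p \<noteq> 0" using assms by (simp add: rsquarefree_def)
  have "degree p = degree (\<Prod>z|poly p z = 0. [:-z, 1:])"
    by (subst (1) complex_poly_decompose_rsquarefree[OF assms, symmetric]) (simp add: p)
  also have "\<dots> = (\<Sum>z|poly p z = 0. degree [:-z, 1:])"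
    by (rule degree_prod_eq_sum_degree) auto
  finally show ?thesis by simp
qed

section \<open>Openness of having the maximal number of distinct roots\<close>

context function_ring
begin

text \<open>Nonvanishing of the discriminant, phrased as triviality of the kernel of the Sylvester
  system, whose coefficients lie in R.\<close>

lemma near_card_roots:
  fixes A :: "nat \<Rightarrow> 'x \<Rightarrow> complex"
  assumes d: "d \<ge> 1" and A: "\<And>m. m \<le> d \<Longrightarrow> A m \<in> R"
    and p: "\<And>m. m \<le> d \<Longrightarrow> A m x0 = coeff p m" "degree p = d" "rsquarefree p"
  shows "near x0 (\<lambda>x. card {z. (\<Sum>m\<le>d. A m x * z ^ m) = 0} = d)"
proof -
  define P where "P x = (\<Sum>m\<le>d. monom (A m x) m)" for x
  have coeff_P: "coeff (P x) m = (if m \<le> d then A m x else 0)" for x m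
    by (simp add: P_def coeff_sum coeff_monom) 
  have P0: "P x0 = p"
    using p by (intro poly_eqI) (auto simp: coeff_P coeff_eq_0)
  let ?J = "{..2 * d - 2}"
  define \<M> where "\<M> = (\<lambda>i k x. coeff (monom 1 i * P x) k) ` {i. i + 2 \<le> d} \<union>
    (\<lambda>i k x. coeff (monom 1 i * pderiv (P x)) k) ` {i. i + 1 \<le> d}"
  have M: "M k \<in> R" if "M \<in> \<M>" for M k
    using that A
    by (auto simp: \<M>_def coeff_monom_mult coeff_pderiv coeff_P intro!: closed)
  have "near x0 (\<lambda>x. \<forall>y\<in>sols ?J \<M> x. \<forall>k\<in>?J. y k = 0)"
  proof (rule near_trivial_kernel)
    fix y k assume y: "y \<in> sols ?J \<M> x0" and "k \<in> ?J"
    show "y k = 0"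
    proof (rule functional_vanishing[where p = p and d = d])
      show "(\<Sum>k\<le>2 * d - 2. coeff (monom 1 i * p) k * y k) = 0" if "i + 2 \<le> d" for i
      proof -
        have "(\<lambda>k x. coeff (monom 1 i * P x) k) \<in> \<M>" using that by (simp add: \<M>_def)
        from bspec[OF y[unfolded sols_def mem_Collect_eq] this] show ?thesis by (simp add: P0)
      qed
      show "(\<Sum>k\<le>2 * d - 2. coeff (monom 1 i * pderiv p) k * y k) = 0" if "i + 1 \<le> d" for i
      proof -
        have "(\<lambda>k x. coeff (monom 1 i * pderiv (P x)) k) \<in> \<M>" using that by (simp add: \<M>_def)
        from bspec[OF y[unfolded sols_def mem_Collect_eq] this] show ?thesis by (simp add: P0)
      qed
    qed (use d p \<open>k \<in> ?J\<close> in auto)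
  qed (use M in auto)
  moreover have "near x0 (\<lambda>x. A d x \<noteq> 0)"
    using A p d by (intro near_nonzero) (auto simp: leading_coeff_neq_0)
  ultimately show ?thesis
  proof (rule near_mono[OF near_conj])
    fix x assume H: "(\<forall>y\<in>sols ?J \<M> x. \<forall>k\<in>?J. y k = 0) \<and> A d x \<noteq> 0"
    have deg: "degree (P x) = d"
      using H by (intro antisym degree_le le_degree) (auto simp: coeff_P)
    have "rsquarefree (P x)"
      unfolding rsquarefree_roots
    proof (intro allI notI)
      fix z assume z: "poly (P x) z = 0 \<and> poly (pderiv (P x)) z = 0"
      have eval: "(\<Sum>k\<le>2 * d - 2. coeff f k * z ^ k) = poly f z" if "degree f \<le> 2 * d - 2" for f
        using poly_upto[OF that] by simp
      \<comment> \<open>At a double root, evaluation is a functional that kills all Sylvester rows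
        but not the constant 1.\<close>
      have "(\<lambda>k. z ^ k) \<in> sols ?J \<M> x"
      proof -
        have "degree (monom 1 i * P x) \<le> 2 * d - 2" if "i + 2 \<le> d" for i
          using degree_mult_le[of "monom 1 i" "P x"] that deg by (simp add: degree_monom_eq)
        moreover have "degree (monom 1 i * pderiv (P x)) \<le> 2 * d - 2" if "i + 1 \<le> d" for i
          using degree_mult_le[of "monom 1 i" "pderiv (P x)"] that deg
          by (simp add: degree_monom_eq degree_pderiv)
        ultimately show ?thesis using z by (auto simp: sols_def \<M>_def eval)
      qed
      then have "z ^ 0 = 0" using H by fastforce
      then show False by simp
    qed
    then have "card {z. poly (P x) z = 0} = d" using card_roots_rsquarefree deg by metis
    then show "card {z. (\<Sum>m\<le>d. A m x * z ^ m) = 0} = d"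
      using poly_upto[of "P x" d] deg by (simp add: coeff_P)
  qed
qed

end

lemma underdetermined_system:
  fixes M :: "'k \<Rightarrow> 'j \<Rightarrow> complex"
  assumes "finite K" "finite J" "card K < card J"
  obtains y where "\<exists>j\<in>J. y j \<noteq> 0" "\<And>k. k \<in> K \<Longrightarrow> (\<Sum>j\<in>J. M k j * y j) = 0"
proof -
  have "\<exists>y. (\<exists>j\<in>J. y j \<noteq> 0) \<and> (\<forall>k\<in>K. (\<Sum>j\<in>J. M k j * y j) = 0)"
    using assms
  proof (induction K arbitrary: M J rule: finite_induct)
    case empty
    then obtain j where "j \<in> J" by fastforce
    then show ?case by (intro exI[of _ "\<lambda>_. 1"]) auto
  next
    case (insert k K)
    show ?case
    proof (cases "\<exists>j\<in>J. M k j \<noteq> 0")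
      case False
      obtain y where "\<exists>j\<in>J. y j \<noteq> 0" "\<forall>k\<in>K. (\<Sum>j\<in>J. M k j * y j) = 0"
        using insert.IH[of J M] insert.prems insert.hyps by auto
      then show ?thesis using False by (intro exI[of _ y]) auto
    next
      case True
      then obtain j where j: "j \<in> J" "M k j \<noteq> 0" by blast
      define J' where "J' = J - {j}"
      have J': "finite J'" "j \<notin> J'" "J = insert j J'" "card K < card J'"
        using j insert by (auto simp: J'_def)
      define c where "c k' = M k' j / M k j" for k'
      obtain y where y: "\<exists>j\<in>J'. y j \<noteq> 0"
        "\<forall>k'\<in>K. (\<Sum>i\<in>J'. (M k' i - c k' * M k i) * y i) = 0"
        using insert.IH[of J' "\<lambda>k' i. M k' i - c k' * M k i"] J' by auto
      define y' where "y' = y(j := - (\<Sum>i\<in>J'. M k i * y i) / M k j)"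
      have sum: "(\<Sum>i\<in>J. f i * y' i) = f j * y' j + (\<Sum>i\<in>J'. f i * y i)" for f
      proof -
        have "(\<Sum>i\<in>J'. f i * y' i) = (\<Sum>i\<in>J'. f i * y i)"
          using J' by (intro sum.cong) (auto simp: y'_def)
        then show ?thesis using J' by simp
      qed
      have "(\<Sum>i\<in>J. M k' i * y' i) = 0" if "k' \<in> K" for k'
        using y(2)[rule_format, OF that]
        unfolding sum by (simp add: y'_def c_def algebra_simps sum_subtractf sum_distrib_left sum_divide_distrib)
      moreover have "(\<Sum>i\<in>J. M k i * y' i) = 0" using j unfolding sum by (simp add: y'_def)
      ultimately show ?thesis using y(1) J' by (intro exI[of _ y']) (auto simp: y'_def)
    qed
  qed
  then show thesis using that by blast
qed

section \<open>Binary forms\<close>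

text \<open>Homogenisation for the affine coordinate t/s; the point s = 0 at infinity sees only the
  coefficient of degree \<open>d\<close>.\<close>

definition hom :: "nat \<Rightarrow> complex poly \<Rightarrow> complex \<Rightarrow> complex \<Rightarrow> complex" where
  "hom d p s t = (\<Sum>k\<le>d. coeff p k * t ^ k * s ^ (d - k))"

lemma hom_1: "degree p \<le> d \<Longrightarrow> hom d p 1 z = poly p z"
  by (simp add: hom_def poly_upto)

lemma hom_eval:
  assumes "degree p \<le> d" "s \<noteq> 0"
  shows "hom d p s t = s ^ d * poly p (t / s)"
  unfolding hom_def poly_upto[OF assms(1)] sum_distrib_left
proof (intro sum.cong refl)
  fix k assume "k \<in> {..d}"
  then have "s ^ d = s ^ (d - k) * s ^ k" by (simp flip: power_add)
  then show "coeff p k * t ^ k * s ^ (d - k) = s ^ d * (coeff p k * (t / s) ^ k)"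
    using assms(2) by (simp add: power_divide)
qed

lemma hom_0: "hom d p 0 t = coeff p d * t ^ d"
proof -
  have "hom d p 0 t = (\<Sum>k\<le>d. if k = d then coeff p d * t ^ d else 0)"
    unfolding hom_def by (intro sum.cong) auto
  then show ?thesis by simp
qed

lemma binary_formI: "(\<lambda>s t. \<Sum>m\<le>d. A m * t ^ m * s ^ (d - m)) \<in> binary_forms d"
proof -
  have "(\<Sum>m\<le>d. A m * t ^ m * s ^ (d - m)) = (\<Sum>k\<le>d. A (d - k) * s ^ k * t ^ (d - k))" for s t
    by (rule sum.reindex_bij_witness[of _ "\<lambda>k. d - k" "\<lambda>k. d - k"]) (auto simp: mult_ac)
  then show ?thesis unfolding binary_forms_def by (intro CollectI exI[of _ "\<lambda>k. A (d - k)"] ext)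
qed

lemma binary_forms_iff: "G \<in> binary_forms d \<longleftrightarrow> (\<exists>p. degree p \<le> d \<and> G = hom d p)"
proof
  assume "G \<in> binary_forms d"
  then obtain a where a: "G = (\<lambda>s t. \<Sum>k\<le>d. a k * s ^ k * t ^ (d - k))"
    by (auto simp: binary_forms_def)
  define p where "p = (\<Sum>k\<le>d. monom (a (d - k)) k)"
  have c: "coeff p k = (if k \<le> d then a (d - k) else 0)" for k
    by (simp add: p_def coeff_sum coeff_monom)
  have "hom d p s t = G s t" for s t
    unfolding hom_def a
    by (rule sum.reindex_bij_witness[of _ "\<lambda>k. d - k" "\<lambda>k. d - k"]) (auto simp: c mult_ac)
  then have "G = hom d p" by (intro ext) simp
  moreover have "degree p \<le> d" by (rule degree_le) (simp add: c)
  ultimately show "\<exists>p. degree p \<le> d \<and> G = hom d p" by blast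
next
  assume "\<exists>p. degree p \<le> d \<and> G = hom d p"
  then show "G \<in> binary_forms d" using binary_formI by (auto simp: hom_def[abs_def])
qed

lemma binary_form_add:
  "F \<in> binary_forms d \<Longrightarrow> G \<in> binary_forms d \<Longrightarrow> (\<lambda>s t. F s t + G s t) \<in> binary_forms d"
proof -
  assume "F \<in> binary_forms d" "G \<in> binary_forms d"
  then obtain a b where "F = (\<lambda>s t. \<Sum>k\<le>d. a k * s ^ k * t ^ (d - k))"
    "G = (\<lambda>s t. \<Sum>k\<le>d. b k * s ^ k * t ^ (d - k))" by (auto simp: binary_forms_def)
  then show ?thesis unfolding binary_forms_def
    by (intro CollectI exI[of _ "\<lambda>k. a k + b k"]) (simp add: sum.distrib algebra_simps)
qed

lemma binary_form_scale:
  "F \<in> binary_forms d \<Longrightarrow> (\<lambda>s t. c * F s t) \<in> binary_forms d"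
proof -
  assume "F \<in> binary_forms d"
  then obtain a where "F = (\<lambda>s t. \<Sum>k\<le>d. a k * s ^ k * t ^ (d - k))"
    by (auto simp: binary_forms_def)
  then show ?thesis unfolding binary_forms_def
    by (intro CollectI exI[of _ "\<lambda>k. c * a k"]) (simp add: sum_distrib_left algebra_simps)
qed

lemma binary_form_zero: "(\<lambda>s t. 0) \<in> binary_forms d"
  unfolding binary_forms_def by (intro CollectI exI[of _ "\<lambda>_. 0"]) simp

lemma binary_form_sum:
  "(\<And>i. i \<in> I \<Longrightarrow> F i \<in> binary_forms d) \<Longrightarrow> (\<lambda>s t. \<Sum>i\<in>I. c i * F i s t) \<in> binary_forms d"
proof (induction I rule: infinite_finite_induct)
  case (insert i I)
  then show ?case
    using binary_form_add[OF binary_form_scale[of "F i" d "c i"] insert.IH] by simp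
qed (simp_all add: binary_form_zero)

lemma binary_form_linear_mult:
  assumes "G \<in> binary_forms d"
  shows "(\<lambda>s t. (\<alpha> * s + \<beta> * t) * G s t) \<in> binary_forms (Suc d)"
proof -
  obtain p where p: "degree p \<le> d" "G = hom d p" using assms by (auto simp: binary_forms_iff)
  have deg: "degree ([:\<alpha>, \<beta>:] * p) \<le> Suc d"
  proof -
    have "degree [:\<alpha>, \<beta>:] \<le> 1" by simp
    then show ?thesis using degree_mult_le[of "[:\<alpha>, \<beta>:]" p] p(1) by linarith
  qed
  have "(\<lambda>s t. (\<alpha> * s + \<beta> * t) * G s t) = hom (Suc d) ([:\<alpha>, \<beta>:] * p)"
  proof (intro ext)
    fix s t
    show "(\<alpha> * s + \<beta> * t) * G s t = hom (Suc d) ([:\<alpha>, \<beta>:] * p) s t"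
    proof (cases "s = 0")
      case True
      have "coeff p (Suc d) = 0" using p(1) by (simp add: coeff_eq_0)
      then show ?thesis using True by (simp add: p hom_0)
    next
      case False
      then show ?thesis
        unfolding p hom_eval[OF p(1) False] hom_eval[OF deg False] poly_mult
        by (simp add: distrib_left distrib_right)
    qed
  qed
  then show ?thesis using deg binary_forms_iff by blast
qed

text \<open>A zero with s0 nonzero is a root t0/s0 of the dehomogenised polynomial; a zero at
  infinity means that its top coefficient vanishes.\<close>

lemma binary_form_factor:
  assumes G: "G \<in> binary_forms (Suc d)" and z: "(s0, t0) \<noteq> (0, 0)" "G s0 t0 = 0"
  obtains H where "H \<in> binary_forms d" "\<And>s t. G s t = (t * s0 - s * t0) * H s t"
proof -
  obtain p where p: "degree p \<le> Suc d" "G = hom (Suc d) p"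
    using G by (auto simp: binary_forms_iff)
  show thesis
  proof (cases "s0 = 0")
    case True
    then have t0: "t0 \<noteq> 0" using z by auto
    then have c0: "coeff p (Suc d) = 0" using z(2) True by (simp add: p hom_0)
    then have deg: "degree p \<le> d" using p(1)

    proof (intro degree_le allI impI)
      fix i assume "d < i"
      then have "i = Suc d \<or> degree p < i" using p(1) by linarith
      then show "coeff p i = 0" using c0 by (auto simp: coeff_eq_0)
    qed
    have "G s t = s * hom d p s t" for s t
      using c0 by (simp add: p hom_def sum_distrib_left Suc_diff_le algebra_simps)
    then have "G s t = (t * s0 - s * t0) * (- 1 / t0 * hom d p s t)" for s t
      using True t0 by simp
    moreover have "hom d p \<in> binary_forms d" using deg binary_forms_iff by blast
    ultimately show thesis by (intro that[OF binary_form_scale])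
  next
    case False
    then have "poly p (t0 / s0) = 0" using z(2) by (simp add: p hom_eval[OF p(1)])
    then obtain q where q: "p = [:- (t0 / s0), 1:] * q" by (meson dvdE poly_eq_0_iff_dvd)
    have deg: "degree q \<le> d"
    proof (cases "q = 0")
      case False
      have "degree p = Suc (degree q)" unfolding q using False by (subst degree_mult_eq) auto
      then show ?thesis using p(1) by simp
    qed simp
    have "G s t = (t * s0 - s * t0) * (1 / s0 * hom d q s t)" for s t
    proof (cases "s = 0")
      case True
      have "coeff q (Suc d) = 0" using deg by (simp add: coeff_eq_0)
      then show ?thesis using True False by (simp add: p hom_0 q)
    next
      case False
      then show ?thesis using \<open>s0 \<noteq> 0\<close> unfolding p hom_eval[OF p(1) False] hom_eval[OF deg False]
        by (simp add: q field_simps)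
    qed
    moreover have "hom d q \<in> binary_forms d" using deg binary_forms_iff by blast
    ultimately show thesis by (intro that[OF binary_form_scale])
  qed
qed

lemma binary_form_factor_set:
  assumes "finite T" "card T \<le> d" "G \<in> binary_forms d"
    and "\<And>s t. (s, t) \<in> T \<Longrightarrow> (s, t) \<noteq> (0, 0) \<and> G s t = 0"
    and "\<And>s t s' t'. (s, t) \<in> T \<Longrightarrow> (s', t') \<in> T \<Longrightarrow> t * s' = s * t' \<Longrightarrow> (s, t) = (s', t')"
  obtains H where "H \<in> binary_forms (d - card T)"
    "\<And>s t. G s t = (\<Prod>(s0, t0)\<in>T. t * s0 - s * t0) * H s t"
proof -
  have "\<exists>H\<in>binary_forms (d - card T). \<forall>s t. G s t = (\<Prod>(s0, t0)\<in>T. t * s0 - s * t0) * H s t"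
    using assms
  proof (induction T rule: finite_induct)
    case empty
    then show ?case by (intro bexI[of _ G]) auto
  next
    case (insert x T)
    obtain s0 t0 where x: "x = (s0, t0)" by fastforce
    have "\<exists>H\<in>binary_forms (d - card T). \<forall>s t. G s t = (\<Prod>(s0, t0)\<in>T. t * s0 - s * t0) * H s t"
    proof (rule insert.IH)
      show "card T \<le> d" "G \<in> binary_forms d" using insert.prems insert.hyps by auto
      show "(s, t) \<noteq> (0, 0) \<and> G s t = 0" if "(s, t) \<in> T" for s t
        using insert.prems(3)[of s t] that by blast
      show "(s, t) = (s', t')" if "(s, t) \<in> T" "(s', t') \<in> T" "t * s' = s * t'" for s t s' t'
        using insert.prems(4)[of s t s' t'] that by blast
    qed
    then obtain H where H: "H \<in> binary_forms (d - card T)"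
      "\<And>s t. G s t = (\<Prod>(s0, t0)\<in>T. t * s0 - s * t0) * H s t" by blast
    \<comment> \<open>Elements of the set represent pairwise different points, so the factors
      already split off do not vanish at the new zero.\<close>
    have "(\<Prod>(s1, t1)\<in>T. t0 * s1 - s0 * t1) \<noteq> 0"
    proof -
      have "t0 * s1 - s0 * t1 \<noteq> 0" if "(s1, t1) \<in> T" for s1 t1
        using insert.prems(4)[of s0 t0 s1 t1] insert.hyps that x by (metis insertCI right_minus_eq)
      then show ?thesis using insert.hyps(1) by (auto simp: prod_zero_iff)
    qed
    then have "H s0 t0 = 0" using H(2)[of s0 t0] insert.prems(3)[of s0 t0] x by simp
    moreover have "d - card T = Suc (d - card (insert x T))" using insert by simp
    ultimately obtain H' where H': "H' \<in> binary_forms (d - card (insert x T))"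
      "\<And>s t. H s t = (t * s0 - s * t0) * H' s t"
      using binary_form_factor[of H "d - card (insert x T)" s0 t0] H(1) insert.prems(3)[of s0 t0] x
      by auto
    then show ?case using H insert.hyps x by (intro bexI[of _ H']) (auto simp: mult_ac)
  qed
  then show thesis using that by blast
qed

text \<open>The exceptional set \<open>Z\<close> allows a linear factor to be cancelled from an
  identity between forms.\<close>

lemma binary_form_eq_zero:
  assumes "G \<in> binary_forms d" "finite Z" "\<And>z. z \<notin> Z \<Longrightarrow> G 1 z = 0"
  shows "G s t = 0"
proof -
  obtain p where p: "degree p \<le> d" "G = hom d p" using assms(1) by (auto simp: binary_forms_iff)
  have "p = 0"
  proof (rule ccontr)
    assume "p \<noteq> 0"
    then have "finite {z. poly p z = 0}" by (rule poly_roots_finite)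
    moreover have "- Z \<subseteq> {z. poly p z = 0}" using assms(3) by (auto simp: p hom_1[OF p(1)])
    ultimately have "finite (- Z)" by (rule rev_finite_subset)
    then show False using assms(2) infinite_UNIV_char_0[where 'a = complex]
      by (metis finite_compl)
  qed
  then show ?thesis by (simp add: p hom_def)
qed

lemma binary_form_one:
  assumes "G \<in> binary_forms 1"
  obtains \<alpha> \<beta> where "\<And>s t. G s t = \<alpha> * s + \<beta> * t"
proof -
  obtain a where "G = (\<lambda>s t. \<Sum>k\<le>1. a k * s ^ k * t ^ (1 - k))"
    using assms by (auto simp: binary_forms_def)
  then have "G s t = a 1 * s + a 0 * t" for s t by simp
  then show thesis by (rule that)
qed

text \<open>For positive \<open>d\<close> this form vanishes at the point (s0, t0) only; expressed
  in a basis of forms, it separates points of the curve.\<close>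

lemma binary_form_linear_power:
  assumes "G = (\<lambda>s t. (t * s0 - s * t0) ^ d)"
  shows "G \<in> binary_forms d"
  unfolding assms
proof (induction d)
  case 0
  show ?case unfolding binary_forms_def by (intro CollectI exI[of _ "\<lambda>_. 1"]) simp
next
  case (Suc d)
  show ?case using binary_form_linear_mult[OF Suc, of "- t0" s0] by (simp add: algebra_simps)
qed

section \<open>Maximal minors\<close>

text \<open>The cofactors along row \<open>m0\<close>, that is, the signed maximal minors of the
  other rows: the generalised cross product.\<close>

definition cross :: "'m::finite \<Rightarrow> ('m \<Rightarrow> 'm \<Rightarrow> complex) \<Rightarrow> 'm \<Rightarrow> complex" where
  "cross m0 N j = det (\<chi> i k. if i = m0 then (if k = j then 1 else 0) else N i k)"

lemma cross_dot:
  "(\<Sum>j\<in>UNIV. c j * cross m0 N j) = det (\<chi> i k. if i = m0 then c k else N i k)"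
proof -
  have e: "(\<chi> i k. if i = m0 then f k else N i k) = (\<chi> i. if i = m0 then vec_lambda f else vec_lambda (N i))"
    for f by (simp add: vec_eq_iff)
  have "det (\<chi> i k. if i = m0 then c k else N i k) =
      det (\<chi> i. if i = m0 then (\<Sum>j\<in>UNIV. c j *s axis j 1) else vec_lambda (N i))"
    unfolding e by (intro arg_cong[where f = det]) (simp add: vec_eq_iff axis_def if_distrib cong: if_cong)
  also have "\<dots> = (\<Sum>j\<in>UNIV. c j * det (\<chi> i. if i = m0 then axis j 1 else vec_lambda (N i)))"
    by (subst det_linear_row_sum[where a = "\<lambda>i j. c j *s axis j 1"]) (simp_all only: det_row_mul finite)
  also have "\<dots> = (\<Sum>j\<in>UNIV. c j * cross m0 N j)"
    unfolding cross_def e axis_def ..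
  finally show ?thesis by simp
qed

lemma cross_row: "i \<noteq> m0 \<Longrightarrow> (\<Sum>j\<in>UNIV. N i j * cross m0 N j) = 0"
  unfolding cross_dot by (rule det_identical_rows[of m0 i]) (auto simp: row_def)

lemma matrix_vector_mult_nth: "(A *v v) $ i = (\<Sum>k\<in>UNIV. A $ i $ k * v $ k)"
  by (simp add: matrix_vector_mult_def)

lemma det_nz_iff_trivial_kernel:
  fixes A :: "complex^'m^'m"
  shows "det A \<noteq> 0 \<longleftrightarrow> (\<forall>v. A *v v = 0 \<longrightarrow> v = 0)"
  using matrix_left_invertible_ker[of A]
  by (simp add: invertible_det_nz[symmetric] invertible_left_inverse)

text \<open>One nonzero minor shows that the rows other than \<open>m0\<close> are independent, so
  their common kernel is the line spanned by the vector of minors.\<close>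

lemma cross_kernel:
  assumes "cross m0 N j0 \<noteq> 0" "\<And>i. i \<noteq> m0 \<Longrightarrow> (\<Sum>k\<in>UNIV. N i k * v k) = 0"
  shows "v k = v j0 / cross m0 N j0 * cross m0 N k"
proof -
  define A where "A = (\<chi> i k. if i = m0 then (if k = j0 then 1 else 0) else N i k)"
  define w where "w k = v k - v j0 / cross m0 N j0 * cross m0 N k" for k
  have "A *v (\<chi> k. w k) = 0"
  proof (subst vec_eq_iff, intro allI)
    fix i
    show "(A *v (\<chi> k. w k)) $ i = 0 $ i"
    proof (cases "i = m0")
      case True
      have "(A *v (\<chi> k. w k)) $ i = (\<Sum>k\<in>UNIV. if k = j0 then w k else 0)"
        unfolding matrix_vector_mult_nth using True by (auto simp: A_def if_distrib[of "\<lambda>u. u * _"] cong: if_cong)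
      then show ?thesis using assms(1) by (simp add: w_def)
    next
      case False
      then have "(A *v (\<chi> k. w k)) $ i = (\<Sum>k\<in>UNIV. N i k * w k)"
        by (simp add: matrix_vector_mult_nth A_def)
      also have "\<dots> = (\<Sum>k\<in>UNIV. N i k * v k) - v j0 / cross m0 N j0 * (\<Sum>k\<in>UNIV. N i k * cross m0 N k)"
        by (simp add: w_def algebra_simps sum_subtractf sum_distrib_left)
      finally show ?thesis using assms(2)[OF False] cross_row[OF False] by simp
    qed
  qed
  moreover have "det A \<noteq> 0" using assms(1) by (simp add: A_def cross_def)
  ultimately have "(\<chi> k. w k) = 0" by (simp add: det_nz_iff_trivial_kernel)
  then have "w k = 0" by (simp add: vec_eq_iff)
  then show ?thesis by (simp add: w_def)
qed

text \<open>By \<open>cross_dot\<close> the sum is a determinant. Together with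
  \<open>cross_dot_zero\<close> this decides whether a hyperplane contains the point given by the
  minors without computing any minor.\<close>

lemma cross_dot_nonzero:
  assumes "\<And>v. (\<And>i. i \<noteq> m0 \<Longrightarrow> (\<Sum>k\<in>UNIV. N i k * v k) = 0) \<Longrightarrow> (\<Sum>k\<in>UNIV. c k * v k) = 0 \<Longrightarrow>
    (\<And>k. v k = 0)"
  shows "(\<Sum>j\<in>UNIV. c j * cross m0 N j) \<noteq> 0"
  unfolding cross_dot det_nz_iff_trivial_kernel
proof (intro allI impI)
  fix v assume v: "(\<chi> i k. if i = m0 then c k else N i k) *v v = 0"
  have row: "(\<Sum>k\<in>UNIV. (if i = m0 then c k else N i k) * v $ k) = 0" for i
    using arg_cong[OF v, of "\<lambda>u. u $ i"] by (simp add: matrix_vector_mult_nth)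
  have "v $ k = 0" for k
  proof (rule assms[of "\<lambda>k. v $ k"])
    show "(\<Sum>k\<in>UNIV. N i k * v $ k) = 0" if "i \<noteq> m0" for i using row[of i] that by simp
    show "(\<Sum>k\<in>UNIV. c k * v $ k) = 0" using row[of m0] by simp
  qed
  then show "v = 0" by (simp add: vec_eq_iff)
qed

lemma cross_dot_zero:
  assumes "\<And>i. i \<noteq> m0 \<Longrightarrow> (\<Sum>k\<in>UNIV. N i k * v k) = 0" "(\<Sum>k\<in>UNIV. c k * v k) = 0" "v k0 \<noteq> 0"
  shows "(\<Sum>j\<in>UNIV. c j * cross m0 N j) = 0"
proof (rule ccontr)
  assume "\<not> ?thesis"
  then have "\<forall>u. (\<chi> i k. if i = m0 then c k else N i k) *v u = 0 \<longrightarrow> u = 0"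
    by (simp add: cross_dot det_nz_iff_trivial_kernel)
  moreover have "(\<chi> i k. if i = m0 then c k else N i k) *v (\<chi> k. v k) = 0"
  proof (subst vec_eq_iff, intro allI)
    fix i
    show "((\<chi> i k. if i = m0 then c k else N i k) *v (\<chi> k. v k)) $ i = 0 $ i"
      using assms(1)[of i] assms(2) by (cases "i = m0") (simp_all add: matrix_vector_mult_nth)
  qed
  ultimately have "(\<chi> k. v k) = 0" by blast
  then show False using assms(3) by (simp add: vec_eq_iff)
qed

definition dot :: "('m::finite \<Rightarrow> complex) \<Rightarrow> ('m \<Rightarrow> complex) \<Rightarrow> complex" where
  "dot c x = (\<Sum>j\<in>UNIV. c j * x j)"

lemma dot_add: "dot (\<lambda>j. c j + d j) x = dot c x + dot d x" "dot c (\<lambda>j. x j + y j) = dot c x + dot c y"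
  and dot_diff: "dot (\<lambda>j. c j - d j) x = dot c x - dot d x" "dot c (\<lambda>j. x j - y j) = dot c x - dot c y"
  and dot_scale: "dot (\<lambda>j. r * c j) x = r * dot c x" "dot c (\<lambda>j. r * x j) = r * dot c x"
  by (simp_all add: dot_def distrib_left distrib_right left_diff_distrib right_diff_distrib
      sum.distrib sum_subtractf sum_distrib_left mult_ac)

lemma dot_zero: "dot (\<lambda>j. 0) x = 0" "dot c (\<lambda>j. 0) = 0"
  by (simp_all add: dot_def)

lemma dot_sum: "dot (\<lambda>j. \<Sum>i\<in>I. r i * E i j) x = (\<Sum>i\<in>I. r i * dot (E i) x)"
proof -
  have "dot (\<lambda>j. \<Sum>i\<in>I. r i * E i j) x = (\<Sum>j\<in>UNIV. \<Sum>i\<in>I. r i * (E i j * x j))"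
    unfolding dot_def sum_distrib_right by (simp only: mult.assoc)
  also have "\<dots> = (\<Sum>i\<in>I. r i * dot (E i) x)"
    by (subst sum.swap) (simp add: dot_def sum_distrib_left)
  finally show ?thesis .
qed

section \<open>Curves given by a basis of the binary forms\<close>

definition form_basis :: "nat \<Rightarrow> ('m::finite \<Rightarrow> complex \<Rightarrow> complex \<Rightarrow> complex) \<Rightarrow> bool" where
  "form_basis n G \<longleftrightarrow> (\<forall>i. G i \<in> binary_forms n) \<and>
     (\<forall>H\<in>binary_forms n. \<exists>!c :: complex^'m. H = (\<lambda>s t. \<Sum>i\<in>UNIV. c $ i * G i s t))"

definition curve :: "('m::finite \<Rightarrow> complex \<Rightarrow> complex \<Rightarrow> complex) \<Rightarrow> (complex^'m) set set" where
  "curve G = {vec.span {\<chi> i. G i s t} | s t. (s, t) \<noteq> (0, 0)}"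

abbreviation solution_curve where
  "solution_curve n p l \<Lambda> P C \<equiv> rational_normal_curve C \<and>
     (\<forall>k\<in>{1..p}. P k \<in> C) \<and> (\<forall>k\<in>{1..l}. secant (n - 1) (\<Lambda> k) C)"

abbreviation zero_space :: "('m::finite \<Rightarrow> complex) \<Rightarrow> ('m \<Rightarrow> complex) \<Rightarrow> (complex^'m) set" where
  "zero_space a b \<equiv> {x. (\<Sum>i\<in>UNIV. a i * x $ i) = 0 \<and> (\<Sum>i\<in>UNIV. b i * x $ i) = 0}"

lemma curveI: "(s, t) \<noteq> (0, 0) \<Longrightarrow> vec.span {\<chi> i. G i s t} \<in> curve G"
  unfolding curve_def by blast

lemma rational_normal_curve_iff:
  fixes C :: "(complex^'m::finite) set set"
  shows "rational_normal_curve C \<longleftrightarrow>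
    (\<exists>G :: 'm \<Rightarrow> complex \<Rightarrow> complex \<Rightarrow> complex. form_basis (CARD('m) - 1) G \<and> C = curve G)"
  unfolding rational_normal_curve_def form_basis_def curve_def by (simp only: conj_assoc)

text \<open>Independence implies spanning by dimension: together with H the forms are n + 2 vectors
  with n + 1 coefficients each. In the resulting relation \<open>None\<close> marks the coefficient
  of H.\<close>

lemma form_basisI:
  fixes G :: "'m::finite \<Rightarrow> complex \<Rightarrow> complex \<Rightarrow> complex"
  assumes card: "CARD('m) = n + 1" and G: "\<And>i. G i \<in> binary_forms n"
    and indep: "\<And>c i. (\<And>s t. dot c (\<lambda>i. G i s t) = 0) \<Longrightarrow> c i = 0"
  shows "form_basis n G"
  unfolding form_basis_def
proof (intro conjI allI ballI)
  fix H assume H: "H \<in> binary_forms n"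
  have "\<forall>i. \<exists>p. degree p \<le> n \<and> G i = hom n p" using G binary_forms_iff by blast
  then obtain P where P: "\<And>i. degree (P i) \<le> n" "\<And>i. G i = hom n (P i)" by metis
  obtain p where p: "degree p \<le> n" "H = hom n p" using H binary_forms_iff by blast
  obtain y where y: "\<exists>j\<in>(UNIV :: 'm option set). y j \<noteq> 0"
    "\<And>k. k \<in> {..n} \<Longrightarrow> (\<Sum>j\<in>UNIV. case_option (coeff p k) (\<lambda>i. coeff (P i) k) j * y j) = 0"
    by (rule underdetermined_system[of "{..n}" "UNIV :: 'm option set"
          "\<lambda>k. case_option (coeff p k) (\<lambda>i. coeff (P i) k)"]) (simp_all add: card)
  have "(\<Sum>j\<in>UNIV. case_option (coeff p k) (\<lambda>i. coeff (P i) k) j * y j) =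
      coeff p k * y None + (\<Sum>i\<in>UNIV. coeff (P i) k * y (Some i))" for k
    by (simp add: UNIV_option_conv sum.reindex)
  then have y0: "coeff p k * y None + (\<Sum>i\<in>UNIV. coeff (P i) k * y (Some i)) = 0" if "k \<le> n" for k
    using y(2)[of k] that by simp
  have eq: "y None * H s t + dot (\<lambda>i. y (Some i)) (\<lambda>i. G i s t) = 0" for s t
  proof -
    have "dot (\<lambda>i. y (Some i)) (\<lambda>i. G i s t) =
        (\<Sum>i\<in>UNIV. \<Sum>k\<le>n. coeff (P i) k * y (Some i) * t ^ k * s ^ (n - k))"
      unfolding dot_def P(2) hom_def sum_distrib_left by (simp only: mult_ac)
    also have "\<dots> = (\<Sum>k\<le>n. (\<Sum>i\<in>UNIV. coeff (P i) k * y (Some i)) * t ^ k * s ^ (n - k))"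
      unfolding sum_distrib_right by (rule sum.swap)
    finally have "dot (\<lambda>i. y (Some i)) (\<lambda>i. G i s t) =
        (\<Sum>k\<le>n. (\<Sum>i\<in>UNIV. coeff (P i) k * y (Some i)) * t ^ k * s ^ (n - k))" .
    then have "y None * H s t + dot (\<lambda>i. y (Some i)) (\<lambda>i. G i s t) =
        (\<Sum>k\<le>n. (coeff p k * y None + (\<Sum>i\<in>UNIV. coeff (P i) k * y (Some i))) * t ^ k * s ^ (n - k))"
      unfolding p(2) hom_def distrib_right sum.distrib sum_distrib_left by (simp only: mult_ac)
    then show ?thesis by (simp add: y0)
  qed
  have None: "y None \<noteq> 0"
  proof
    assume "y None = 0"
    then have "y (Some i) = 0" for i using indep[of "\<lambda>i. y (Some i)"] eq by simp
    with \<open>y None = 0\<close> y(1) show False by (metis option.exhaust)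
  qed
  have d: "H = (\<lambda>s t. \<Sum>i\<in>UNIV. (\<chi> i. - y (Some i) / y None) $ i * G i s t)"
  proof (intro ext)
    fix s t
    have "H s t = - dot (\<lambda>i. y (Some i)) (\<lambda>i. G i s t) / y None"
      using eq[of s t] None by (simp add: field_simps add_eq_0_iff)
    then show "H s t = (\<Sum>i\<in>UNIV. (\<chi> i. - y (Some i) / y None) $ i * G i s t)"
      by (simp add: dot_def sum_negf sum_divide_distrib)
  qed
  show "\<exists>!c :: complex^'m. H = (\<lambda>s t. \<Sum>i\<in>UNIV. c $ i * G i s t)"
  proof (rule ex1I[of _ "\<chi> i. - y (Some i) / y None"], rule d)
    fix c :: "complex^'m"
    assume c: "H = (\<lambda>s t. \<Sum>i\<in>UNIV. c $ i * G i s t)"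
    have "dot (\<lambda>i. c $ i - (\<chi> i. - y (Some i) / y None) $ i) (\<lambda>i. G i s t) = 0" for s t
      using fun_cong[OF fun_cong[OF c], of s t] fun_cong[OF fun_cong[OF d], of s t]
      unfolding dot_diff dot_def by simp
    then have "c $ i - (\<chi> i. - y (Some i) / y None) $ i = 0" for i by (rule indep)
    then show "c = (\<chi> i. - y (Some i) / y None)"
      unfolding vec_eq_iff by (metis right_minus_eq)
  qed
qed (rule G)

lemma span_singleton_eqI:
  fixes f g :: "'m::finite \<Rightarrow> complex"
  assumes "\<And>i. f i = c * g i" "c \<noteq> 0"
  shows "vec.span {\<chi> i. f i} = vec.span {\<chi> i. g i}"
proof -
  have "(\<chi> i. f i) = c *s (\<chi> i. g i)" "(\<chi> i. g i) = (1 / c) *s (\<chi> i. f i)"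
    using assms by (simp_all add: vec_eq_iff)
  then have "(\<chi> i. f i) \<in> vec.span {\<chi> i. g i}" "(\<chi> i. g i) \<in> vec.span {\<chi> i. f i}"
    by (metis vec.span_base vec.span_scale singletonI)+
  then show ?thesis unfolding vec.span_eq by blast
qed

lemma span_singleton_eqD:
  fixes f g :: "'m::finite \<Rightarrow> complex"
  assumes "vec.span {\<chi> i. f i} = vec.span {\<chi> i. g i}" "f j \<noteq> 0"
  obtains c where "c \<noteq> 0" "\<And>i. f i = c * g i"
proof -
  have "(\<chi> i. f i) \<in> vec.span {\<chi> i. g i}" using assms(1) by (metis singletonI vec.span_base)
  then obtain c where "(\<chi> i. f i) = c *s (\<chi> i. g i)" by (auto simp: vec.span_singleton)
  then have "f i = c * g i" for i by (simp add: vec_eq_iff)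
  moreover from this[of j] have "c \<noteq> 0" using assms(2) by auto
  ultimately show thesis using that by blast
qed

lemma span_singleton_subset_iff:
  assumes "W = zero_space a b"
  shows "vec.span {\<chi> i. f i} \<subseteq> W \<longleftrightarrow> dot a f = 0 \<and> dot b f = 0"
proof
  assume "vec.span {\<chi> i. f i} \<subseteq> W"
  then have "(\<chi> i. f i) \<in> W" by (metis singletonI subsetD vec.span_base)
  then show "dot a f = 0 \<and> dot b f = 0" by (simp add: assms dot_def)
next
  assume H: "dot a f = 0 \<and> dot b f = 0"
  have "(\<Sum>i\<in>UNIV. a i * (c * f i)) = 0" "(\<Sum>i\<in>UNIV. b i * (c * f i)) = 0" for c
    using H dot_scale(2)[of a c f] dot_scale(2)[of b c f] by (simp_all add: dot_def)
  then show "vec.span {\<chi> i. f i} \<subseteq> W" by (auto simp: assms vec.span_singleton)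
qed

locale basis_curve =
  fixes n :: nat and G :: "'m::finite \<Rightarrow> complex \<Rightarrow> complex \<Rightarrow> complex"
  assumes n: "n \<ge> 1" and basis: "form_basis n G"
begin

abbreviation pt :: "complex \<Rightarrow> complex \<Rightarrow> 'm \<Rightarrow> complex" where
  "pt s t \<equiv> \<lambda>i. G i s t"

lemma G_form: "G i \<in> binary_forms n"
  using basis by (simp add: form_basis_def)

lemma dot_form: "(\<lambda>s t. dot c (pt s t)) \<in> binary_forms n"
  unfolding dot_def by (rule binary_form_sum) (rule G_form)

lemma obtain_dot:
  assumes "H \<in> binary_forms n"
  obtains c where "\<And>s t. dot c (pt s t) = H s t"
proof -
  obtain c :: "complex^'m" where "H = (\<lambda>s t. \<Sum>i\<in>UNIV. c $ i * G i s t)"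
    using basis assms unfolding form_basis_def by blast
  then show thesis by (intro that[of "\<lambda>i. c $ i"]) (simp add: dot_def)
qed

text \<open>Nondegeneracy of the curve: no hyperplane contains all but finitely many of its
  points.\<close>

lemma dot_eq_zero:
  assumes "finite Z" "\<And>z. z \<notin> Z \<Longrightarrow> dot c (pt 1 z) = 0"
  shows "c i = 0"
proof -
  have "(\<lambda>s t. 0) = (\<lambda>s t. \<Sum>i\<in>UNIV. (\<chi> i. c i) $ i * G i s t)"
    using binary_form_eq_zero[OF dot_form[of c] assms] by (simp add: dot_def fun_eq_iff)
  moreover have "(\<lambda>s t. 0) = (\<lambda>s t. \<Sum>i\<in>UNIV. 0 $ i * G i s t)" by simp
  ultimately have "(\<chi> i. c i) = 0"
    using basis binary_form_zero[of n] unfolding form_basis_def by blast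
  then show ?thesis by (simp add: vec_eq_iff)
qed

text \<open>The n-th power of a linear form that is nonzero at (s, t) is a combination of the
  coordinates.\<close>

lemma pt_nonzero:
  assumes "(s, t) \<noteq> (0, 0)"
  obtains j where "G j s t \<noteq> 0"
proof -
  obtain s0 t0 where st: "t * s0 - s * t0 \<noteq> 0"
  proof (cases "s = 0")
    case True
    then show thesis using that[of 1 0] assms by auto
  next
    case False
    then show thesis using that[of 0 1] by auto
  qed
  obtain c where c: "\<And>s t. dot c (pt s t) = (t * s0 - s * t0) ^ n"
    using obtain_dot[OF binary_form_linear_power[OF refl]] by blast
  have "\<exists>j. G j s t \<noteq> 0"
  proof (rule ccontr)
    assume "\<not> ?thesis"
    then have "dot c (pt s t) = 0" by (simp add: dot_def)
    then show False using c st by simp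
  qed
  then show thesis using that by blast
qed

text \<open>The n-th power of the linear form with zero (s', t') is a combination of the coordinates
  and vanishes at no other point.\<close>

lemma pt_separates:
  assumes "\<And>i. G i s t = c * G i s' t'"
  shows "t * s' = s * t'"
proof -
  obtain d where d: "\<And>s t. dot d (pt s t) = (t * s' - s * t') ^ n"
    using obtain_dot[OF binary_form_linear_power[OF refl]] by blast
  have "(t * s' - s * t') ^ n = c * dot d (pt s' t')"
    unfolding d[symmetric] assms by (simp add: dot_scale)
  also have "\<dots> = 0" using n by (simp add: d mult.commute)
  finally show ?thesis by simp
qed

lemma pt_parallel:
  assumes "t * s' = s * t'" "(s, t) \<noteq> (0, 0)" "(s', t') \<noteq> (0, 0)"
  shows "vec.span {\<chi> i. G i s t} = vec.span {\<chi> i. G i s' t'}"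
proof -
  obtain r where r: "r \<noteq> 0" "s = r * s'" "t = r * t'"
  proof (cases "s' = 0")
    case True
    then show thesis using assms that[of "t / t'"] by auto
  next
    case False
    moreover have "s \<noteq> 0" using False assms by auto
    moreover have "t = s / s' * t'" using False assms(1) by (simp add: field_simps)
    ultimately show thesis using that[of "s / s'"] by simp
  qed
  have "H s t = r ^ n * H s' t'" if H: "H \<in> binary_forms n" for H
  proof -
    obtain p where p: "H = hom n p" using H binary_forms_iff by blast
    have "r ^ n = r ^ k * r ^ (n - k)" if "k \<le> n" for k using that by (simp flip: power_add)
    then show ?thesis
      unfolding p hom_def r sum_distrib_left
      by (intro sum.cong refl) (simp add: power_mult_distrib)
  qed
  then show ?thesis using G_form r(1) by (intro span_singleton_eqI[where c = "r ^ n"]) auto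
qed

end

section \<open>The curve attached to a pencil of matrices\<close>

definition wedge :: "('m \<Rightarrow> complex) \<Rightarrow> ('m \<Rightarrow> complex) \<Rightarrow> 'm \<Rightarrow> 'm \<Rightarrow> complex" where
  "wedge a b i j = a i * b j - a j * b i"

text \<open>For \<open>q = wedge a b\<close> this is the member of the pencil of \<open>a\<close>
  and \<open>b\<close> that vanishes at \<open>v\<close>: the equation of the hyperplane spanned by
  \<open>v\<close> and the space a = b = 0, provided that \<open>v\<close> lies off that
  space.\<close>

definition contract :: "('m::finite \<Rightarrow> complex) \<Rightarrow> ('m \<Rightarrow> 'm \<Rightarrow> complex) \<Rightarrow> 'm \<Rightarrow> complex" where
  "contract v q i = (\<Sum>j\<in>UNIV. v j * q j i)"

lemma contract_wedge: "contract v (wedge a b) i = dot a v * b i - dot b v * a i"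
  by (simp add: contract_def wedge_def dot_def algebra_simps sum_subtractf sum_distrib_left)

text \<open>The rows of the projection from the point \<open>v\<close> onto the hyperplane \<open>x\<^bsub>m0\<^esub> = 0\<close>,
  scaled by \<open>v m0\<close>.\<close>

definition proj :: "'m \<Rightarrow> ('m \<Rightarrow> complex) \<Rightarrow> 'm \<Rightarrow> 'm \<Rightarrow> complex" where
  "proj m0 v i j = (if j = i then v m0 else 0) - (if j = m0 then v i else 0)"

lemma dot_proj: "dot (proj m0 v i) x = v m0 * x i - v i * x m0"
  by (simp add: proj_def dot_def left_diff_distrib sum_subtractf if_distrib[of "\<lambda>u. u * _"] cong: if_cong)

lemma proj_m0: "proj m0 v m0 j = 0"
  by (simp add: proj_def)

definition pull :: "('m::finite \<Rightarrow> complex) \<Rightarrow> ('m \<Rightarrow> 'm \<Rightarrow> complex) \<Rightarrow> 'm \<Rightarrow> complex" where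
  "pull c E j = (\<Sum>i\<in>UNIV. c i * E i j)"

lemma dot_pull: "dot (pull c E) x = (\<Sum>i\<in>UNIV. c i * dot (E i) x)"
  using dot_sum[of c E UNIV x] by (simp add: pull_def[abs_def])

text \<open>A linear form that vanishes at \<open>v\<close> factors through the projection from
  \<open>v\<close>.\<close>

lemma pull_proj:
  assumes "dot c v = 0"
  shows "pull c (proj m0 v) j = v m0 * c j"
proof -
  have "pull c (proj m0 v) j = (\<Sum>i\<in>UNIV. c i * (if j = i then v m0 else 0)) -
      (if j = m0 then dot c v else 0)"
    by (simp add: pull_def proj_def dot_def right_diff_distrib sum_subtractf)
  then show ?thesis using assms by (simp add: if_distrib cong: if_cong)
qed

text \<open>The hypothesis says that the triple wedge of \<open>w\<close>, \<open>a\<close> and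
  \<open>b\<close> vanishes; Cramer's rule in the coordinates \<open>j\<close> and \<open>r\<close>
  gives the coefficients. Stated with minors, the condition is polynomial in the Pluecker
  coordinates.\<close>

lemma in_span_wedge:
  assumes q: "wedge a b j r \<noteq> 0"
    and w: "\<And>i. w i * wedge a b j r + w j * wedge a b r i + w r * wedge a b i j = 0"
  obtains x y where "\<And>i. w i = x * a i + y * b i"
proof -
  have "w i = (w j * b r - w r * b j) / wedge a b j r * a i +
      (a j * w r - a r * w j) / wedge a b j r * b i" for i
    using q w[of i] by (simp add: field_simps) (simp add: wedge_def algebra_simps)
  then show thesis by (rule that)
qed

text \<open>The linear system behind the theorem.  Let \<open>\<pi>\<close> be the projection from \<open>P\<^sub>1\<close>.  The unknown
  matrix \<open>E\<close> is to satisfy \<open>E P\<^sub>k = \<rho>\<^sub>k \<pi> P\<^sub>k\<close>, and to pull the hyperplane spanned by \<open>\<Lambda>\<^sub>k\<close>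
  and \<open>P\<^sub>1\<close> back to a hyperplane containing \<open>\<Lambda>\<^sub>k\<close>.  The condition on \<open>E i1 i1\<close> excludes
  the trivial solution \<open>E = \<pi>\<close>.\<close>

definition solves :: "nat \<Rightarrow> nat \<Rightarrow> (nat \<Rightarrow> 'm::finite \<Rightarrow> 'm \<Rightarrow> complex) \<Rightarrow> (nat \<Rightarrow> 'm \<Rightarrow> complex) \<Rightarrow>
    'm \<Rightarrow> 'm \<Rightarrow> ('m \<Rightarrow> 'm \<Rightarrow> complex) \<Rightarrow> (nat \<Rightarrow> complex) \<Rightarrow> bool" where
  "solves l p q v m0 i1 E \<rho> \<longleftrightarrow> (\<forall>j. E m0 j = 0) \<and> E i1 i1 = 0 \<and>
     (\<forall>k\<in>{2..p}. \<forall>i. i \<noteq> m0 \<longrightarrow> dot (E i) (v k) = \<rho> k * dot (proj m0 (v 1) i) (v k)) \<and>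
     (\<forall>k\<in>{1..l}. let w = pull (contract (v 1) (q k)) E in
        \<forall>i j r. w i * q k j r + w j * q k r i + w r * q k i j = 0)"

text \<open>The \<open>n - 1\<close> secant points are common zeros of the two pulled back linear forms.\<close>

lemma (in basis_curve) secant_factor:
  assumes W: "W = zero_space a b"
    and sec: "secant (n - 1) W (curve G)"
  obtains h a1 a2 b1 b2 where "\<And>s t. dot a (pt s t) = h s t * (a1 * s + a2 * t)"
    "\<And>s t. dot b (pt s t) = h s t * (b1 * s + b2 * t)"
proof -
  define X where "X = {x \<in> curve G. x \<subseteq> W}"
  have X: "finite X" "card X = n - 1" using sec by (auto simp: secant_def X_def)
  have "\<forall>x\<in>X. \<exists>\<tau>. \<tau> \<noteq> (0, 0) \<and> x = vec.span {\<chi> i. G i (fst \<tau>) (snd \<tau>)}"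
    by (auto simp: X_def curve_def)
  then obtain f where f: "\<And>x. x \<in> X \<Longrightarrow> f x \<noteq> (0, 0)"
    "\<And>x. x \<in> X \<Longrightarrow> x = vec.span {\<chi> i. G i (fst (f x)) (snd (f x))}" by metis
  define T where "T = f ` X"
  have inj: "inj_on f X" by (rule inj_onI) (metis f(2))
  have T: "finite T" "card T = n - 1" using X inj by (simp_all add: T_def card_image)
  have zeros: "dot a (pt s t) = 0 \<and> dot b (pt s t) = 0" if st: "(s, t) \<in> T" for s t
  proof -
    obtain x where x: "x \<in> X" "(s, t) = f x" using st unfolding T_def by blast
    then have x: "x \<in> X" "f x = (s, t)" by simp_all
    have "vec.span {\<chi> i. G i s t} \<subseteq> W" using x f(2)[OF x(1)] by (auto simp: X_def)
    then show ?thesis using span_singleton_subset_iff[OF W] by blast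
  qed
  have par: "(s, t) = (s', t')" if st: "(s, t) \<in> T" "(s', t') \<in> T" "t * s' = s * t'" for s t s' t'
  proof -
    obtain x x' where "x \<in> X" "(s, t) = f x" "x' \<in> X" "(s', t') = f x'"
      using st unfolding T_def by blast
    then have x: "x \<in> X" "f x = (s, t)" "x' \<in> X" "f x' = (s', t')" by simp_all
    have "x = vec.span {\<chi> i. G i s t}" "x' = vec.span {\<chi> i. G i s' t'}"
      using f(2)[OF x(1), unfolded x(2)] f(2)[OF x(3), unfolded x(4)] by simp_all
    moreover have "(s, t) \<noteq> (0, 0)" "(s', t') \<noteq> (0, 0)"
      using f(1)[OF x(1)] f(1)[OF x(3)] x(2,4) by simp_all
    ultimately have "x = x'" using pt_parallel[OF st(3)] by metis
    then show ?thesis using x by simp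
  qed
  define h where "h s t = (\<Prod>(s0, t0)\<in>T. t * s0 - s * t0)" for s t
  \<comment> \<open>After the n - 1 common zeros are split off, a linear form is left of each of the
    two forms of degree n.\<close>
  have n1: "n - card T = 1" using T n by simp
  have nz: "(s, t) \<noteq> (0, 0)" if "(s, t) \<in> T" for s t
    using that f(1) unfolding T_def by (metis imageE)
  have fac: "\<exists>\<gamma> \<delta>. \<forall>s t. dot c (pt s t) = h s t * (\<gamma> * s + \<delta> * t)"
    if "\<And>s t. (s, t) \<in> T \<Longrightarrow> dot c (pt s t) = 0" for c
  proof -
    obtain H where H: "H \<in> binary_forms (n - card T)" "\<And>s t. dot c (pt s t) = h s t * H s t"
      unfolding h_def
    proof (rule binary_form_factor_set[OF T(1) _ dot_form, of c])
      show "card T \<le> n" using T(2) by simp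
      show "(s, t) \<noteq> (0, 0) \<and> dot c (pt s t) = 0" if "(s, t) \<in> T" for s t
        using that nz \<open>\<And>s t. (s, t) \<in> T \<Longrightarrow> dot c (pt s t) = 0\<close> by blast
      show "(s, t) = (s', t')" if "(s, t) \<in> T" "(s', t') \<in> T" "t * s' = s * t'" for s t s' t'
        using par that by blast
    qed blast
    then show ?thesis using binary_form_one[of H] n1 by metis
  qed
  obtain a1 a2 where A: "\<And>s t. dot a (pt s t) = h s t * (a1 * s + a2 * t)"
    using fac[of a] zeros by blast
  obtain b1 b2 where B: "\<And>s t. dot b (pt s t) = h s t * (b1 * s + b2 * t)"
    using fac[of b] zeros by blast
  show thesis by (rule that[OF A B])
qed

text \<open>The open conditions under which the minors of the pencil parametrise the unique curve.
  By \<open>roots\<close>, the hyperplane through \<open>\<Lambda> k\<close> and \<open>P 1\<close>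
  meets that curve in n - 1 distinct points besides \<open>P 1\<close>, which sits at infinity;
  these become the secant points.\<close>

locale generic_data =
  fixes n p l :: nat and a b :: "nat \<Rightarrow> 'm::finite \<Rightarrow> complex" and v :: "nat \<Rightarrow> 'm \<Rightarrow> complex"
    and \<Lambda> :: "nat \<Rightarrow> (complex^'m) set" and P :: "nat \<Rightarrow> (complex^'m) set"
    and q :: "nat \<Rightarrow> 'm \<Rightarrow> 'm \<Rightarrow> complex"
    and m0 i1 :: 'm and E :: "'m \<Rightarrow> 'm \<Rightarrow> complex" and \<rho> :: "nat \<Rightarrow> complex"
  assumes card: "CARD('m) = n + 1" and n: "n \<ge> 2" and p: "p \<ge> 1"
    and \<Lambda>: "\<And>k. k \<in> {1..l} \<Longrightarrow>
      \<Lambda> k = zero_space (a k) (b k)"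
    and q: "\<And>k. k \<in> {1..l} \<Longrightarrow> q k = wedge (a k) (b k)"
    and P: "\<And>k. k \<in> {1..p} \<Longrightarrow> P k = vec.span {\<chi> i. v k i}"
    and m0: "v 1 m0 \<noteq> 0" "i1 \<noteq> m0"
    and sol: "solves l p q v m0 i1 E \<rho>"
    and only: "\<And>E' \<rho>'. solves l p q v m0 i1 E' \<rho>' \<Longrightarrow> \<exists>c. \<forall>i j. E' i j = c * E i j"
    and off_P1: "\<And>k. k \<in> {1..l} \<Longrightarrow> \<exists>i. contract (v 1) (q k) i \<noteq> 0"
    and points: "\<And>k. k \<in> {2..p} \<Longrightarrow> \<exists>i. dot (proj m0 (v 1) i) (v k) \<noteq> 0"
    and forms: "\<And>j. (\<lambda>s t. cross m0 (\<lambda>i j. s * E i j - t * proj m0 (v 1) i j) j) \<in> binary_forms n"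
    and indep: "\<And>c i. (\<And>s t. dot c (cross m0 (\<lambda>i j. s * E i j - t * proj m0 (v 1) i j)) = 0) \<Longrightarrow> c i = 0"
    and roots: "\<And>k. k \<in> {1..l} \<Longrightarrow>
      card {z. dot (contract (v 1) (q k)) (cross m0 (\<lambda>i j. 1 * E i j - z * proj m0 (v 1) i j)) = 0} = n - 1"
begin

abbreviation \<pi> where "\<pi> \<equiv> proj m0 (v 1)"

definition F :: "'m \<Rightarrow> complex \<Rightarrow> complex \<Rightarrow> complex" where
  "F j s t = cross m0 (\<lambda>i j. s * E i j - t * \<pi> i j) j"

lemma F_basis: "form_basis n F"
proof (rule form_basisI[OF card])
  show "F i \<in> binary_forms n" for i using forms[of i] by (simp add: F_def[abs_def])
  show "c i = 0" if "\<And>s t. dot c (\<lambda>i. F i s t) = 0" for c i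
    using indep[of c] that by (simp add: F_def)
qed

sublocale F: basis_curve n F
  by unfold_locales (use n F_basis in auto)

lemma F_row: "s * dot (E i) (F.pt s t) = t * dot (\<pi> i) (F.pt s t)"
proof (cases "i = m0")
  case True
  then show ?thesis using sol by (simp add: solves_def dot_def proj_m0)
next
  case False
  have "dot (\<lambda>j. s * E i j - t * \<pi> i j) (F.pt s t) = 0"
    using cross_row[OF False, of "\<lambda>i j. s * E i j - t * \<pi> i j"] by (simp add: dot_def F_def)
  then show ?thesis by (simp add: dot_diff dot_scale)
qed

text \<open>Since \<open>F\<close> has no base point, some maximal minor is nonzero and the kernel
  of s E - t \<pi> is a line for every parameter.\<close>

lemma F_kernel:
  assumes "(s, t) \<noteq> (0, 0)" "\<And>i. i \<noteq> m0 \<Longrightarrow> s * dot (E i) x = t * dot (\<pi> i) x"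
  obtains c where "\<And>i. x i = c * F i s t"
proof -
  obtain j where j: "F j s t \<noteq> 0" using F.pt_nonzero[OF assms(1)] by blast
  have "x k = x j / F j s t * F k s t" for k
    unfolding F_def
  proof (rule cross_kernel)
    show "cross m0 (\<lambda>i j. s * E i j - t * \<pi> i j) j \<noteq> 0" using j by (simp add: F_def)
    show "(\<Sum>k\<in>UNIV. (s * E i k - t * \<pi> i k) * x k) = 0" if "i \<noteq> m0" for i
      using assms(2)[OF that] dot_diff(1)[of "\<lambda>k. s * E i k" "\<lambda>k. t * \<pi> i k" x]
      by (simp add: dot_def[symmetric] dot_scale)
  qed
  then show thesis by (rule that)
qed

lemma F_span:
  assumes "(s, t) \<noteq> (0, 0)" "\<And>i. i \<noteq> m0 \<Longrightarrow> s * dot (E i) x = t * dot (\<pi> i) x" "x j \<noteq> 0"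
  shows "vec.span {\<chi> i. x i} = vec.span {\<chi> i. F i s t}"
proof -
  obtain c where c: "\<And>i. x i = c * F i s t" using F_kernel[OF assms(1,2)] by blast
  moreover from c[of j] have "c \<noteq> 0" using assms(3) by auto
  ultimately show ?thesis by (rule span_singleton_eqI)
qed

lemma proj_kernel:
  assumes "\<And>i. i \<noteq> m0 \<Longrightarrow> dot (\<pi> i) x = 0"
  shows "x i = x m0 / v 1 m0 * v 1 i"
  using assms[of i] m0(1) by (cases "i = m0") (auto simp: dot_proj field_simps)

text \<open>At the parameter (0, 1) the pencil is -\<pi>, with kernel \<open>v 1\<close>; at (1,
  \<open>\<rho> k\<close>) its kernel contains \<open>v k\<close> by the point equations.\<close>

lemma points_on_curve:
  assumes k: "k \<in> {1..p}"
  shows "P k \<in> curve F"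
proof (cases "k = 1")
  case True
  have "vec.span {\<chi> i. v 1 i} = vec.span {\<chi> i. F i 0 1}"
    by (rule F_span[of _ _ _ m0]) (use m0 in \<open>auto simp: dot_proj\<close>)
  then show ?thesis using P[OF k] True curveI[of 0 1 F] by simp
next
  case False
  then have k': "k \<in> {2..p}" using k by auto
  obtain j where j: "v k j \<noteq> 0"
  proof -
    obtain i where "dot (\<pi> i) (v k) \<noteq> 0" using points[OF k'] by blast
    then have "\<exists>j. v k j \<noteq> 0" unfolding dot_proj by (metis mult_zero_right diff_self)
    then show thesis using that by blast
  qed
  have "vec.span {\<chi> i. v k i} = vec.span {\<chi> i. F i 1 (\<rho> k)}"
    by (rule F_span[of _ _ _ j]) (use sol k' j in \<open>auto simp: solves_def\<close>)
  then show ?thesis using P[OF k] curveI[of 1 "\<rho> k" F] by simp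
qed

context
  fixes k assumes k: "k \<in> {1..l}"
begin

definition \<alpha> where "\<alpha> = contract (v 1) (q k)"

lemma \<alpha>_eq: "\<alpha> i = dot (a k) (v 1) * b k i - dot (b k) (v 1) * a k i"
  by (simp add: \<alpha>_def q[OF k] contract_wedge)

lemma dot_\<alpha>: "dot \<alpha> x = dot (a k) (v 1) * dot (b k) x - dot (b k) (v 1) * dot (a k) x"
  by (simp add: \<alpha>_eq[abs_def] dot_diff dot_scale)

lemma \<alpha>_v1: "dot \<alpha> (v 1) = 0"
  by (simp add: dot_\<alpha>)

lemma \<alpha>_nonzero: "\<exists>i. \<alpha> i \<noteq> 0"
  using off_P1[OF k] by (simp add: \<alpha>_def)

lemma v1_off: "dot (a k) (v 1) \<noteq> 0 \<or> dot (b k) (v 1) \<noteq> 0"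
  using \<alpha>_nonzero by (auto simp: \<alpha>_eq)

lemma wedge_nonzero: "\<exists>j r. wedge (a k) (b k) j r \<noteq> 0"
proof (rule ccontr)
  assume "\<not> ?thesis"
  then have "\<alpha> i = 0" for i by (simp add: \<alpha>_def q[OF k] contract_def)
  then show False using \<alpha>_nonzero by blast
qed

lemma pull_\<alpha>_span:
  obtains x y where "\<And>i. pull \<alpha> E i = x * a k i + y * b k i"
proof -
  obtain j r where jr: "wedge (a k) (b k) j r \<noteq> 0" using wedge_nonzero by blast
  have "pull \<alpha> E i * wedge (a k) (b k) j r + pull \<alpha> E j * wedge (a k) (b k) r i +
      pull \<alpha> E r * wedge (a k) (b k) i j = 0" for i
    using sol k q[OF k] unfolding solves_def Let_def \<alpha>_def by metis
  then show thesis using in_span_wedge[OF jr, of "pull \<alpha> E"] that by blast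
qed

lemma \<alpha>_F_not_cofinitely_zero: "finite Z \<Longrightarrow> \<exists>z. z \<notin> Z \<and> dot \<alpha> (F.pt 1 z) \<noteq> 0"
  using F.dot_eq_zero[of Z \<alpha>] \<alpha>_nonzero by metis

text \<open>At infinity the curve passes through \<open>P 1\<close>, which is off
  \<open>\<Lambda> k\<close>. Elsewhere, if \<alpha> vanishes then so does its pullback by E. Both
  lie in the pencil of \<open>a k\<close> and \<open>b k\<close> and they are independent, so the
  whole pencil vanishes.\<close>

lemma incidence_iff:
  assumes st: "(s, t) \<noteq> (0, 0)"
  shows "vec.span {\<chi> i. F i s t} \<subseteq> \<Lambda> k \<longleftrightarrow> s \<noteq> 0 \<and> dot \<alpha> (F.pt s t) = 0"
  unfolding span_singleton_subset_iff[OF \<Lambda>[OF k]]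
proof
  assume ab: "dot (a k) (F.pt s t) = 0 \<and> dot (b k) (F.pt s t) = 0"
  have "s \<noteq> 0"
  proof
    assume s: "s = 0"
    have "dot (\<pi> i) (F.pt s t) = 0" for i using F_row[of s i t] s st by simp
    then have *: "F i s t = F m0 s t / v 1 m0 * v 1 i" for i
      using proj_kernel[of "F.pt s t" i] by simp
    have "dot c (F.pt s t) = F m0 s t / v 1 m0 * dot c (v 1)" for c
      by (subst *) (rule dot_scale)
    moreover have "F m0 s t \<noteq> 0" using F.pt_nonzero[OF st] * by (metis div_0 mult_zero_left)
    ultimately have "dot (a k) (v 1) = 0" "dot (b k) (v 1) = 0" using ab m0 by auto
    then show False using v1_off by simp
  qed
  then show "s \<noteq> 0 \<and> dot \<alpha> (F.pt s t) = 0" using ab by (simp add: dot_\<alpha>)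
next
  assume H: "s \<noteq> 0 \<and> dot \<alpha> (F.pt s t) = 0"
  obtain x' y' where w: "\<And>i. pull \<alpha> E i = x' * a k i + y' * b k i"
    using pull_\<alpha>_span by blast
  \<comment> \<open>The row identities \<open>s E F = t \<pi> F\<close>, weighted by \<alpha>; \<pi>
    only rescales \<alpha> because \<alpha> vanishes at \<open>v 1\<close>.\<close>
  have pullF: "s * dot (pull \<alpha> E) (F.pt s t) = t * v 1 m0 * dot \<alpha> (F.pt s t)" for s t
  proof -
    have "s * dot (pull \<alpha> E) (F.pt s t) = (\<Sum>i\<in>UNIV. \<alpha> i * (s * dot (E i) (F.pt s t)))"
      by (simp add: dot_pull sum_distrib_left mult_ac)
    also have "\<dots> = t * dot (pull \<alpha> \<pi>) (F.pt s t)"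
      by (simp add: F_row dot_pull sum_distrib_left mult_ac)
    also have "dot (pull \<alpha> \<pi>) (F.pt s t) = v 1 m0 * dot \<alpha> (F.pt s t)"
      using pull_proj[OF \<alpha>_v1] dot_scale(1)[of "v 1 m0" \<alpha>] by presburger
    finally show ?thesis by simp
  qed
  define A B where "A = dot (a k) (F.pt s t)" and "B = dot (b k) (F.pt s t)"
  define x y where "x = - dot (b k) (v 1)" and "y = dot (a k) (v 1)"
  have \<alpha>_xy: "\<alpha> i = x * a k i + y * b k i" for i by (simp add: \<alpha>_eq x_def y_def)
  have "dot (pull \<alpha> E) (F.pt s t) = 0" using pullF[of s t] H by simp
  then have eq1: "x' * A + y' * B = 0"
    by (simp add: w[abs_def] dot_add dot_scale A_def B_def)
  have eq2: "x * A + y * B = 0" using H by (simp add: \<alpha>_xy[abs_def] dot_add dot_scale A_def B_def)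
  \<comment> \<open>If the pullback were a multiple \<xi> of \<alpha>, then \<alpha> would vanish at
    every point of the curve with affine parameter different from
    \<open>\<xi> / v 1 m0\<close>.\<close>
  have "x * y' \<noteq> x' * y"
  proof
    assume par: "x * y' = x' * y"
    define \<xi> where "\<xi> = (if x = 0 then y' / y else x' / x)"
    have "x \<noteq> 0 \<or> y \<noteq> 0" using v1_off by (auto simp: x_def y_def)
    then have "x' = \<xi> * x" "y' = \<xi> * y" using par by (auto simp: \<xi>_def field_simps)
    then have "pull \<alpha> E i = \<xi> * \<alpha> i" for i by (simp add: w \<alpha>_xy algebra_simps)
    then have "dot (pull \<alpha> E) u = \<xi> * dot \<alpha> u" for u
      using dot_scale(1)[of \<xi> \<alpha>] by presburger
    then have zero: "(\<xi> - z * v 1 m0) * dot \<alpha> (F.pt 1 z) = 0" for z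
      using pullF[of 1 z] by (simp add: algebra_simps)
    obtain z where "z \<notin> {\<xi> / v 1 m0}" "dot \<alpha> (F.pt 1 z) \<noteq> 0"
      using \<alpha>_F_not_cofinitely_zero[of "{\<xi> / v 1 m0}"] by auto
    then show False using zero[of z] m0 by (auto simp: field_simps)
  qed
  moreover have "(x * y' - x' * y) * A = 0" "(x * y' - x' * y) * B = 0"
    using eq1 eq2 by algebra+
  ultimately show "dot (a k) (F.pt s t) = 0 \<and> dot (b k) (F.pt s t) = 0"
    by (simp add: A_def B_def)
qed

text \<open>No point at infinity lies in \<open>\<Lambda> k\<close>, so the affine roots of \<alpha>
  count all secant points.\<close>

lemma secant_F: "secant (n - 1) (\<Lambda> k) (curve F)"
proof -
  define Z where "Z = {z. dot \<alpha> (F.pt 1 z) = 0}"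
  let ?f = "\<lambda>z. vec.span {\<chi> i. F i 1 z}"
  have "{x \<in> curve F. x \<subseteq> \<Lambda> k} = ?f ` Z"
  proof (intro equalityI subsetI)
    fix x assume "x \<in> {x \<in> curve F. x \<subseteq> \<Lambda> k}"
    then obtain s t where st: "(s, t) \<noteq> (0, 0)" "x = vec.span {\<chi> i. F i s t}" "x \<subseteq> \<Lambda> k"
      by (auto simp: curve_def)
    then have s: "s \<noteq> 0" using incidence_iff by blast
    then have "x = ?f (t / s)" using st F.pt_parallel[of t 1 s "t / s"] by simp
    moreover from this st have "t / s \<in> Z" using incidence_iff[of 1 "t / s"] by (simp add: Z_def)
    ultimately show "x \<in> ?f ` Z" by blast
  next
    fix x assume "x \<in> ?f ` Z"
    then show "x \<in> {x \<in> curve F. x \<subseteq> \<Lambda> k}"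
      using incidence_iff[of 1] curveI[of 1 _ F] by (auto simp: Z_def)
  qed
  moreover have "inj_on ?f Z"
  proof (rule inj_onI)
    fix z z' assume eq: "?f z = ?f z'"
    obtain j where "F j 1 z \<noteq> 0" using F.pt_nonzero[of 1 z] by auto
    with eq obtain c where "\<And>i. F i 1 z = c * F i 1 z'" using span_singleton_eqD by blast
    then show "z = z'" using F.pt_separates[of 1 z c 1 z'] by simp
  qed
  moreover have "card Z = n - 1"
    using roots[OF k] by (simp add: Z_def \<alpha>_def F_def)
  moreover from this have "finite Z" using n by (intro card_ge_0_finite) auto
  ultimately show ?thesis by (simp add: secant_def card_image)
qed

text \<open>On the curve, all forms of the pencil are a common factor h times linear forms, and
  every linear form occurs. The one of \<alpha> vanishes at the parameter of \<open>P 1\<close>; a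
  suitable member of the pencil has the linear form m. For the matrix of the curve this becomes the
  secancy equation of \<open>solves\<close>.\<close>

lemma pencil_of_secant_curve:
  assumes G: "basis_curve n G" and sec: "secant (n - 1) (\<Lambda> k) (curve G)"
    and st0: "v 1 = (\<lambda>i. \<kappa> * G i s0 t0)" "(s0, t0) \<noteq> (0, 0)"
    and m: "\<And>s t. m s t = s * cs + t * ct" "m s0 t0 = 1"
  obtains lam x y where "\<And>s t. m s t * dot \<alpha> (\<lambda>i. G i s t) =
      (t * s0 - s * t0) * lam * dot (\<lambda>i. x * a k i + y * b k i) (\<lambda>i. G i s t)"
proof -
  interpret G: basis_curve n G by (rule G)
  obtain h a1 a2 b1 b2 where A: "\<And>s t. dot (a k) (G.pt s t) = h s t * (a1 * s + a2 * t)"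
    and B: "\<And>s t. dot (b k) (G.pt s t) = h s t * (b1 * s + b2 * t)"
    by (rule G.secant_factor[OF \<Lambda>[OF k] sec]) blast
  have zero_comb: "x = 0 \<and> y = 0" if "x * a1 + y * b1 = 0" "x * a2 + y * b2 = 0" for x y
  proof -
    have "dot (\<lambda>i. x * a k i + y * b k i) (G.pt s t) = h s t * ((x * a1 + y * b1) * s + (x * a2 + y * b2) * t)"
      for s t by (simp add: dot_add dot_scale A B algebra_simps)
    then have "x * a k i + y * b k i = 0" for i
      using G.dot_eq_zero[of "{}" "\<lambda>i. x * a k i + y * b k i"] that by simp
    then have *: "x * a k i = - (y * b k i)" for i by (simp add: eq_neg_iff_add_eq_0)
    obtain j r where jr: "a k j * b k r - a k r * b k j \<noteq> 0"
      using wedge_nonzero by (auto simp: wedge_def)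
    have "x * (a k j * b k r - a k r * b k j) = 0" "y * (a k j * b k r - a k r * b k j) = 0"
      using *[of j] *[of r] by algebra+
    then show ?thesis using jr by simp
  qed
  have det: "a1 * b2 - a2 * b1 \<noteq> 0"
  proof
    assume "a1 * b2 - a2 * b1 = 0"
    then have "b2 = 0 \<and> - a2 = 0" "b1 = 0 \<and> - a1 = 0"
      using zero_comb[of b2 "- a2"] zero_comb[of b1 "- a1"] by (simp_all add: algebra_simps)
    then show False using zero_comb[of 1 0] by simp
  qed
  have v1: "dot c (v 1) = \<kappa> * dot c (G.pt s0 t0)" for c
    unfolding st0(1) by (rule dot_scale)
  have h0: "h s0 t0 \<noteq> 0"
    using v1_off v1 A B by auto
  define L1 L2 where "L1 = dot (a k) (v 1) * b1 - dot (b k) (v 1) * a1"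
    and "L2 = dot (a k) (v 1) * b2 - dot (b k) (v 1) * a2"
  have \<alpha>G: "dot \<alpha> (G.pt s t) = h s t * (L1 * s + L2 * t)" for s t
    by (simp add: dot_\<alpha> A B L1_def L2_def algebra_simps)
  have "\<kappa> \<noteq> 0" using m0(1) st0(1) by auto
  then have "L1 * s0 + L2 * t0 = 0" using \<alpha>_v1 v1[of \<alpha>] \<alpha>G[of s0 t0] h0 by simp
  \<comment> \<open>Solves L1 = - lam t0 and L2 = lam s0, using m(s0, t0) = 1 and that the form L1 s
    + L2 t vanishes at (s0, t0).\<close>
  define lam where "lam = L2 * cs - L1 * ct"
  have m1: "s0 * cs + t0 * ct = 1" using m by simp
  have L: "L1 * s + L2 * t = lam * (t * s0 - s * t0)" for s t
  proof -
    have "L1 = - lam * t0" "L2 = lam * s0"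
      using m1 \<open>L1 * s0 + L2 * t0 = 0\<close> unfolding lam_def by algebra+
    then show ?thesis by (simp add: algebra_simps)
  qed
  \<comment> \<open>Cramer's rule for the member of the pencil whose linear factor is m.\<close>
  define x y where "x = (cs * b2 - ct * b1) / (a1 * b2 - a2 * b1)"
    and "y = (ct * a1 - cs * a2) / (a1 * b2 - a2 * b1)"
  have xy: "x * a1 + y * b1 = cs" "x * a2 + y * b2 = ct"
    using det by (simp_all add: x_def y_def divide_simps) (simp_all add: algebra_simps)
  have "dot (\<lambda>i. x * a k i + y * b k i) (G.pt s t) = h s t * m s t" for s t
  proof -
    have "dot (\<lambda>i. x * a k i + y * b k i) (G.pt s t) = h s t * ((x * a1 + y * b1) * s + (x * a2 + y * b2) * t)"
      by (simp add: dot_add dot_scale A B algebra_simps)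
    then show ?thesis unfolding xy m by (simp add: mult_ac)
  qed
  then have "m s t * dot \<alpha> (G.pt s t) =
      (t * s0 - s * t0) * lam * dot (\<lambda>i. x * a k i + y * b k i) (G.pt s t)" for s t
    by (simp add: \<alpha>G L)
  then show thesis by (rule that)
qed

end

text \<open>Any other solution curve G yields a matrix \<open>EG\<close> with ll EG G = m \<pi> G,
  where ll and m are linear forms in the parameters and ll vanishes at \<open>P 1\<close>.
  Normalised, it solves the linear system, so it is c E + d \<pi>, and G is F after a linear change
  of parameters.\<close>

lemma curve_unique:
  assumes G: "form_basis n G" and inc: "\<And>k. k \<in> {1..p} \<Longrightarrow> P k \<in> curve G"
    and sec: "\<And>k. k \<in> {1..l} \<Longrightarrow> secant (n - 1) (\<Lambda> k) (curve G)"
  shows "curve G = curve F"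
proof -
  interpret G: basis_curve n G by unfold_locales (use n G in auto)
  have on_curve: "\<exists>s t c. (s, t) \<noteq> (0, 0) \<and> c \<noteq> 0 \<and> v k = (\<lambda>i. c * G i s t)"
    if k: "k \<in> {1..p}" and nz: "v k j \<noteq> 0" for k j
  proof -
    obtain s t where st: "(s, t) \<noteq> (0, 0)" "vec.span {\<chi> i. v k i} = vec.span {\<chi> i. G i s t}"
      using inc[OF k] P[OF k] by (auto simp: curve_def)
    obtain c where "c \<noteq> 0" "\<And>i. v k i = c * G i s t" 
      using span_singleton_eqD[of "v k" "G.pt s t" j] st(2) nz by metis
    then have "v k = (\<lambda>i. c * G i s t)" "c \<noteq> 0" by auto
    then show ?thesis using st(1) by blast
  qed
  obtain s0 t0 \<kappa> where st0: "(s0, t0) \<noteq> (0, 0)" "\<kappa> \<noteq> 0" "v 1 = (\<lambda>i. \<kappa> * G i s0 t0)"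
    using on_curve[of 1 m0] p m0 by auto
  \<comment> \<open>A linear form m with value 1 at (s0, t0); with ll it forms a basis of the linear
    forms.\<close>
  define cs ct where "cs = (if s0 = 0 then 0 else 1 / s0)" and "ct = (if s0 = 0 then 1 / t0 else 0)"
  have cst: "s0 * cs + t0 * ct = 1" using st0(1) by (auto simp: cs_def ct_def)
  define ll m where "ll s t = t * s0 - s * t0" and "m s t = s * cs + t * ct" for s t
  have inv: "(s, t) = (0, 0)" if "ll s t = 0" "m s t = 0" for s t
  proof -
    have "s = 0" "t = 0" using that cst unfolding ll_def m_def by algebra+
    then show ?thesis by simp
  qed
  have ll_finite: "finite {z. r * ll 1 z = r' * m 1 z}" if "r \<noteq> 0 \<or> r' \<noteq> 0" for r r'
  proof -
    define p where "p = [:- r * t0 - r' * cs, r * s0 - r' * ct:]"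
    have "p \<noteq> 0"
    proof
      assume "p = 0"
      then have "- r * t0 - r' * cs = 0" "r * s0 - r' * ct = 0" by (simp_all add: p_def)
      then have "r = 0" "r' = 0" using cst by algebra+
      then show False using that by simp
    qed
    moreover have "{z. r * ll 1 z = r' * m 1 z} = {z. poly p z = 0}"
      by (auto simp: p_def ll_def m_def algebra_simps)
    ultimately show ?thesis by (simp add: poly_roots_finite)
  qed
  \<comment> \<open>The restriction of \<open>\<pi> i\<close> to the curve vanishes at
    \<open>P 1\<close> and is divisible by ll. Exchanging that factor for m gives a form of degree
    n, hence the restriction of a linear form.\<close>
  have "\<exists>d. \<forall>s t. ll s t * dot d (G.pt s t) = m s t * dot (\<pi> i) (G.pt s t)" for i
  proof -
    have "dot (\<pi> i) (v 1) = 0" by (simp add: dot_proj)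
    moreover have "dot (\<pi> i) (v 1) = \<kappa> * dot (\<pi> i) (G.pt s0 t0)"
      using dot_scale(2)[of "\<pi> i" \<kappa> "G.pt s0 t0"] st0(3) by metis
    ultimately have "dot (\<pi> i) (G.pt s0 t0) = 0" using st0(2) by simp
    moreover obtain n' where n': "n = Suc n'" using n by (cases n) auto
    ultimately obtain H where H: "H \<in> binary_forms n'"
      "\<And>s t. dot (\<pi> i) (G.pt s t) = (t * s0 - s * t0) * H s t"
      using binary_form_factor[of "\<lambda>s t. dot (\<pi> i) (G.pt s t)" n' s0 t0] G.dot_form st0(1) by metis
    obtain d where d: "\<And>s t. dot d (G.pt s t) = (cs * s + ct * t) * H s t"
      using G.obtain_dot[of "\<lambda>s t. (cs * s + ct * t) * H s t"] binary_form_linear_mult[OF H(1)] n' by blast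
    then have "ll s t * dot d (G.pt s t) = m s t * dot (\<pi> i) (G.pt s t)" for s t
      unfolding H(2) d ll_def m_def by (simp only: mult_ac)
    then show ?thesis by blast
  qed
  then obtain D where D: "\<And>i s t. ll s t * dot (D i) (G.pt s t) = m s t * dot (\<pi> i) (G.pt s t)"
    by metis
  define EG where "EG i = (if i = m0 then (\<lambda>_. 0) else D i)" for i
  have EG: "ll s t * dot (EG i) (G.pt s t) = m s t * dot (\<pi> i) (G.pt s t)" for i s t
    using D by (auto simp: EG_def dot_def proj_m0)
  have "\<forall>k\<in>{2..p}. \<exists>r. \<forall>i. dot (EG i) (v k) = r * dot (\<pi> i) (v k)"
  proof
    fix k assume k: "k \<in> {2..p}"
    obtain i where i: "dot (\<pi> i) (v k) \<noteq> 0" using points[OF k] by blast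
    then have "\<exists>j. v k j \<noteq> 0" unfolding dot_proj by (metis mult_zero_right diff_self)
    then obtain j where "v k j \<noteq> 0" by blast
    then obtain s t c where st: "(s, t) \<noteq> (0, 0)" "c \<noteq> 0" "v k = (\<lambda>i. c * G i s t)"
      using on_curve[of k j] k by auto
    have vk: "ll s t * dot (EG i) (v k) = m s t * dot (\<pi> i) (v k)" for i
      using EG[of s t i] by (simp add: st(3) dot_scale)
    have "ll s t \<noteq> 0"
    proof
      assume l0: "ll s t = 0"
      then have "m s t = 0" using vk[of i] i by simp
      then show False using inv[OF l0] st(1) by simp
    qed
    then have "dot (EG i) (v k) = m s t / ll s t * dot (\<pi> i) (v k)" for i
      using vk[of i] by (simp add: field_simps)
    then show "\<exists>r. \<forall>i. dot (EG i) (v k) = r * dot (\<pi> i) (v k)" by blast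
  qed
  then obtain rG where rG: "\<And>k i. k \<in> {2..p} \<Longrightarrow> dot (EG i) (v k) = rG k * dot (\<pi> i) (v k)"
    by metis
  \<comment> \<open>Subtracting d \<pi> makes the entry at (i1, i1) zero and preserves the other
    equations, all of which \<pi> satisfies.\<close>
  define d where "d = EG i1 i1 / v 1 m0"
  define E' where "E' i j = EG i j - d * \<pi> i j" for i j
  have E': "dot (E' i) x = dot (EG i) x - d * dot (\<pi> i) x" for i x
    by (simp add: E'_def[abs_def] dot_diff dot_scale)
  have "solves l p q v m0 i1 E' (\<lambda>k. rG k - d)"
    unfolding solves_def
  proof (intro conjI allI ballI impI)
    show "E' m0 j = 0" for j by (simp add: E'_def EG_def proj_m0)
    show "E' i1 i1 = 0" using m0 by (simp add: E'_def d_def proj_def)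
    show "dot (E' i) (v k) = (rG k - d) * dot (\<pi> i) (v k)" if "k \<in> {2..p}" for k i
      using rG[OF that] by (simp add: E' algebra_simps)
    show "let w = pull (contract (v 1) (q k)) E' in
        \<forall>i j r. w i * q k j r + w j * q k r i + w r * q k i j = 0" if k: "k \<in> {1..l}" for k
    proof -
      obtain lam x y where lam: "\<And>s t. m s t * dot (\<alpha> k) (G.pt s t) =
          (t * s0 - s * t0) * lam * dot (\<lambda>i. x * a k i + y * b k i) (G.pt s t)"
        by (rule pencil_of_secant_curve[OF k G.basis_curve_axioms sec[OF k] st0(3,1), of m cs ct])
          (use cst in \<open>auto simp: m_def\<close>)
      \<comment> \<open>The difference of two linear forms that agree on the curve wherever ll is
        nonzero, hence zero.\<close>
      define c where "c i = pull (\<alpha> k) EG i - v 1 m0 * lam * (x * a k i + y * b k i)" for i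
      have "ll s t * dot c (G.pt s t) = 0" for s t
      proof -
        have "ll s t * dot (pull (\<alpha> k) EG) (G.pt s t) = (\<Sum>i\<in>UNIV. \<alpha> k i * (ll s t * dot (EG i) (G.pt s t)))"
          by (simp add: dot_pull sum_distrib_left mult_ac)
        also have "\<dots> = m s t * dot (pull (\<alpha> k) \<pi>) (G.pt s t)"
          by (simp add: EG dot_pull sum_distrib_left mult_ac)
        also have "dot (pull (\<alpha> k) \<pi>) (G.pt s t) = v 1 m0 * dot (\<alpha> k) (G.pt s t)"
          using pull_proj[OF \<alpha>_v1[OF k]] dot_scale(1)[of "v 1 m0" "\<alpha> k"] by presburger
        finally have "ll s t * dot (pull (\<alpha> k) EG) (G.pt s t) = m s t * (v 1 m0 * dot (\<alpha> k) (G.pt s t))" .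
        moreover have "dot c (G.pt s t) = dot (pull (\<alpha> k) EG) (G.pt s t) -
            v 1 m0 * lam * dot (\<lambda>i. x * a k i + y * b k i) (G.pt s t)"
          unfolding c_def[abs_def] dot_diff dot_scale ..
        ultimately show ?thesis using lam[of s t] unfolding ll_def by algebra
      qed
      moreover have "finite {z. ll 1 z = 0}" using ll_finite[of 1 0] by simp
      ultimately have "c i = 0" for i
        by (intro G.dot_eq_zero[of "{z. ll 1 z = 0}" c]) auto
      then have "pull (\<alpha> k) EG i = v 1 m0 * lam * (x * a k i + y * b k i)" for i by (simp add: c_def)
      moreover have "pull (\<alpha> k) E' i = pull (\<alpha> k) EG i - d * (v 1 m0 * \<alpha> k i)" for i
        using pull_proj[OF \<alpha>_v1[OF k], of m0 i]
        by (simp add: pull_def E'_def right_diff_distrib sum_subtractf sum_distrib_left[symmetric] mult.left_commute[of _ d])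
      ultimately have "pull (\<alpha> k) E' i = (v 1 m0 * lam * x + d * v 1 m0 * dot (b k) (v 1)) * a k i +
          (v 1 m0 * lam * y - d * v 1 m0 * dot (a k) (v 1)) * b k i" for i
        by (simp add: \<alpha>_eq[OF k] algebra_simps)
      then obtain X Y where XY: "\<And>i. pull (\<alpha> k) E' i = X * a k i + Y * b k i" by blast
      show ?thesis
        unfolding Let_def \<alpha>_def[OF k, symmetric] XY by (simp add: q[OF k] wedge_def algebra_simps)
    qed
  qed
  then obtain c where c: "\<And>i j. E' i j = c * E i j" using only by metis
  have EGc: "dot (EG i) x = c * dot (E i) x + d * dot (\<pi> i) x" for i x
    using E'[of i x] c by (simp add: dot_scale c[abs_def])
  \<comment> \<open>With c = 0, the nonzero linear form \<open>\<pi> i1\<close> would vanish on the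
    curve wherever d ll and m differ.\<close>
  have "c \<noteq> 0"
  proof
    assume "c = 0"
    then have "(d * ll s t - m s t) * dot (\<pi> i1) (G.pt s t) = 0" for s t
      using EG[of s t i1] EGc[of i1] by (simp add: algebra_simps)
    moreover have "finite {z. d * ll 1 z = 1 * m 1 z}" by (rule ll_finite) simp
    ultimately have "\<pi> i1 i1 = 0"
      by (intro G.dot_eq_zero[of "{z. d * ll 1 z = 1 * m 1 z}" "\<pi> i1"]) auto
    then show False using m0 by (simp add: proj_def)
  qed
  have span: "vec.span {\<chi> i. G i s t} = vec.span {\<chi> i. F i (c * ll s t) (m s t - d * ll s t)}"
    if st: "(s, t) \<noteq> (0, 0)" for s t
  proof -
    obtain j where j: "G j s t \<noteq> 0" using G.pt_nonzero[OF st] by blast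
    show ?thesis
    proof (rule F_span[of _ _ "G.pt s t", OF _ _ j])
      show "(c * ll s t, m s t - d * ll s t) \<noteq> (0, 0)"
        using inv[of s t] st \<open>c \<noteq> 0\<close> by auto
      show "c * ll s t * dot (E i) (G.pt s t) = (m s t - d * ll s t) * dot (\<pi> i) (G.pt s t)" for i
        using EG[of s t i] EGc[of i "G.pt s t"] by (simp add: algebra_simps)
    qed
  qed
  show ?thesis
  proof (intro equalityI subsetI)
    fix x assume "x \<in> curve G"
    then obtain s t where st: "(s, t) \<noteq> (0, 0)" "x = vec.span {\<chi> i. G i s t}" by (auto simp: curve_def)
    moreover have "(c * ll s t, m s t - d * ll s t) \<noteq> (0, 0)"
      using inv[of s t] st \<open>c \<noteq> 0\<close> by auto
    ultimately show "x \<in> curve F" using span curveI by metis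
  next
    fix x assume "x \<in> curve F"
    then obtain s' t' where st': "(s', t') \<noteq> (0, 0)" "x = vec.span {\<chi> i. F i s' t'}"
      by (auto simp: curve_def)
    \<comment> \<open>Inverts the change of parameters from (s, t) to (c ll, m - d ll).\<close>
    define L M where "L = s' / c" and "M = t' + d * L"
    define s t where "s = M * s0 - L * ct" and "t = M * t0 + L * cs"
    have "ll s t = L" "m s t = M" using cst unfolding ll_def m_def s_def t_def by algebra+
    then have eq: "c * ll s t = s'" "m s t - d * ll s t = t'" using \<open>c \<noteq> 0\<close> by (simp_all add: L_def M_def)
    have "(s, t) \<noteq> (0, 0)" using eq st'(1) by (auto simp: ll_def m_def)
    then show "x \<in> curve G" using span[of s t] st'(2) eq curveI by metis
  qed
qed

lemma unique_curve:
  "\<exists>!C. solution_curve n p l \<Lambda> P C"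
proof
  show "rational_normal_curve (curve F) \<and> (\<forall>k\<in>{1..p}. P k \<in> curve F) \<and>
      (\<forall>k\<in>{1..l}. secant (n - 1) (\<Lambda> k) (curve F))"
    using F_basis card points_on_curve secant_F by (auto simp: rational_normal_curve_iff)
next
  fix C
  assume C: "solution_curve n p l \<Lambda> P C"
  then obtain G :: "'m \<Rightarrow> complex \<Rightarrow> complex \<Rightarrow> complex" where "form_basis n G" "C = curve G"
    using card by (auto simp: rational_normal_curve_iff)
  then show "C = curve F" using curve_unique C by blast
qed

end

section \<open>A configuration on the standard curve\<close>

text \<open>In the affine coordinate \<open>t/s\<close> on the standard curve, put \<open>P\<^sub>1\<close> at infinity and \<open>P\<^sub>j\<close> at
  \<open>j - 2\<close>, and let \<open>\<Lambda>\<^sub>k\<close> be the span of the points at the roots of \<open>trunc_exp n k\<close>, the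
  truncated exponential series of \<open>k z\<close>.  Besides strict log-concavity of the coefficients, we use that
  this polynomial is squarefree and positive on the natural numbers.\<close>

definition ec :: "nat \<Rightarrow> nat \<Rightarrow> complex" where
  "ec n m = (if m < n then 1 / fact m else 0)"

definition trunc_exp :: "nat \<Rightarrow> nat \<Rightarrow> complex poly" where
  "trunc_exp n k = (\<Sum>m<n. monom (ec n m * of_nat k ^ m) m)"

lemma ec_nonzero: "m < n \<Longrightarrow> ec n m \<noteq> 0" and ec_zero: "m \<ge> n \<Longrightarrow> ec n m = 0"
  and ec_0: "n \<ge> 1 \<Longrightarrow> ec n 0 = 1"
  by (simp_all add: ec_def)

lemma ec_log_concave:
  assumes "Suc r < n"
  shows "ec n (Suc r) ^ 2 - ec n r * ec n (Suc (Suc r)) \<noteq> 0"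
proof (cases "Suc (Suc r) < n")
  case True
  have f: "fact (Suc r) = (of_nat (Suc r) * fact r :: complex)"
    "fact (Suc (Suc r)) = (of_nat (Suc (Suc r)) * (of_nat (Suc r) * fact r) :: complex)"
    by simp_all
  have nz: "(of_nat (Suc r) :: complex) \<noteq> 0" "(of_nat (Suc (Suc r)) :: complex) \<noteq> 0" "(fact r :: complex) \<noteq> 0"
    by (simp_all del: of_nat_Suc)
  \<comment> \<open>Over the common denominator the two products become r + 2 and r + 1, which
    differ. In the other case the second product is cut off by the truncation.\<close>
  have "ec n (Suc r) ^ 2 * ((of_nat (Suc r) * fact r) ^ 2 * of_nat (Suc (Suc r)) :: complex) = of_nat (Suc (Suc r))"
    using True nz unfolding ec_def f by (simp add: power2_eq_square del: of_nat_Suc)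
  moreover have "ec n r * ec n (Suc (Suc r)) * ((of_nat (Suc r) * fact r) ^ 2 * of_nat (Suc (Suc r)) :: complex) = of_nat (Suc r)"
    using True nz unfolding ec_def f by (simp add: power2_eq_square del: of_nat_Suc)
  moreover have "(of_nat (Suc (Suc r)) :: complex) \<noteq> of_nat (Suc r)" by simp
  ultimately show ?thesis by (metis right_minus_eq)
next
  case False
  then show ?thesis using ec_nonzero[OF assms] by (simp add: ec_zero)
qed

lemma coeff_trunc_exp: "coeff (trunc_exp n k) m = ec n m * of_nat k ^ m"
proof -
  have "coeff (trunc_exp n k) m = (\<Sum>i<n. if i = m then ec n i * of_nat k ^ i else 0)"
    by (simp add: trunc_exp_def coeff_sum coeff_monom eq_commute cong: if_cong)
  then show ?thesis by (simp add: ec_def)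
qed

lemma poly_trunc_exp: "poly (trunc_exp n k) z = (\<Sum>m<n. ec n m * of_nat k ^ m * z ^ m)"
  by (simp add: trunc_exp_def poly_sum poly_monom)

lemma trunc_exp_nonzero_at_nat:
  assumes "n \<ge> 1"
  shows "poly (trunc_exp n k) (of_nat j) \<noteq> 0"
proof -
  define r :: real where "r = (\<Sum>m<n. 1 / fact m * real k ^ m * real j ^ m)"
  have "poly (trunc_exp n k) (of_nat j) = of_real r"
    by (simp add: poly_trunc_exp r_def ec_def)
  \<comment> \<open>All terms are nonnegative, and the constant one is 1.\<close>
  moreover have "r \<ge> (\<Sum>m\<in>{0}. 1 / fact m * real k ^ m * real j ^ m)"
    unfolding r_def using assms by (intro sum_mono2) auto
  ultimately show ?thesis by simp
qed

lemma degree_trunc_exp: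
  assumes "n \<ge> 1" "k \<ge> 1"
  shows "degree (trunc_exp n k) = n - 1"
proof (rule antisym)
  show "degree (trunc_exp n k) \<le> n - 1"
    by (rule degree_le) (auto simp: coeff_trunc_exp ec_def)
  show "n - 1 \<le> degree (trunc_exp n k)"
    by (rule le_degree) (use assms in \<open>auto simp: coeff_trunc_exp ec_def\<close>)
qed

text \<open>The derivative is k times the polynomial without its top term, so a common root is a
  root of the top term. That leaves 0, where the value is 1.\<close>

lemma rsquarefree_trunc_exp:
  assumes "n \<ge> 1" "k \<ge> 1"
  shows "rsquarefree (trunc_exp n k)"
  unfolding rsquarefree_roots
proof (intro allI notI)
  fix z assume z: "poly (trunc_exp n k) z = 0 \<and> poly (pderiv (trunc_exp n k)) z = 0"
  have deriv: "pderiv (trunc_exp n k) = smult (of_nat k) (trunc_exp n k - monom (ec n (n - 1) * of_nat k ^ (n - 1)) (n - 1))"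
  proof (rule poly_eqI)
    fix m
    have "(1 + of_nat m) * (1 / fact (Suc m)) = (1 / fact m :: complex)"
      by (simp add: divide_simps del: of_nat_Suc) (simp add: algebra_simps)
    then show "coeff (pderiv (trunc_exp n k)) m =
        coeff (smult (of_nat k) (trunc_exp n k - monom (ec n (n - 1) * of_nat k ^ (n - 1)) (n - 1))) m"
      using assms by (auto simp: coeff_pderiv coeff_trunc_exp coeff_monom ec_def)
  qed
  have "of_nat k * (ec n (n - 1) * of_nat k ^ (n - 1) * z ^ (n - 1)) = 0"
    using conjunct1[OF z] conjunct2[OF z, unfolded deriv] by (simp add: poly_monom)
  then have "z ^ (n - 1) = 0" using assms ec_nonzero[of "n - 1" n] by auto
  then have "z = of_nat 0" using assms by (cases "n = 1") auto
  then show False using z trunc_exp_nonzero_at_nat[OF assms(1), of k 0] by simp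
qed

lemma card_of_nat_image: "card (of_nat ` A :: complex set) = card A"
  by (intro card_image inj_onI) simp

lemma poly_eq_on_nats:
  fixes f g :: "complex poly"
  assumes "\<And>k. k \<in> {a..b} \<Longrightarrow> poly f (of_nat k) = poly g (of_nat k)"
    and "degree f + a \<le> b" "degree g + a \<le> b"
  shows "f = g"
  by (rule poly_eqI_degree[of "of_nat ` {a..b}"]) (use assms in \<open>auto simp: card_of_nat_image\<close>)

lemma degree_monom_mult_le:
  fixes f :: "complex poly"
  assumes "degree f + r \<le> d"
  shows "degree (monom 1 r * f) \<le> d"
  using degree_mult_le[of "monom 1 r" f] assms degree_monom_le[of "1 :: complex" r] by linarith

lemma degree_of_monom_mult:
  fixes f :: "complex poly"
  assumes "degree (monom 1 r * f) \<le> d" "f \<noteq> 0"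
  shows "degree f + r \<le> d"
  using assms by (simp add: degree_mult_eq degree_monom_eq)

text \<open>\<open>D m\<close> is row m of E as a polynomial in the parameter z of the standard
  curve, on which row m of \<pi> is z^m. By \<open>sec\<close>, the pulled back form lies in the
  pencil of \<open>trunc_exp n k\<close> and z times it. Each case is to give D m = (x + y z) z^m, a
  combination of \<pi> and multiplication by z.\<close>

locale multiplier =
  fixes n p l :: nat and D :: "nat \<Rightarrow> complex poly" and \<rho> :: "nat \<Rightarrow> complex"
  assumes n: "n \<ge> 2" and p: "p \<ge> 1" and pl: "p + l = n + 3"
    and deg: "\<And>m. m < n \<Longrightarrow> degree (D m) \<le> n"
    and pts: "\<And>j m. j \<in> {2..p} \<Longrightarrow> m < n \<Longrightarrow> poly (D m) (of_nat (j - 2)) = \<rho> j * of_nat (j - 2) ^ m"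
    and sec: "\<And>k. k \<in> {1..l} \<Longrightarrow> \<exists>x y. (\<Sum>m<n. smult (ec n m * of_nat k ^ m) (D m)) = [:x, y:] * trunc_exp n k"
begin

abbreviation Dh :: "nat \<Rightarrow> complex poly" where
  "Dh k \<equiv> \<Sum>m<n. smult (ec n m * of_nat k ^ m) (D m)"

text \<open>Evaluates the space condition at a point and cancels \<open>trunc_exp\<close>, which is
  nonzero there: every point ties the unknown x and y of all spaces to its own \<rho>.\<close>

lemma value_at_point:
  assumes j: "j \<in> {2..p}" and k: "Dh k = [:x, y:] * trunc_exp n k"
  shows "x + of_nat (j - 2) * y = \<rho> j"
proof -
  have "(x + of_nat (j - 2) * y) * poly (trunc_exp n k) (of_nat (j - 2)) =
      poly (Dh k) (of_nat (j - 2))"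
    by (simp add: k distrib_right)
  also have "\<dots> = (\<Sum>m<n. ec n m * of_nat k ^ m * (\<rho> j * of_nat (j - 2) ^ m))"
    using pts[OF j] by (simp add: poly_sum)
  also have "\<dots> = \<rho> j * poly (trunc_exp n k) (of_nat (j - 2))"
    by (simp add: poly_trunc_exp sum_distrib_left mult_ac)
  finally show ?thesis using trunc_exp_nonzero_at_nat[of n k "j - 2"] n by simp
qed

text \<open>The transposed view: the coefficients of degree r of all \<open>D m\<close>, as a
  polynomial in the index k of the space, so that the spaces become interpolation nodes.\<close>

definition Q :: "nat \<Rightarrow> complex poly" where
  "Q r = (\<Sum>m<n. monom (ec n m * coeff (D m) r) m)"

lemma coeff_Q: "coeff (Q r) m = (if m < n then ec n m * coeff (D m) r else 0)"
proof -
  have "coeff (Q r) m = (\<Sum>i<n. if i = m then ec n i * coeff (D i) r else 0)"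
    by (simp add: Q_def coeff_sum coeff_monom eq_commute cong: if_cong)
  then show ?thesis by simp
qed

lemma degree_Q: "degree (Q r) \<le> n - 1"
  by (rule degree_le) (auto simp: coeff_Q)

lemma poly_Q: "poly (Q r) (of_nat k) = coeff (Dh k) r"
  by (simp add: Q_def poly_sum poly_monom coeff_sum mult_ac)

lemma poly_Q_eq:
  assumes "Dh k = [:x, y:] * trunc_exp n k"
  shows "poly (Q 0) (of_nat k) = x"
    and "poly (Q (Suc r)) (of_nat k) = x * ec n (Suc r) * of_nat k ^ Suc r + y * ec n r * of_nat k ^ r"
  using n by (simp_all add: poly_Q assms coeff_trunc_exp ec_0 mult_ac)

lemma D_of_Q:
  assumes Q0: "Q 0 = [:x:]"
    and QS: "\<And>r. r < n \<Longrightarrow> Q (Suc r) = monom (x * ec n (Suc r)) (Suc r) + monom (y * ec n r) r"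
    and m: "m < n"
  shows "D m = [:x, y:] * monom 1 m"
proof (rule poly_eqI)
  fix r
  have R: "coeff ([:x, y:] * monom 1 m) r = (if r = m then x else 0) + (if r = Suc m then y else 0)"
    by (auto simp: coeff_monom coeff_pCons split: nat.split)
  show "coeff (D m) r = coeff ([:x, y:] * monom 1 m) r"
  proof (cases r)
    case 0
    have "ec n m * coeff (D m) 0 = coeff (Q 0) m" using m by (simp add: coeff_Q)
    also have "\<dots> = (if m = 0 then x else 0)" by (simp add: Q0 coeff_pCons split: nat.split)
    finally show ?thesis using R 0 n m ec_0[of n] ec_nonzero[OF m] by (auto split: if_splits)
  next
    case (Suc r')
    show ?thesis
    proof (cases "r' < n")
      case True
      have "ec n m * coeff (D m) r = coeff (Q (Suc r')) m" using m Suc by (simp add: coeff_Q)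
      also have "\<dots> = (if r = m then x * ec n m else 0) + (if r = Suc m then y * ec n m else 0)"
        unfolding QS[OF True] using Suc by (auto simp: coeff_monom)
      also have "\<dots> = ec n m * coeff ([:x, y:] * monom 1 m) r" unfolding R by simp
      finally show ?thesis using ec_nonzero[OF m] by simp
    next
      case False
      then have "coeff (D m) r = 0" using deg[OF m] Suc by (intro coeff_eq_0) simp
      then show ?thesis unfolding R using False Suc m by simp
    qed
  qed
qed

text \<open>\<open>D (Suc m)\<close> and z times \<open>D m\<close> have degree at most n + 1 and
  agree at n + 2 points. So D m = z^m D 0, and the bound on the last row forces \<open>D 0\<close>
  to be linear.\<close>

lemma multiplier_0:
  assumes l: "l = 0"
  shows "\<exists>x y. \<forall>m<n. D m = [:x, y:] * monom 1 m"
proof -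
  have step: "D (Suc m) = monom 1 1 * D m" if m: "Suc m < n" for m
  proof (rule poly_eq_on_nats[of 0 "n + 1"])
    fix k assume "k \<in> {0..n + 1}"
    then have "k + 2 \<in> {2..p}" using pl l by simp
    from pts[OF this, of m] pts[OF this, of "Suc m"]
    show "poly (D (Suc m)) (of_nat k) = poly (monom 1 1 * D m) (of_nat k)"
      using m by (simp add: poly_monom)
  qed (use deg[of m] deg[of "Suc m"] m degree_monom_mult_le[of "D m" 1 "n + 1"] in auto)
  have D: "D m = monom 1 m * D 0" if "m < n" for m
    using that
  proof (induction m)
    case (Suc m)
    then have "D (Suc m) = monom 1 1 * (monom 1 m * D 0)" using step[of m] by simp
    then show ?case by (simp add: mult_monom flip: mult.assoc)
  qed (simp flip: one_poly_def add: monom_0)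
  have "degree (D 0) \<le> 1"
  proof (cases "D 0 = 0")
    case False
    then show ?thesis
      using degree_of_monom_mult[of "n - 1" "D 0" n] D[of "n - 1"] deg[of "n - 1"] n by simp
  qed simp
  then have "D 0 = [:coeff (D 0) 0, coeff (D 0) 1:]"
    by (intro poly_eqI) (auto simp: coeff_pCons coeff_eq_0 split: nat.split)
  then obtain x y where "D 0 = [:x, y:]" by blast
  then show ?thesis using D by (metis mult.commute)
qed

text \<open>The single space fixes x and y, hence all \<rho>; each row is then determined by its
  values at n + 1 points.\<close>

lemma multiplier_1:
  assumes l: "l = 1"
  shows "\<exists>x y. \<forall>m<n. D m = [:x, y:] * monom 1 m"
proof -
  obtain x y where xy: "Dh 1 = [:x, y:] * trunc_exp n 1"
    using sec[of 1] l by auto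
  have "D m = [:x, y:] * monom 1 m" if m: "m < n" for m
  proof (rule poly_eq_on_nats[of 0 n])
    fix k assume "k \<in> {0..n}"
    then have k: "k + 2 \<in> {2..p}" using pl l by simp
    have "\<rho> (k + 2) = x + of_nat k * y" using value_at_point[OF k xy] by simp
    then show "poly (D m) (of_nat k) = poly ([:x, y:] * monom 1 m) (of_nat k)"
      using pts[OF k m] by (simp add: poly_monom algebra_simps)
  next
    show "degree (D m) + 0 \<le> n" using deg[OF m] by simp
    have "degree [:x, y:] \<le> 1" by simp
    then show "degree ([:x, y:] * monom 1 m) + 0 \<le> n"
      using m degree_monom_mult_le[of "[:x, y:]" m n] by (simp add: mult.commute)
  qed
  then show ?thesis by blast
qed

text \<open>Two points besides \<open>P\<^sub>1\<close> fix x and y for all spaces; each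
  \<open>Q r\<close>, of degree at most n - 1, is then known at n nodes.\<close>

lemma multiplier_n:
  assumes l: "l = n"
  shows "\<exists>x y. \<forall>m<n. D m = [:x, y:] * monom 1 m"
proof -
  define x y where "x = \<rho> 2" and "y = \<rho> 3 - \<rho> 2"
  have eq: "Dh k = [:x, y:] * trunc_exp n k" if k: "k \<in> {1..n}" for k
  proof -
    obtain x' y' where xy: "Dh k = [:x', y':] * trunc_exp n k"
      using sec[of k] l k by auto
    have "x' = x" "y' = y" using value_at_point[OF _ xy, of 2] value_at_point[OF _ xy, of 3] pl l n
      by (auto simp: x_def y_def algebra_simps)
    then show ?thesis using xy by simp
  qed
  have "Q 0 = [:x:]"
    by (rule poly_eq_on_nats[of 1 n]) (use poly_Q_eq(1)[OF eq] degree_Q[of 0] n in auto)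
  moreover have "Q (Suc r) = monom (x * ec n (Suc r)) (Suc r) + monom (y * ec n r) r" if r: "r < n" for r
  proof (rule poly_eq_on_nats[of 1 n])
    show "degree (monom (x * ec n (Suc r)) (Suc r) + monom (y * ec n r) r) + 1 \<le> n"
    proof -
      have "degree (monom (x * ec n (Suc r)) (Suc r)) \<le> n - 1"
        using r degree_monom_le[of "x * ec n (Suc r)" "Suc r"] by (cases "Suc r < n") (auto simp: ec_zero)
      moreover have "degree (monom (y * ec n r) r) \<le> n - 1"
        using r degree_monom_le[of "y * ec n r" r] by simp
      ultimately show ?thesis
        using degree_add_le[of _ "n - 1"] n by fastforce
    qed
  qed (use poly_Q_eq(2)[OF eq] degree_Q[of "Suc r"] n in \<open>auto simp: poly_monom\<close>)
  ultimately show ?thesis using D_of_Q by blast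
qed

text \<open>One point besides \<open>P\<^sub>1\<close> fixes x, while y may depend on k and is
  interpolated by \<open>Q' 0\<close>. Inductively \<open>Q' r\<close> is \<open>ec n r\<close>
  times k^r \<open>Q' 0\<close>, both sides of degree at most n on n + 1 nodes. For r = n - 1 the
  degree bound makes \<open>Q' 0\<close> constant.\<close>

lemma multiplier_Suc_n:
  assumes l: "l = n + 1"
  shows "\<exists>x y. \<forall>m<n. D m = [:x, y:] * monom 1 m"
proof -
  define x where "x = \<rho> 2"
  have "\<forall>k\<in>{1..n + 1}. \<exists>y. Dh k = [:x, y:] * trunc_exp n k"
  proof
    fix k assume k: "k \<in> {1..n + 1}"
    obtain x' y where xy: "Dh k = [:x', y:] * trunc_exp n k"
      using sec[of k] l k by auto
    have "x' = x" using value_at_point[OF _ xy, of 2] pl l n by (auto simp: x_def)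
    then show "\<exists>y. Dh k = [:x, y:] * trunc_exp n k"
      using xy by blast
  qed
  then obtain Y where eq: "\<And>k. k \<in> {1..n + 1} \<Longrightarrow>
      Dh k = [:x, Y k:] * trunc_exp n k" by metis
  have Q0: "Q 0 = [:x:]"
    by (rule poly_eq_on_nats[of 1 "n + 1"]) (use poly_Q_eq(1)[OF eq] degree_Q[of 0] n in auto)
  define Q' where "Q' r = Q (Suc r) - monom (x * ec n (Suc r)) (Suc r)" for r
  have degQ': "degree (Q' r) \<le> n - 1" if "r < n" for r
  proof -
    have "degree (monom (x * ec n (Suc r)) (Suc r)) \<le> n - 1"
      using that degree_monom_le[of "x * ec n (Suc r)" "Suc r"] by (cases "Suc r < n") (auto simp: ec_zero)
    then show ?thesis unfolding Q'_def using degree_Q by (intro degree_diff_le)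
  qed
  have polyQ': "poly (Q' r) (of_nat k) = Y k * ec n r * of_nat k ^ r" if "k \<in> {1..n + 1}" for r k
    using poly_Q_eq(2)[OF eq[OF that], of r] by (simp add: Q'_def poly_monom)
  have Q'_eq: "Q' r = smult (ec n r) (monom 1 r * Q' 0)" if "r < n" for r
    using that
  proof (induction r)
    case 0
    then show ?case using n by (simp add: ec_0 monom_0)
  next
    case (Suc r)
    then have "degree (monom 1 r * Q' 0) \<le> n - 1"
      using degQ'[of r] ec_nonzero[of r n] by simp
    then have "degree (monom 1 (Suc r) * Q' 0) \<le> n"
      using degree_of_monom_mult[of r "Q' 0" "n - 1"] n
      by (cases "Q' 0 = 0") (auto intro!: degree_monom_mult_le)
    show ?case
    proof (rule poly_eq_on_nats[of 1 "n + 1"])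
      show "poly (Q' (Suc r)) (of_nat k) = poly (smult (ec n (Suc r)) (monom 1 (Suc r) * Q' 0)) (of_nat k)"
        if "k \<in> {1..n + 1}" for k
        using polyQ'[OF that] n by (simp add: poly_monom ec_0)
      show "degree (Q' (Suc r)) + 1 \<le> n + 1" using degQ'[OF Suc.prems] n by simp
      show "degree (smult (ec n (Suc r)) (monom 1 (Suc r) * Q' 0)) + 1 \<le> n + 1"
        using \<open>degree (monom 1 (Suc r) * Q' 0) \<le> n\<close> by simp
    qed
  qed
  have "degree (Q' 0) = 0"
  proof (cases "Q' 0 = 0")
    case False
    then show ?thesis
      using degree_of_monom_mult[of "n - 1" "Q' 0" "n - 1"] Q'_eq[of "n - 1"] degQ'[of "n - 1"]
        ec_nonzero[of "n - 1" n] n by simp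
  qed simp
  then obtain y where y: "Q' 0 = [:y:]" by (metis degree_eq_zeroE)
  have "Q (Suc r) = monom (x * ec n (Suc r)) (Suc r) + monom (y * ec n r) r" if "r < n" for r
  proof -
    have "Q' r = monom (y * ec n r) r"
      unfolding Q'_eq[OF that] y by (simp add: smult_monom mult.commute[of "monom 1 r"])
    then show ?thesis by (simp add: Q'_def algebra_simps)
  qed
  then show ?thesis using D_of_Q Q0 by blast
qed

text \<open>Now both x and y may depend on k; A and B interpolate them. The n + 2 nodes suffice as
  long as the two summands of \<open>M r\<close> have bounded degree separately, which strict
  log-concavity provides.\<close>

lemma multiplier_Suc_Suc_n:
  assumes l: "l = n + 2"
  shows "\<exists>x y. \<forall>m<n. D m = [:x, y:] * monom 1 m"
proof -
  have "\<forall>k\<in>{1..n + 2}. \<exists>x y. Dh k = [:x, y:] * trunc_exp n k"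
    using sec l by simp
  then obtain X Y where eq: "\<And>k. k \<in> {1..n + 2} \<Longrightarrow>
      Dh k = [:X k, Y k:] * trunc_exp n k" by metis
  define A where "A = Q 0"
  define B where "B = Q 1 - smult (ec n 1) (monom 1 1 * A)"
  have A: "poly A (of_nat k) = X k" if "k \<in> {1..n + 2}" for k
    using poly_Q_eq(1)[OF eq[OF that]] by (simp add: A_def)
  have B: "poly B (of_nat k) = Y k" if "k \<in> {1..n + 2}" for k
    using poly_Q_eq(2)[OF eq[OF that], of 0] A[OF that] n
    by (simp add: B_def poly_monom ec_0 algebra_simps)
  define M where "M r = smult (ec n (Suc r)) (monom 1 (Suc r) * A) + smult (ec n r) (monom 1 r * B)" for r
  have polyM: "poly (Q (Suc r)) (of_nat k) = poly (M r) (of_nat k)" if "k \<in> {1..n + 2}" for r k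
    using poly_Q_eq(2)[OF eq[OF that], of r] A[OF that] B[OF that]
    by (simp add: M_def poly_monom algebra_simps)
  have shift: "monom 1 1 * (monom 1 r * f) = monom 1 (Suc r) * f" for r and f :: "complex poly"
    by (simp add: mult_monom flip: mult.assoc)
  have deg_shift: "degree (monom 1 (Suc r) * f) \<le> Suc d" if "degree (monom 1 r * f) \<le> d"
    for r d and f :: "complex poly"
    using degree_monom_mult_le[of "monom 1 r * f" 1 "Suc d"] that unfolding shift by simp
  have J: "Q (Suc r) = M r \<and> degree (monom 1 (Suc r) * A) \<le> n \<and> degree (monom 1 r * B) \<le> n"
    if "r < n" for r
    using that
  proof (induction r)
    case 0
    have degA: "degree (monom 1 1 * A) \<le> n"
      using degree_Q[of 0] n by (intro degree_monom_mult_le) (simp add: A_def)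
    moreover have "degree B \<le> n"
      unfolding B_def using degree_Q[of 1] n degA
      by (intro degree_diff_le) (auto intro: order_trans[OF degree_smult_le])
    moreover have "Q (Suc 0) = M 0" using n by (simp add: M_def B_def ec_0 monom_0)
    ultimately show ?case by (simp add: monom_0)
  next
    case (Suc r)
    then have IH: "Q (Suc r) = M r" "degree (monom 1 (Suc r) * A) \<le> n" "degree (monom 1 r * B) \<le> n"
      by auto
    have "degree (M (Suc r)) \<le> Suc n"
      unfolding M_def using deg_shift[OF IH(2)] deg_shift[OF IH(3)]
      by (intro degree_add_le order_trans[OF degree_smult_le])
    then have QM: "Q (Suc (Suc r)) = M (Suc r)"
      using polyM degree_Q[of "Suc (Suc r)"] n by (intro poly_eq_on_nats[of 1 "n + 2"]) auto
    \<comment> \<open>Multiplication by k of \<open>Q (Suc r)\<close>, and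
      \<open>Q (Suc (Suc r))\<close>, are two combinations of \<open>?U\<close> and
      \<open>?V\<close> with determinant \<Delta>. Solving for \<open>?U\<close> and
      \<open>?V\<close> excludes cancellation of their leading terms.\<close>
    define \<Delta> where "\<Delta> = ec n (Suc r) ^ 2 - ec n r * ec n (Suc (Suc r))"
    have \<Delta>: "\<Delta> \<noteq> 0" unfolding \<Delta>_def by (rule ec_log_concave[OF Suc.prems])
    let ?U = "monom 1 (Suc (Suc r)) * A" and ?V = "monom 1 (Suc r) * B"
    have XQ: "monom 1 1 * Q (Suc r) = smult (ec n (Suc r)) ?U + smult (ec n r) ?V"
      unfolding IH(1) M_def by (simp only: distrib_left mult_smult_right shift)
    have degXQ: "degree (monom 1 1 * Q (Suc r)) \<le> n"
      using degree_Q[of "Suc r"] n by (intro degree_monom_mult_le) simp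
    have degQ: "degree (Q (Suc (Suc r))) \<le> n" using degree_Q[of "Suc (Suc r)"] by simp
    have "smult \<Delta> ?U = smult (ec n (Suc r)) (monom 1 1 * Q (Suc r)) - smult (ec n r) (Q (Suc (Suc r)))"
      unfolding XQ QM unfolding M_def \<Delta>_def
      by (simp add: smult_add_right smult_diff_left power2_eq_square mult_ac)
    then have "degree (smult \<Delta> ?U) \<le> n"
      using degXQ degQ by (auto intro!: degree_diff_le order_trans[OF degree_smult_le])
    moreover have "smult \<Delta> ?V = smult (ec n (Suc r)) (Q (Suc (Suc r))) - smult (ec n (Suc (Suc r))) (monom 1 1 * Q (Suc r))"
      unfolding XQ QM unfolding M_def \<Delta>_def
      by (simp add: smult_add_right smult_diff_left power2_eq_square mult_ac)
    then have "degree (smult \<Delta> ?V) \<le> n"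
      using degXQ degQ by (auto intro!: degree_diff_le order_trans[OF degree_smult_le])
    ultimately show ?case using QM \<Delta> by simp
  qed
  have "degree A = 0"
  proof (cases "A = 0")
    case False
    then show ?thesis using degree_of_monom_mult[of n A n] J[of "n - 1"] n by simp
  qed simp
  then obtain x where x: "A = [:x:]" by (metis degree_eq_zeroE)
  have "degree B = 0"
  proof (cases "B = 0")
    case False
    \<comment> \<open>At the last step \<open>ec n n = 0\<close> removes the summand with A, so the
      sharper bound n - 1 applies to B alone.\<close>
    have "Q n = smult (ec n (n - 1)) (monom 1 (n - 1) * B)"
      using J[of "n - 1"] n by (simp add: M_def ec_zero)
    then have "degree (monom 1 (n - 1) * B) \<le> n - 1"
      using degree_Q[of n] ec_nonzero[of "n - 1" n] n by simp
    then show ?thesis using degree_of_monom_mult[of "n - 1" B "n - 1"] False by simp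
  qed simp
  then obtain y where y: "B = [:y:]" by (metis degree_eq_zeroE)
  have "Q (Suc r) = monom (x * ec n (Suc r)) (Suc r) + monom (y * ec n r) r" if "r < n" for r
    using J[OF that] unfolding M_def x y
    by (simp add: smult_monom mult.commute[of "monom 1 _"] mult.commute[of x] mult.commute[of y])
  then show ?thesis using D_of_Q x by (metis A_def)
qed

lemma multiplier:
  assumes "l \<in> {0, 1, n, n + 1, n + 2}"
  shows "\<exists>x y. \<forall>m<n. D m = [:x, y:] * monom 1 m"
  using assms multiplier_0 multiplier_1 multiplier_n multiplier_Suc_n multiplier_Suc_Suc_n by blast

end

declare One_nat_def [simp del]

lemma mult_if_zero:
  "y * (if B then x else 0) = (if B then y * x else (0 :: complex))"
  "(if B then x else 0) * y = (if B then x * y else (0 :: complex))"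
  by simp_all

section \<open>The standard configuration and its pencil of matrices\<close>

locale standard_configuration =
  fixes n p l :: nat and e :: "'m::finite \<Rightarrow> nat"
  assumes bij: "bij_betw e UNIV {..n}" and n: "n \<ge> 2" and p: "p \<ge> 1" and pl: "p + l = n + 3"
begin

definition ei :: "nat \<Rightarrow> 'm" where "ei = inv_into UNIV e"

lemma e_le: "e i \<le> n" using bij by (auto simp: bij_betw_def)

lemma ei_e: "ei (e i) = i" using bij by (simp add: ei_def bij_betw_inv_into_left)

lemma e_ei: "m \<le> n \<Longrightarrow> e (ei m) = m" using bij by (simp add: ei_def bij_betw_inv_into_right)

lemma e_inj: "e i = e j \<longleftrightarrow> i = j" by (metis ei_e)

lemma sum_e: "(\<Sum>i\<in>UNIV. f i) = (\<Sum>m\<le>n. f (ei m))" for f :: "'m \<Rightarrow> complex"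
proof -
  have "(\<Sum>m\<le>n. f (ei m)) = (\<Sum>i\<in>UNIV. f (ei (e i)))"
    using sum.reindex_bij_betw[OF bij, of "\<lambda>m. f (ei m)"] by simp
  then show ?thesis by (simp add: ei_e)
qed

definition m0 where "m0 = ei n"
definition i1 where "i1 = ei 0"

lemma e_m0: "e m0 = n" and e_i1: "e i1 = 0"
  by (simp_all add: m0_def i1_def e_ei)

lemma i1_m0: "i1 \<noteq> m0" using e_m0 e_i1 n by auto

lemma e_less: "i \<noteq> m0 \<Longrightarrow> e i < n" using e_le[of i] e_inj[of i m0] e_m0 by auto

lemma card: "CARD('m) = n + 1"
  using bij_betw_same_card[OF bij] by simp

definition v :: "nat \<Rightarrow> 'm \<Rightarrow> complex" where
  "v k i = (if k = 1 then (if i = m0 then 1 else 0) else of_nat (k - 2) ^ e i)"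

definition \<eta> :: "nat \<Rightarrow> nat \<Rightarrow> complex" where "\<eta> k m = ec n m * of_nat k ^ m"

definition a :: "nat \<Rightarrow> 'm \<Rightarrow> complex" where "a k i = \<eta> k (e i)"

text \<open>Where \<open>a k\<close> has the coefficients of \<open>trunc_exp n k\<close>, this has
  those of z times it. Their common zeros on the standard curve are the points at the roots of
  \<open>trunc_exp n k\<close>.\<close>

definition b :: "nat \<Rightarrow> 'm \<Rightarrow> complex" where "b k i = (if e i = 0 then 0 else \<eta> k (e i - 1))"

definition q :: "nat \<Rightarrow> 'm \<Rightarrow> 'm \<Rightarrow> complex" where "q k = wedge (a k) (b k)"

text \<open>The shift, which acts on the standard curve as multiplication by z.\<close>

definition E0 :: "'m \<Rightarrow> 'm \<Rightarrow> complex" where "E0 i j = (if e j = Suc (e i) then 1 else 0)"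

lemma \<eta>_nonzero: "m < n \<Longrightarrow> k \<ge> 1 \<Longrightarrow> \<eta> k m \<noteq> 0"
  by (simp add: \<eta>_def ec_nonzero)

lemma \<eta>_n: "\<eta> k n = 0" by (simp add: \<eta>_def ec_zero)

lemma contract_v1: "contract (v 1) r i = r m0 i"
  by (simp add: contract_def v_def mult_if_zero)

lemma contract_q: "contract (v 1) (q k) i = - \<eta> k (n - 1) * a k i"
proof -
  have "a k m0 = 0" "b k m0 = \<eta> k (n - 1)" using n by (simp_all add: a_def b_def e_m0 \<eta>_n)
  then show ?thesis by (simp add: q_def contract_v1 wedge_def)
qed

lemma a_i1: "a k i1 = 1" using n by (simp add: a_def e_i1 \<eta>_def ec_0)

lemma contract_q_i1: "k \<ge> 1 \<Longrightarrow> contract (v 1) (q k) i1 \<noteq> 0"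
  using n \<eta>_nonzero[of "n - 1" k] by (simp add: contract_q a_i1)

lemma dot_E0: "dot (E0 i) x = (if i = m0 then 0 else x (ei (Suc (e i))))"
proof (cases "i = m0")
  case True
  have "E0 i j = 0" for j using e_le[of j] by (simp add: E0_def True e_m0)
  then show ?thesis using True by (simp add: dot_def)
next
  case False
  have "dot (E0 i) x = (\<Sum>j\<in>UNIV. if j = ei (Suc (e i)) then x j else 0)"
    unfolding dot_def
  proof (intro sum.cong refl)
    fix j
    have "e j = Suc (e i) \<longleftrightarrow> j = ei (Suc (e i))" using ei_e e_ei e_less[OF False] by (metis Suc_leI)
    then show "E0 i j * x j = (if j = ei (Suc (e i)) then x j else 0)" by (simp add: E0_def)
  qed
  then show ?thesis using False by simp
qed

lemma dot_proj_v1: "dot (proj m0 (v 1) i) x = (if i = m0 then 0 else x i)"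
  by (simp add: dot_proj v_def)

lemma pull_E0: "pull (a k) E0 j = b k j"
proof -
  have "pull (a k) E0 j = (\<Sum>m\<le>n. \<eta> k m * (if e j = Suc m then 1 else 0))"
    unfolding pull_def sum_e by (intro sum.cong) (auto simp: a_def E0_def e_ei)
  also have "\<dots> = b k j"
    using e_le[of j] by (cases "e j") (simp_all add: b_def mult_if_zero)
  finally show ?thesis .
qed

lemma solves_E0: "solves l p q v m0 i1 E0 (\<lambda>k. of_nat (k - 2))"
  unfolding solves_def Let_def
proof (intro conjI allI ballI impI)
  show "E0 m0 j = 0" for j using e_le[of j] by (simp add: E0_def e_m0)
  show "E0 i1 i1 = 0" by (simp add: E0_def)
  show "dot (E0 i) (v k) = of_nat (k - 2) * dot (proj m0 (v 1) i) (v k)"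
    if "k \<in> {2..p}" "i \<noteq> m0" for k i
  proof -
    have "e (ei (Suc (e i))) = Suc (e i)" using e_less[OF that(2)] by (simp add: e_ei)
    then show ?thesis using that unfolding dot_E0 dot_proj_v1 by (simp add: v_def)
  qed
  fix k i j r
  have "pull (contract (v 1) (q k)) E0 j = - \<eta> k (n - 1) * b k j" for j
  proof -
    have "pull (contract (v 1) (q k)) E0 j = - \<eta> k (n - 1) * pull (a k) E0 j"
      unfolding pull_def contract_q by (simp add: sum_distrib_left mult_ac)
    then show ?thesis by (simp add: pull_E0)
  qed
  then show "pull (contract (v 1) (q k)) E0 i * q k j r + pull (contract (v 1) (q k)) E0 j * q k r i +
      pull (contract (v 1) (q k)) E0 r * q k i j = 0"
    by (simp add: q_def wedge_def algebra_simps)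
qed

lemma coeff_pencil:
  assumes "r \<le> n"
  shows "coeff ([:x, y:] * trunc_exp n k) r = x * a k (ei r) + y * b k (ei r)"
  using assms
  by (auto simp: coeff_pCons coeff_trunc_exp a_def b_def \<eta>_def e_ei split: nat.split)

text \<open>Read as polynomials through \<open>e\<close>, the rows of E form a
  \<open>multiplier\<close>.\<close>

lemma only_E0:
  assumes l: "l \<in> {0, 1, n, n + 1, n + 2}" and sol: "solves l p q v m0 i1 E \<rho>"
  obtains c where "\<And>i j. E i j = c * E0 i j" "\<And>k. k \<in> {2..p} \<Longrightarrow> \<rho> k = c * of_nat (k - 2)"
proof -
  define D where "D m = (\<Sum>r\<le>n. monom (E (ei m) (ei r)) r)" for m
  have coeff_D: "coeff (D m) r = (if r \<le> n then E (ei m) (ei r) else 0)" for m r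
    by (simp add: D_def coeff_sum coeff_monom)
  interpret multiplier n p l D \<rho>
  proof
    show "degree (D m) \<le> n" for m by (rule degree_le) (simp add: coeff_D)
    show "poly (D m) (of_nat (j - 2)) = \<rho> j * of_nat (j - 2) ^ m" if j: "j \<in> {2..p}" and m: "m < n" for j m
    proof -
      have "ei m \<noteq> m0" using m e_m0 e_ei[of m] by auto
      then have "dot (E (ei m)) (v j) = \<rho> j * dot (proj m0 (v 1) (ei m)) (v j)"
        using sol j unfolding solves_def by blast
      also have "\<dots> = \<rho> j * of_nat (j - 2) ^ m"
        unfolding dot_proj_v1 using \<open>ei m \<noteq> m0\<close> j m by (simp add: v_def e_ei)
      also have "dot (E (ei m)) (v j) = poly (D m) (of_nat (j - 2))"
        unfolding dot_def sum_e using j by (simp add: D_def poly_sum poly_monom v_def e_ei)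
      finally show ?thesis .
    qed
    show "\<exists>x y. (\<Sum>m<n. smult (ec n m * of_nat k ^ m) (D m)) = [:x, y:] * trunc_exp n k"
      if k: "k \<in> {1..l}" for k
    proof -
      define w where "w = pull (contract (v 1) (q k)) E"
      have "contract (v 1) (q k) i1 \<noteq> 0" using k contract_q_i1 by simp
      then have nz: "wedge (a k) (b k) m0 i1 \<noteq> 0" by (simp add: contract_v1 q_def)
      have "w i * wedge (a k) (b k) m0 i1 + w m0 * wedge (a k) (b k) i1 i + w i1 * wedge (a k) (b k) i m0 = 0" for i
        using sol k unfolding solves_def Let_def w_def q_def by blast
      then obtain x y where xy: "\<And>i. w i = x * a k i + y * b k i"
        using in_span_wedge[OF nz, of w] by metis
      have \<eta>: "\<eta> k (n - 1) \<noteq> 0" using n k \<eta>_nonzero by simp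
      have w: "w j = - \<eta> k (n - 1) * pull (a k) E j" for j
        unfolding w_def pull_def contract_q by (simp add: sum_distrib_left mult_ac)
      have "(\<Sum>m<n. smult (ec n m * of_nat k ^ m) (D m)) =
          [:- x / \<eta> k (n - 1), - y / \<eta> k (n - 1):] * trunc_exp n k" (is "?L = ?R")
      proof (rule poly_eqI)
        fix r
        show "coeff ?L r = coeff ?R r"
        proof (cases "r \<le> n")
          case True
          have "pull (a k) E (ei r) = (\<Sum>m\<le>n. \<eta> k m * E (ei m) (ei r))"
            unfolding pull_def sum_e by (simp add: a_def e_ei)
          also have "\<dots> = (\<Sum>m<n. \<eta> k m * E (ei m) (ei r))"
            by (simp add: \<eta>_n flip: lessThan_Suc_atMost)
          also have "\<dots> = coeff ?L r" using True by (simp add: coeff_sum coeff_D \<eta>_def)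
          finally have "coeff ?L r = - w (ei r) / \<eta> k (n - 1)" using \<eta> by (simp add: w)
          then show ?thesis unfolding coeff_pencil[OF True] xy using \<eta> by (simp add: field_simps)
        next
          case False
          then have "coeff (trunc_exp n k) r = 0" "coeff (trunc_exp n k) (r - 1) = 0"
            by (simp_all add: coeff_trunc_exp ec_zero)
          then show ?thesis using False
            by (cases r) (simp_all add: coeff_sum coeff_D coeff_pCons)
        qed
      qed
      then show ?thesis by blast
    qed
  qed (rule n p pl)+
  from multiplier[OF l] obtain x y where D': "\<forall>m<n. D m = [:x, y:] * monom 1 m" by (elim exE)
  then have D: "D m = [:x, y:] * monom 1 m" if "m < n" for m using that by blast
  have E_eq: "E i j = (if e j = e i then x else 0) + (if e j = Suc (e i) then y else 0)" if "i \<noteq> m0" for i j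
  proof -
    have "E i j = coeff (D (e i)) (e j)" using e_le by (simp add: coeff_D ei_e)
    also have "\<dots> = coeff ([:x, y:] * monom 1 (e i)) (e j)" using D e_less[OF that] by simp
    also have "\<dots> = (if e j = e i then x else 0) + (if e j = Suc (e i) then y else 0)"
      by (auto simp: coeff_monom coeff_pCons split: nat.split)
    finally show ?thesis .
  qed
  \<comment> \<open>The normalisation at (i1, i1) removes the component along \<pi>.\<close>
  have x: "x = 0" using E_eq[OF i1_m0, of i1] sol by (simp add: solves_def)
  show thesis
  proof (rule that[of y])
    show "E i j = y * E0 i j" for i j
    proof (cases "i = m0")
      case True
      have "e j \<noteq> Suc n" using e_le[of j] by simp
      then show ?thesis using sol True by (simp add: solves_def E0_def e_m0)
    next
      case False
      then show ?thesis by (simp add: E_eq x E0_def)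
    qed
    show "\<rho> k = y * of_nat (k - 2)" if "k \<in> {2..p}" for k
      using pts[OF that, of 0] D[of 0] n by (simp add: x monom_0 mult.commute[of y])
  qed
qed

text \<open>The rows are a recursion from each power of z to the next, so the kernel is spanned by
  the point of the standard curve with parameter z.\<close>

lemma kernel_E0:
  assumes "\<And>i. i \<noteq> m0 \<Longrightarrow> (\<Sum>k\<in>UNIV. (1 * E0 i k - z * proj m0 (v 1) i k) * x k) = 0"
  shows "x j = z ^ e j * x i1"
proof -
  have rec: "x (ei (Suc (e i))) = z * x i" if "i \<noteq> m0" for i
    using assms[OF that] dot_diff(1)[of "\<lambda>k. 1 * E0 i k" "\<lambda>k. z * proj m0 (v 1) i k" x] that
    by (simp add: dot_def[symmetric] dot_scale dot_E0 dot_proj_v1)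
  have "x (ei m) = z ^ m * x i1" if "m \<le> n" for m
    using that
  proof (induction m)
    case 0
    show ?case by (simp add: i1_def)
  next
    case (Suc m)
    then have "ei m \<noteq> m0" "e (ei m) = m" using e_ei[of m] e_m0 by auto
    then show ?case using rec[of "ei m"] Suc by simp
  qed
  from this[of "e j"] show ?thesis using e_le by (simp add: ei_e)
qed

abbreviation F :: "complex \<Rightarrow> 'm \<Rightarrow> complex" where
  "F z \<equiv> cross m0 (\<lambda>i k. 1 * E0 i k - z * proj m0 (v 1) i k)"

lemma F_eq: "F z j = z ^ e j * F z i1"
  by (rule kernel_E0) (rule cross_row[of _ m0 "\<lambda>i k. 1 * E0 i k - z * proj m0 (v 1) i k"])

lemma dot_F_nonzero:
  assumes "(\<Sum>j\<in>UNIV. c j * z ^ e j) \<noteq> 0"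
  shows "dot c (F z) \<noteq> 0"
  unfolding dot_def
proof (rule cross_dot_nonzero)
  fix x :: "'m \<Rightarrow> complex" and k
  assume x: "\<And>i. i \<noteq> m0 \<Longrightarrow> (\<Sum>k\<in>UNIV. (1 * E0 i k - z * proj m0 (v 1) i k) * x k) = 0"
    and c: "(\<Sum>k\<in>UNIV. c k * x k) = 0"
  have xe: "x j = z ^ e j * x i1" for j by (rule kernel_E0[OF x])
  have "(\<Sum>k\<in>UNIV. c k * x k) = (\<Sum>j\<in>UNIV. c j * z ^ e j) * x i1"
    unfolding sum_distrib_right by (intro sum.cong refl, subst xe) simp
  then have "x i1 = 0" using c assms by simp
  then show "x k = 0" by (subst xe) simp
qed

lemma F_independent:
  assumes "\<And>z. dot c (F z) = 0"
  shows "c i = 0"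
proof -
  define f where "f = (\<Sum>m\<le>n. monom (c (ei m)) m)"
  have "poly f z = (\<Sum>j\<in>UNIV. c j * z ^ e j)" for z
    unfolding sum_e by (simp add: f_def poly_sum poly_monom e_ei)
  then have "poly f z = 0" for z using assms dot_F_nonzero[of c z] by metis
  then have "f = 0" using poly_all_0_iff_0 by blast
  then have "coeff f (e i) = 0" by simp
  then show ?thesis using e_le[of i] by (simp add: f_def coeff_sum coeff_monom ei_e)
qed

text \<open>This avoids evaluating minors: the entry at \<open>m0\<close> is z^n times the entry at
  \<open>i1\<close>, and its degree is at most n, so the latter is constant.\<close>

lemma F_constant:
  assumes poly: "\<And>j. degree (f j) \<le> n" "\<And>j z. poly (f j) z = F z j"
  obtains u where "u \<noteq> 0" "\<And>z j. F z j = u * z ^ e j"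
proof -
  have eq: "f m0 = monom 1 n * f i1"
    using F_eq[of _ m0] by (intro poly_eq_poly_eq_iff[THEN iffD1] ext) (simp add: poly poly_monom e_m0)
  have nz: "F z i1 \<noteq> 0" for z
  proof -
    have "(\<Sum>j\<in>UNIV. (if j = i1 then 1 else 0) * z ^ e j) = 1"
      by (simp add: if_distrib[of "\<lambda>u. u * _"] e_i1 cong: if_cong)
    then have "dot (\<lambda>j. if j = i1 then 1 else 0) (F z) \<noteq> 0" by (intro dot_F_nonzero) simp
    then show ?thesis by (simp add: dot_def if_distrib[of "\<lambda>u. u * _"] cong: if_cong)
  qed
  have "f i1 \<noteq> 0" using nz[of 0] poly(2)[of i1 0] by auto
  then have "degree (f i1) = 0"
    using degree_of_monom_mult[of n "f i1" n] poly(1)[of m0] eq by simp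
  then obtain u where u: "f i1 = [:u:]" by (metis degree_eq_zeroE)
  then have Fi1: "F z i1 = u" for z using poly(2)[of i1 z] by simp
  show thesis
  proof (rule that[of u])
    show "u \<noteq> 0" using nz[of 0] Fi1[of 0] by simp
    show "F z j = u * z ^ e j" for z j by (subst F_eq) (simp only: Fi1 mult.commute)
  qed
qed

end

section \<open>The configuration is generic\<close>

context function_ring
begin

text \<open>Elements of R depend on the data only, so the parameters s and t are separated off by
  expanding.\<close>

lemma linear_prod_family:
  assumes "finite S" "\<And>i. i \<in> S \<Longrightarrow> \<alpha> i \<in> R" "\<And>i. i \<in> S \<Longrightarrow> \<beta> i \<in> R"
  obtains A where "\<And>m. A m \<in> R"
    "\<And>x s t. (\<Prod>i\<in>S. s * \<alpha> i x - t * \<beta> i x) = (\<Sum>m\<le>card S. A m x * t ^ m * s ^ (card S - m))"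
proof -
  have "\<exists>A. (\<forall>m. A m \<in> R) \<and>
      (\<forall>x s t. (\<Prod>i\<in>S. s * \<alpha> i x - t * \<beta> i x) = (\<Sum>m\<le>card S. A m x * t ^ m * s ^ (card S - m)))"
    using assms
  proof (induction S rule: finite_induct)
    case empty
    show ?case by (intro exI[of _ "\<lambda>_ _. 1"]) (simp add: const_closed)
  next
    case (insert i S)
    then obtain A where A: "\<And>m. A m \<in> R"
      "\<And>x s t. (\<Prod>i\<in>S. s * \<alpha> i x - t * \<beta> i x) = (\<Sum>m\<le>card S. A m x * t ^ m * s ^ (card S - m))"
      by auto
    define d where "d = card S"
    define A1 where "A1 m x = (if m \<le> d then \<alpha> i x * A m x else 0)" for m x
    define A2 where "A2 m x = (case m of 0 \<Rightarrow> 0 | Suc m' \<Rightarrow> \<beta> i x * A m' x)" for m x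
    show ?case
    proof (intro exI[of _ "\<lambda>m x. A1 m x - A2 m x"] conjI allI)
      fix m
      have "A1 m \<in> R" unfolding A1_def[abs_def] using insert.prems A(1) by (intro closed) auto
      moreover have "A2 m \<in> R"
        unfolding A2_def[abs_def] using insert.prems A(1) by (cases m) (auto intro: closed)
      ultimately show "(\<lambda>x. A1 m x - A2 m x) \<in> R" by (rule diff_closed)
    next
      fix x s t
      have 1: "(\<Sum>m\<le>Suc d. A1 m x * t ^ m * s ^ (Suc d - m)) = s * \<alpha> i x * (\<Sum>m\<le>d. A m x * t ^ m * s ^ (d - m))"
      proof -
        have "(\<Sum>m\<le>Suc d. A1 m x * t ^ m * s ^ (Suc d - m)) = (\<Sum>m\<le>d. A1 m x * t ^ m * s ^ (Suc d - m))"
          by (simp add: A1_def)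
        also have "\<dots> = s * \<alpha> i x * (\<Sum>m\<le>d. A m x * t ^ m * s ^ (d - m))"
          unfolding sum_distrib_left by (intro sum.cong) (auto simp: A1_def Suc_diff_le)
        finally show ?thesis .
      qed
      have 2: "(\<Sum>m\<le>Suc d. A2 m x * t ^ m * s ^ (Suc d - m)) = t * \<beta> i x * (\<Sum>m\<le>d. A m x * t ^ m * s ^ (d - m))"
        unfolding sum.atMost_Suc_shift sum_distrib_left by (simp add: A2_def mult_ac)
      have "(\<Sum>m\<le>Suc d. (A1 m x - A2 m x) * t ^ m * s ^ (Suc d - m)) =
          (s * \<alpha> i x - t * \<beta> i x) * (\<Sum>m\<le>d. A m x * t ^ m * s ^ (d - m))"
        unfolding left_diff_distrib sum_subtractf 1 2 ..
      then show "(\<Prod>i\<in>insert i S. s * \<alpha> i x - t * \<beta> i x) =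
          (\<Sum>m\<le>card (insert i S). (A1 m x - A2 m x) * t ^ m * s ^ (card (insert i S) - m))"
        using insert.hyps A(2) by (simp add: d_def)
    qed
  qed
  then show thesis using that by blast
qed

lemma cross_family:
  fixes E B :: "'m::finite \<Rightarrow> 'm \<Rightarrow> 'x \<Rightarrow> complex"
  assumes card: "CARD('m) = n + 1" and E: "\<And>i j. E i j \<in> R" and B: "\<And>i j. B i j \<in> R"
  obtains A where "\<And>m. A m \<in> R"
    "\<And>x s t. cross m0 (\<lambda>i k. s * E i k x - t * B i k x) j = (\<Sum>m\<le>n. A m x * t ^ m * s ^ (n - m))"
proof -
  have cS: "card (UNIV - {m0}) = n" using card by (simp add: card_Diff_singleton)
  have "\<exists>A. (\<forall>m. A m \<in> R) \<and> (\<forall>x s t. (\<Prod>i\<in>UNIV - {m0}. s * E i (\<sigma> i) x - t * B i (\<sigma> i) x) =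
      (\<Sum>m\<le>n. A m x * t ^ m * s ^ (n - m)))" for \<sigma> :: "'m \<Rightarrow> 'm"
  proof -
    obtain A where "\<And>m. A m \<in> R" "\<And>x s t. (\<Prod>i\<in>UNIV - {m0}. s * E i (\<sigma> i) x - t * B i (\<sigma> i) x) =
        (\<Sum>m\<le>n. A m x * t ^ m * s ^ (n - m))"
      by (rule linear_prod_family[of "UNIV - {m0}" "\<lambda>i. E i (\<sigma> i)" "\<lambda>i. B i (\<sigma> i)", unfolded cS])
        (simp, simp add: E, simp add: B, blast)
    then show ?thesis by blast
  qed
  then obtain A where A: "\<And>\<sigma> m. A \<sigma> m \<in> R"
    "\<And>\<sigma> x s t. (\<Prod>i\<in>UNIV - {m0}. s * E i (\<sigma> i) x - t * B i (\<sigma> i) x) = (\<Sum>m\<le>n. A \<sigma> m x * t ^ m * s ^ (n - m))"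
    by metis
  \<comment> \<open>In the Leibniz formula, the unit row \<open>m0\<close> leaves only permutations
    that send \<open>m0\<close> to \<open>j\<close>, each with a product of n linear forms.\<close>
  define c where "c \<sigma> = of_int (sign \<sigma>) * (if \<sigma> m0 = j then 1 else 0 :: complex)" for \<sigma>
  show thesis
  proof (rule that[of "\<lambda>m x. \<Sum>\<sigma> | \<sigma> permutes UNIV. c \<sigma> * A \<sigma> m x"])
    show "(\<lambda>x. \<Sum>\<sigma> | \<sigma> permutes UNIV. c \<sigma> * A \<sigma> m x) \<in> R" for m
      using A(1) by (auto intro!: closed)
    fix x s t
    have "cross m0 (\<lambda>i k. s * E i k x - t * B i k x) j =
        (\<Sum>\<sigma> | \<sigma> permutes UNIV. c \<sigma> * (\<Prod>i\<in>UNIV - {m0}. s * E i (\<sigma> i) x - t * B i (\<sigma> i) x))"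
      unfolding cross_def det_def
    proof (intro sum.cong refl)
      fix \<sigma> :: "'m \<Rightarrow> 'm"
      show "of_int (sign \<sigma>) * (\<Prod>i\<in>UNIV. (\<chi> i k. if i = m0 then if k = j then 1 else 0 else s * E i k x - t * B i k x) $ i $ \<sigma> i) =
          c \<sigma> * (\<Prod>i\<in>UNIV - {m0}. s * E i (\<sigma> i) x - t * B i (\<sigma> i) x)"
        by (simp add: prod.remove[of UNIV m0] c_def)
    qed
    also have "\<dots> = (\<Sum>\<sigma> | \<sigma> permutes UNIV. \<Sum>m\<le>n. c \<sigma> * A \<sigma> m x * t ^ m * s ^ (n - m))"
      unfolding A(2) sum_distrib_left by (simp add: mult_ac)
    also have "\<dots> = (\<Sum>m\<le>n. (\<Sum>\<sigma> | \<sigma> permutes UNIV. c \<sigma> * A \<sigma> m x) * t ^ m * s ^ (n - m))"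
      by (subst sum.swap) (simp add: sum_distrib_right)
    finally show "cross m0 (\<lambda>i k. s * E i k x - t * B i k x) j =
        (\<Sum>m\<le>n. (\<Sum>\<sigma> | \<sigma> permutes UNIV. c \<sigma> * A \<sigma> m x) * t ^ m * s ^ (n - m))" .
  qed
qed

end

section \<open>The linear system over the ring of coordinate polynomials\<close>

type_synonym 'm coords = "(nat \<Rightarrow> 'm \<Rightarrow> 'm \<Rightarrow> complex) \<times> (nat \<Rightarrow> 'm \<Rightarrow> complex)"

locale data_ring = function_ring R
  for R :: "('m::finite coords \<Rightarrow> complex) set" +
  fixes l p :: nat
  assumes q_closed: "k \<in> {1..l} \<Longrightarrow> (\<lambda>x. fst x k i j) \<in> R"
    and v_closed: "k \<in> {1..p} \<Longrightarrow> (\<lambda>x. snd x k i) \<in> R"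
begin

context
  fixes m0 i1 :: 'm
  assumes i1: "i1 \<noteq> m0"
begin

text \<open>Entries that \<open>solves\<close> sets to zero are omitted, so that unknowns and
  equations can be counted exactly.\<close>

definition unknowns :: "('m \<times> 'm + nat) set" where
  "unknowns = Inl ` {ij. fst ij \<noteq> m0 \<and> ij \<noteq> (i1, i1)} \<union> Inr ` {2..p}"

definition mat :: "('m \<times> 'm + nat \<Rightarrow> complex) \<Rightarrow> 'm \<Rightarrow> 'm \<Rightarrow> complex" where
  "mat y i j = (if i \<noteq> m0 \<and> (i, j) \<noteq> (i1, i1) then y (Inl (i, j)) else 0)"

lemma finite_unknowns: "finite unknowns"
  by (simp add: unknowns_def)

lemma card_unknowns:
  assumes "CARD('m) = n + 1"
  shows "card unknowns = n * (n + 1) - 1 + (p - 1)"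
proof -
  have eq: "{ij :: 'm \<times> 'm. fst ij \<noteq> m0 \<and> ij \<noteq> (i1, i1)} = (UNIV - {m0}) \<times> UNIV - {(i1, i1)}" by auto
  have "card {ij :: 'm \<times> 'm. fst ij \<noteq> m0 \<and> ij \<noteq> (i1, i1)} = n * (n + 1) - 1"
    unfolding eq using assms i1 by (subst card_Diff_singleton) (auto simp: card_cartesian_product card_Diff_singleton)
  then show ?thesis
    unfolding unknowns_def by (subst card_Un_disjoint) (auto simp: card_image)
qed

lemma sum_unknowns:
  "(\<Sum>z\<in>unknowns. h z * y z) =
    (\<Sum>i\<in>UNIV. \<Sum>j\<in>UNIV. h (Inl (i, j)) * mat y i j) + (\<Sum>k\<in>{2..p}. h (Inr k) * y (Inr k))"
proof -
  have "(\<Sum>z\<in>unknowns. h z * y z) = (\<Sum>z\<in>Inl ` {ij. fst ij \<noteq> m0 \<and> ij \<noteq> (i1, i1)}. h z * y z) +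
      (\<Sum>z\<in>Inr ` {2..p}. h z * y z)"
    unfolding unknowns_def by (rule sum.union_disjoint) auto
  also have "(\<Sum>z\<in>Inl ` {ij. fst ij \<noteq> m0 \<and> ij \<noteq> (i1, i1)}. h z * y z) =
      (\<Sum>ij | fst ij \<noteq> m0 \<and> ij \<noteq> (i1, i1). h (Inl ij) * mat y (fst ij) (snd ij))"
    by (subst sum.reindex) (auto simp: mat_def intro!: sum.cong)
  also have "\<dots> = (\<Sum>ij\<in>UNIV. h (Inl ij) * mat y (fst ij) (snd ij))"
    by (rule sum.mono_neutral_left) (auto simp: mat_def)
  also have "\<dots> = (\<Sum>i\<in>UNIV. \<Sum>j\<in>UNIV. h (Inl (i, j)) * mat y i j)"
    by (subst sum.cartesian_product) (auto simp: UNIV_Times_UNIV[symmetric] simp del: UNIV_Times_UNIV intro!: sum.cong)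
  also have "(\<Sum>z\<in>Inr ` {2..p}. h z * y z) = (\<Sum>k\<in>{2..p}. h (Inr k) * y (Inr k))"
    by (subst sum.reindex) auto
  finally show ?thesis .
qed

definition point_eq where
  "point_eq k i = case_sum (\<lambda>ij x. if fst ij = i then snd x k (snd ij) else 0)
     (\<lambda>k' x. if k' = k then - dot (proj m0 (snd x 1) i) (snd x k) else 0)"
  for k :: nat and i :: 'm

text \<open>Redundant as a system, but its coefficients are polynomial in the Pluecker coordinates,
  as the elimination requires.\<close>

definition space_eq where
  "space_eq k i j r = case_sum (\<lambda>ij x. contract (snd x 1) (fst x k) (fst ij) *
       ((if snd ij = i then fst x k j r else 0) + (if snd ij = j then fst x k r i else 0) +
        (if snd ij = r then fst x k i j else 0)))
     (\<lambda>k' x. 0)"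
  for k :: nat and i j r :: 'm

definition equations where
  "equations = {point_eq k i | k i. k \<in> {2..p} \<and> i \<noteq> m0} \<union>
    {space_eq k i j r | k i j r. k \<in> {1..l}}"

lemma point_eq_sum:
  assumes "k \<in> {2..p}"
  shows "(\<Sum>z\<in>unknowns. point_eq k i z x * y z) =
    dot (mat y i) (snd x k) - y (Inr k) * dot (proj m0 (snd x 1) i) (snd x k)"
proof -
  have "(\<Sum>i'\<in>UNIV. \<Sum>j\<in>UNIV. (if i' = i then snd x k j else 0) * mat y i' j) =
      (\<Sum>i'\<in>UNIV. if i' = i then dot (mat y i) (snd x k) else 0)"
    by (intro sum.cong) (auto simp: dot_def mult.commute)
  moreover have "(\<Sum>k'\<in>{2..p}. (if k' = k then - dot (proj m0 (snd x 1) i) (snd x k) else 0) * y (Inr k')) =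
      (\<Sum>k'\<in>{2..p}. if k' = k then - y (Inr k) * dot (proj m0 (snd x 1) i) (snd x k) else 0)"
    by (intro sum.cong) auto
  ultimately show ?thesis using assms unfolding sum_unknowns point_eq_def by (simp cong: if_cong)
qed

lemma sum_pull: "(\<Sum>i'\<in>UNIV. \<Sum>j'\<in>UNIV. \<alpha> i' * u j' * E i' j') = dot (pull \<alpha> E) u"
  unfolding dot_pull by (simp add: dot_def sum_distrib_left mult_ac)

lemma space_eq_sum:
  fixes x y and k :: nat
  defines "w \<equiv> pull (contract (snd x 1) (fst x k)) (mat y)"
  shows "(\<Sum>z\<in>unknowns. space_eq k i j r z x * y z) = w i * fst x k j r + w j * fst x k r i + w r * fst x k i j"
proof -
  define u where "u j' = (if j' = i then fst x k j r else 0) + (if j' = j then fst x k r i else 0) +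
        (if j' = r then fst x k i j else 0)" for j'
  have "(\<Sum>z\<in>unknowns. space_eq k i j r z x * y z) = dot w u"
    unfolding sum_unknowns space_eq_def w_def u_def sum_pull[symmetric] by simp
  then show ?thesis
    by (simp add: dot_def u_def distrib_left sum.distrib mult_if_zero)
qed

lemma sols_iff: "y \<in> sols unknowns equations x \<longleftrightarrow>
    solves l p (fst x) (snd x) m0 i1 (mat y) (\<lambda>k. y (Inr k))"
proof -
  have "y \<in> sols unknowns equations x \<longleftrightarrow>
      (\<forall>k\<in>{2..p}. \<forall>i. i \<noteq> m0 \<longrightarrow> (\<Sum>z\<in>unknowns. point_eq k i z x * y z) = 0) \<and>
      (\<forall>k\<in>{1..l}. \<forall>i j r. (\<Sum>z\<in>unknowns. space_eq k i j r z x * y z) = 0)"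
    unfolding sols_def equations_def by blast
  moreover have "mat y m0 j = 0" "mat y i1 i1 = 0" for j by (simp_all add: mat_def)
  ultimately show ?thesis
    unfolding solves_def Let_def space_eq_sum by (simp add: point_eq_sum)
qed

lemma equations_closed:
  assumes "M \<in> equations" "z \<in> unknowns" "p \<ge> 1"
  shows "M z \<in> R"
proof -
  have v1: "(\<lambda>x. snd x 1 i) \<in> R" for i using v_closed assms(3) by simp
  have point: "point_eq k i z \<in> R" if "k \<in> {2..p}" for k i
  proof (cases z)
    case (Inl ij)
    then show ?thesis using that by (auto simp: point_eq_def intro!: closed v_closed)
  next
    case (Inr k')
    have "(\<lambda>x. if k' = k then - dot (proj m0 (snd x 1) i) (snd x k) else 0) \<in> R"
      unfolding dot_proj using that by (intro closed v1 v_closed) auto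
    then show ?thesis by (simp add: point_eq_def Inr)
  qed
  have space: "space_eq k i j r z \<in> R" if "k \<in> {1..l}" for k i j r
    using that by (cases z) (auto simp: space_eq_def contract_def intro!: closed v1 q_closed)
  show ?thesis using assms(1) point space unfolding equations_def by blast
qed

text \<open>The equations \<open>space_eq\<close> are too many to count. They follow once the pulled
  back form vanishes on \<open>\<Lambda> k\<close>, which costs one equation for each of the n - 1
  vectors of a basis.\<close>

lemma nonzero_solution:
  fixes \<Lambda> :: "nat \<Rightarrow> (complex^'m) set"
  assumes card: "CARD('m) = n + 1" and n: "n \<ge> 2" and p: "p \<ge> 1" and pl: "p + l = n + 3"
    and \<Lambda>: "\<And>k. k \<in> {1..l} \<Longrightarrow> \<Lambda> k \<in> codim2_spaces"
      "\<And>k. k \<in> {1..l} \<Longrightarrow> pluecker_coords (fst x k) (\<Lambda> k)"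
  obtains y where "y \<in> sols unknowns equations x" "\<exists>z\<in>unknowns. y z \<noteq> 0"
proof -
  have "\<forall>k\<in>{1..l}. \<exists>B. B \<subseteq> \<Lambda> k \<and> \<Lambda> k \<subseteq> vec.span B \<and> finite B \<and> card B = n - 1"
  proof
    fix k assume k: "k \<in> {1..l}"
    obtain B where B: "B \<subseteq> \<Lambda> k" "vec.independent B" "\<Lambda> k \<subseteq> vec.span B" "card B = vec.dim (\<Lambda> k)"
      using vec.basis_exists[of "\<Lambda> k"] by blast
    moreover have "vec.dim (\<Lambda> k) + 2 = n + 1" using \<Lambda>(1)[OF k] card by (simp add: codim2_spaces_def)
    ultimately show "\<exists>B. B \<subseteq> \<Lambda> k \<and> \<Lambda> k \<subseteq> vec.span B \<and> finite B \<and> card B = n - 1"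
      using vec.finiteI_independent[OF B(2)] by (intro exI[of _ B]) auto
  qed
  then obtain B where B: "\<And>k. k \<in> {1..l} \<Longrightarrow> B k \<subseteq> \<Lambda> k" "\<And>k. k \<in> {1..l} \<Longrightarrow> \<Lambda> k \<subseteq> vec.span (B k)"
    "\<And>k. k \<in> {1..l} \<Longrightarrow> finite (B k)" "\<And>k. k \<in> {1..l} \<Longrightarrow> card (B k) = n - 1" by metis
  define K where "K = Inl ` ({2..p} \<times> (UNIV - {m0})) \<union> Inr ` (SIGMA k:{1..l}. B k)"
  define M where "M = case_sum (\<lambda>(k, i) z. point_eq k i z x)
    (\<lambda>(k, u). case_sum (\<lambda>ij. contract (snd x 1) (fst x k) (fst ij) * u $ snd ij) (\<lambda>_. 0))"
  have finK: "finite K" using B(3) by (auto simp: K_def intro!: finite_SigmaI)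
  have "card K = (p - 1) * n + l * (n - 1)"
  proof -
    have "card K = card ({2..p} \<times> (UNIV - {m0})) + card (SIGMA k:{1..l}. B k)"
      unfolding K_def using B(3)
      by (subst card_Un_disjoint) (auto simp: card_image intro!: finite_SigmaI)
    also have "card ({2..p} \<times> (UNIV - {m0} :: 'm set)) = (p - 1) * n"
      using card by (simp add: card_cartesian_product card_Diff_singleton)
    also have "card (SIGMA k:{1..l}. B k) = l * (n - 1)"
      using B(3,4) by (subst card_SigmaI) auto
    finally show ?thesis .
  qed
  moreover have "(p - 1) * n + l * (n - 1) < n * (n + 1) - 1 + (p - 1)"
  proof -
    obtain n' p' where n': "n = Suc n'" "p = Suc p'" using n p by (cases n; cases p) auto
    have l: "p' + l = n' + 3" using pl n' by simp
    have "(p - 1) * n + l * (n - 1) = p' + (p' + l) * n'" by (simp add: n' algebra_simps)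
    also have "\<dots> = p' + (n' + 3) * n'" by (simp only: l)
    also have "\<dots> < n * (n + 1) - 1 + (p - 1)" by (simp add: n' algebra_simps)
    finally show ?thesis .
  qed
  ultimately have "card K < card unknowns" using card_unknowns[OF card] by simp
  then obtain y where y: "\<exists>z\<in>unknowns. y z \<noteq> 0" "\<And>\<kappa>. \<kappa> \<in> K \<Longrightarrow> (\<Sum>z\<in>unknowns. M \<kappa> z * y z) = 0"
    using underdetermined_system[OF finK finite_unknowns, of M] by metis
  have "solves l p (fst x) (snd x) m0 i1 (mat y) (\<lambda>k. y (Inr k))"
    unfolding solves_def Let_def
  proof (intro conjI allI ballI impI)
    show "mat y m0 j = 0" "mat y i1 i1 = 0" for j by (simp_all add: mat_def)
    show "dot (mat y i) (snd x k) = y (Inr k) * dot (proj m0 (snd x 1) i) (snd x k)"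
      if "k \<in> {2..p}" "i \<noteq> m0" for k i
      using y(2)[of "Inl (k, i)"] that point_eq_sum[of k i x y] by (auto simp: K_def M_def)
  next
    fix k i j r assume k: "k \<in> {1..l}"
    define w where "w = pull (contract (snd x 1) (fst x k)) (mat y)"
    have wB: "dot w (\<lambda>i. u $ i) = 0" if "u \<in> B k" for u
    proof -
      have "(\<Sum>z\<in>unknowns. M (Inr (k, u)) z * y z) = dot w (\<lambda>i. u $ i)"
        unfolding sum_unknowns M_def w_def sum_pull[symmetric] by simp
      then show ?thesis using y(2)[of "Inr (k, u)"] k that by (simp add: K_def)
    qed
    have "vec.subspace {u. dot w (\<lambda>i. u $ i) = 0}"
    proof -
      have lin: "dot w (\<lambda>i. (u + u') $ i) = dot w (\<lambda>i. u $ i) + dot w (\<lambda>i. u' $ i)"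
        "dot w (\<lambda>i. (c *s u) $ i) = c * dot w (\<lambda>i. u $ i)" "dot w (\<lambda>i. 0 $ i) = 0" for u u' c
        by (simp_all add: dot_add dot_scale dot_zero)
      show ?thesis unfolding vec.subspace_def Ball_def mem_Collect_eq lin by simp
    qed
    then have "vec.span (B k) \<subseteq> {u. dot w (\<lambda>i. u $ i) = 0}"
      using wB by (intro vec.span_minimal) auto
    then have w\<Lambda>: "dot w (\<lambda>i. u $ i) = 0" if "u \<in> \<Lambda> k" for u using that B(2)[OF k] by blast
    obtain a b :: "complex^'m" where ab: "\<Lambda> k = {x. (\<Sum>i\<in>UNIV. a $ i * x $ i) = 0 \<and> (\<Sum>i\<in>UNIV. b $ i * x $ i) = 0}"
      "fst x k = (\<lambda>i j. a $ i * b $ j - a $ j * b $ i)"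
      using \<Lambda>(2)[OF k] unfolding pluecker_coords_def by blast
    \<comment> \<open>A vector of \<open>\<Lambda> k\<close> with Pluecker coordinates as entries;
      pairing it with a form gives the left-hand side of the wedge equation.\<close>
    define u where "u j' = (if j' = i then fst x k j r else 0) + (if j' = j then fst x k r i else 0) +
        (if j' = r then fst x k i j else 0)" for j'
    have du: "(\<Sum>j'\<in>UNIV. c j' * u j') = c i * fst x k j r + c j * fst x k r i + c r * fst x k i j" for c
      by (simp add: u_def distrib_left sum.distrib mult_if_zero)
    have "(\<chi> i. u i) \<in> \<Lambda> k"
      unfolding ab(1) by (simp add: du) (simp add: ab(2) algebra_simps)
    then have "dot w u = 0" using w\<Lambda>[of "\<chi> i. u i"] by simp
    then show "pull (contract (snd x 1) (fst x k)) (mat y) i * fst x k j r +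
        pull (contract (snd x 1) (fst x k)) (mat y) j * fst x k r i +
        pull (contract (snd x 1) (fst x k)) (mat y) r * fst x k i j = 0"
      unfolding dot_def du w_def by simp
  qed
  then show thesis using that sols_iff y(1) by blast
qed

text \<open>The hypothesis \<open>line\<close> only bounds the solutions by multiples of
  \<open>Y\<close>; the nonzero solution found by counting shows that \<open>Y\<close> is one
  itself.\<close>

lemma generic_dataI:
  fixes \<Lambda> P :: "nat \<Rightarrow> (complex^'m) set" and Y :: "'m \<times> 'm + nat \<Rightarrow> complex"
    and x :: "'m coords"
  defines "F \<equiv> \<lambda>s t. cross m0 (\<lambda>i j. s * mat Y i j - t * proj m0 (snd x 1) i j)"
  assumes card: "CARD('m) = n + 1" and n: "n \<ge> 2" and p: "p \<ge> 1" and pl: "p + l = n + 3"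
    and \<Lambda>: "\<And>k. k \<in> {1..l} \<Longrightarrow> \<Lambda> k \<in> codim2_spaces"
      "\<And>k. k \<in> {1..l} \<Longrightarrow> pluecker_coords (fst x k) (\<Lambda> k)"
    and P: "\<And>k. k \<in> {1..p} \<Longrightarrow> homogeneous_coords (snd x k) (P k)"
    and line: "\<forall>y\<in>sols unknowns equations x. \<exists>c. \<forall>z\<in>unknowns. y z = c * Y z"
    and m0: "snd x 1 m0 \<noteq> 0"
    and off_P1: "\<forall>k\<in>{1..l}. \<exists>i. contract (snd x 1) (fst x k) i \<noteq> 0"
    and points: "\<forall>k\<in>{2..p}. \<exists>i. dot (proj m0 (snd x 1) i) (snd x k) \<noteq> 0"
    and forms: "\<And>j. (\<lambda>s t. F s t j) \<in> binary_forms n"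
    and indep: "\<And>c i. (\<And>s t. dot c (F s t) = 0) \<Longrightarrow> c i = 0"
    and roots: "\<And>k. k \<in> {1..l} \<Longrightarrow> card {z. dot (contract (snd x 1) (fst x k)) (F 1 z) = 0} = n - 1"
  shows "\<exists>!C. solution_curve n p l \<Lambda> P C"
proof -
  have "\<forall>k\<in>{1..l}. \<exists>a b. \<Lambda> k = zero_space a b \<and>
      fst x k = wedge a b"
  proof
    fix k assume "k \<in> {1..l}"
    then obtain a b :: "complex^'m" where "\<Lambda> k = {x. (\<Sum>i\<in>UNIV. a $ i * x $ i) = 0 \<and> (\<Sum>i\<in>UNIV. b $ i * x $ i) = 0}"
      "fst x k = (\<lambda>i j. a $ i * b $ j - a $ j * b $ i)"
      using \<Lambda>(2) unfolding pluecker_coords_def by blast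
    then show "\<exists>a b. \<Lambda> k = zero_space a b \<and>
        fst x k = wedge a b"
      by (intro exI[of _ "\<lambda>i. a $ i"] exI[of _ "\<lambda>i. b $ i"]) (simp add: wedge_def fun_eq_iff)
  qed
  from bchoice[OF this] obtain a where "\<forall>k\<in>{1..l}. \<exists>b.
      \<Lambda> k = zero_space (a k) b \<and>
      fst x k = wedge (a k) b" by (elim exE)
  from bchoice[OF this] obtain b where ab: "\<forall>k\<in>{1..l}.
      \<Lambda> k = zero_space (a k) (b k) \<and>
      fst x k = wedge (a k) (b k)" by (elim exE)
  obtain y where y: "y \<in> sols unknowns equations x" "\<exists>z\<in>unknowns. y z \<noteq> 0"
    by (rule nonzero_solution[OF card n p pl \<Lambda>])
  then obtain c where c: "\<forall>z\<in>unknowns. y z = c * Y z" using line by blast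
  then have "c \<noteq> 0" using y(2) by auto
  have "(\<Sum>z\<in>unknowns. M z x * Y z) = 1 / c * (\<Sum>z\<in>unknowns. M z x * y z)" for M
    unfolding sum_distrib_left using c \<open>c \<noteq> 0\<close> by (intro sum.cong) auto
  then have Ysol: "Y \<in> sols unknowns equations x" using y(1) by (simp add: sols_def)
  interpret generic_data n p l a b "snd x" \<Lambda> P "fst x" m0 i1 "mat Y" "\<lambda>k. Y (Inr k)"
  proof
    show "solves l p (fst x) (snd x) m0 i1 (mat Y) (\<lambda>k. Y (Inr k))" using Ysol sols_iff by blast
    show "\<exists>c. \<forall>i j. E' i j = c * mat Y i j" if E': "solves l p (fst x) (snd x) m0 i1 E' \<rho>'" for E' \<rho>'
    proof -
      define y' where "y' = case_sum (\<lambda>ij. E' (fst ij) (snd ij)) \<rho>'"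
      have m: "mat y' = E'" using E' by (auto simp: fun_eq_iff mat_def y'_def solves_def)
      then have "y' \<in> sols unknowns equations x" using E' by (simp add: sols_iff y'_def)
      then obtain c where c: "\<forall>z\<in>unknowns. y' z = c * Y z" using line by blast
      have "mat y' i j = c * mat Y i j" for i j
        using c by (auto simp: mat_def unknowns_def)
      then show ?thesis using m by metis
    qed
    show "P k = vec.span {\<chi> i. snd x k i}" if "k \<in> {1..p}" for k
      using P[OF that] by (simp add: homogeneous_coords_def)
    show "(\<lambda>s t. cross m0 (\<lambda>i j. s * mat Y i j - t * proj m0 (snd x 1) i j) j) \<in> binary_forms n" for j
      using forms by (simp add: F_def)
    show "c i = 0" if "\<And>s t. dot c (cross m0 (\<lambda>i j. s * mat Y i j - t * proj m0 (snd x 1) i j)) = 0" for c i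
      using indep[of c] that by (simp add: F_def)
    show "card {z. dot (contract (snd x 1) (fst x k))
        (cross m0 (\<lambda>i j. 1 * mat Y i j - z * proj m0 (snd x 1) i j)) = 0} = n - 1" if "k \<in> {1..l}" for k
      using roots[OF that] by (simp add: F_def)
    show "\<exists>i. contract (snd x 1) (fst x k) i \<noteq> 0" if "k \<in> {1..l}" for k using off_P1 that by blast
    show "\<exists>i. dot (proj m0 (snd x 1) i) (snd x k) \<noteq> 0" if "k \<in> {2..p}" for k using points that by blast
    show "\<Lambda> k = zero_space (a k) (b k)"
      "fst x k = wedge (a k) (b k)" if "k \<in> {1..l}" for k using ab that by blast+
  qed (rule card n p m0 i1)+
  show ?thesis by (rule unique_curve)
qed

end

end

section \<open>The neighbourhood of the standard configuration on which the curve is unique\<close>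

context data_ring
begin

lemma near_unique_curve:
  assumes sc: "standard_configuration n p l e" and l: "l \<in> {0, 1, n, n + 1, n + 2}"
  shows "near (standard_configuration.q n e, standard_configuration.v n e)
    (\<lambda>x. \<forall>\<Lambda> P. (\<forall>k\<in>{1..l}. \<Lambda> k \<in> codim2_spaces \<and> pluecker_coords (fst x k) (\<Lambda> k)) \<longrightarrow>
      (\<forall>k\<in>{1..p}. homogeneous_coords (snd x k) (P k)) \<longrightarrow>
      (\<exists>!C. solution_curve n p l \<Lambda> P C))"
proof -
  interpret S: standard_configuration n p l e by (rule sc)
  define m0 i1 where "m0 = S.m0" and "i1 = S.i1"
  have i1: "i1 \<noteq> m0" using S.i1_m0 by (simp add: m0_def i1_def)
  note U = finite_unknowns[OF i1] equations_closed[OF i1 _ _ S.p] sols_iff[OF i1]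
  define x0 where "x0 = (S.q, S.v)"
  have x0: "fst x0 = S.q" "snd x0 = S.v" by (simp_all add: x0_def)
  let ?J = "unknowns m0 i1" and ?M = "equations m0"
  define y0 where "y0 = case_sum (\<lambda>ij. S.E0 (fst ij) (snd ij)) (\<lambda>k. of_nat (k - 2))"
  have E0: "S.E0 m0 j = 0" "S.E0 i1 i1 = 0" for j
    using S.solves_E0 by (simp_all add: solves_def m0_def i1_def)
  have mat0: "mat m0 i1 y0 = S.E0"
    using E0 by (auto simp: fun_eq_iff mat_def[OF i1] y0_def)
  have J: "z \<in> ?J \<longleftrightarrow> (case z of Inl ij \<Rightarrow> fst ij \<noteq> m0 \<and> ij \<noteq> (i1, i1) | Inr k \<Rightarrow> k \<in> {2..p})" for z
    by (auto simp: unknowns_def[OF i1] split: sum.split)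
  obtain Y where Y: "\<And>z. z \<in> ?J \<Longrightarrow> Y z \<in> R" "\<And>z. z \<in> ?J \<Longrightarrow> Y z x0 = y0 z"
    and near1: "near x0 (\<lambda>x. \<forall>y\<in>sols ?J ?M x. \<exists>c. \<forall>z\<in>?J. y z = c * Y z x)"
  proof (rule near_kernel_line[of ?J ?M y0 x0])
    show "finite ?J" by (rule U)
    show "M z \<in> R" if "M \<in> ?M" "z \<in> ?J" for M z using U(2) that by blast
    show "y0 \<in> sols ?J ?M x0"
      unfolding U(3) mat0 x0 using S.solves_E0 by (simp add: y0_def m0_def i1_def)
    show "\<exists>z\<in>?J. y0 z \<noteq> 0"
    proof
      have e: "e (S.ei 1) = 1" using S.n by (intro S.e_ei) simp
      then have "S.ei 1 \<noteq> i1" using S.e_i1 by (auto simp: i1_def)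
      then show "Inl (i1, S.ei 1) \<in> ?J" using i1 by (simp add: J)
      show "y0 (Inl (i1, S.ei 1)) \<noteq> 0" using S.e_i1 e by (simp add: y0_def S.E0_def i1_def)
    qed
    show "\<exists>c. \<forall>z\<in>?J. y z = c * y0 z" if y: "y \<in> sols ?J ?M x0" for y
    proof -
      have "solves l p S.q S.v S.m0 S.i1 (mat m0 i1 y) (\<lambda>k. y (Inr k))"
        using y unfolding U(3) x0 by (simp add: m0_def i1_def)
      then obtain c where c: "\<And>i j. mat m0 i1 y i j = c * S.E0 i j" "\<And>k. k \<in> {2..p} \<Longrightarrow> y (Inr k) = c * of_nat (k - 2)"
        using S.only_E0[OF l] by metis
      have "y z = c * y0 z" if "z \<in> ?J" for z
      proof (cases z)
        case (Inl ij)
        then have "mat m0 i1 y (fst ij) (snd ij) = y z" using that by (auto simp: J mat_def[OF i1])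
        then show ?thesis using c(1)[of "fst ij" "snd ij"] Inl by (simp add: y0_def)
      next
        case (Inr k)
        then show ?thesis using c(2)[of k] that by (auto simp: J y0_def)
      qed
      then show ?thesis by blast
    qed
  qed blast
  define E where "E i j x = mat m0 i1 (\<lambda>z. Y z x) i j" for i j x
  define B where "B i j x = proj m0 (snd x 1) i j" for i j and x :: "'m coords"
  have v1: "(\<lambda>x. snd x 1 i) \<in> R" for i using S.p by (intro v_closed) simp
  have E: "E i j \<in> R" for i j
    unfolding E_def[abs_def] mat_def[OF i1] by (intro if_closed const_closed Y) (auto simp: J)
  have B: "B i j \<in> R" for i j
    unfolding B_def[abs_def] proj_def by (intro closed v1)
  have Ex0: "E i j x0 = S.E0 i j" for i j
  proof -
    have "mat m0 i1 (\<lambda>z. Y z x0) i j = mat m0 i1 y0 i j"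
      using Y(2)[of "Inl (i, j)"] by (auto simp: mat_def[OF i1] J)
    then show ?thesis by (simp add: E_def mat0)
  qed
  define F where "F x s t = cross m0 (\<lambda>i k. s * E i k x - t * B i k x)" for x s t
  have Fx0: "F x0 1 z = S.F z" for z
    unfolding F_def Ex0 B_def x0 by (simp only: m0_def)
  have "\<exists>A. (\<forall>m. A m \<in> R) \<and> (\<forall>x s t. F x s t j = (\<Sum>m\<le>n. A m x * t ^ m * s ^ (n - m)))" for j
  proof -
    obtain A where "\<And>m. A m \<in> R"
      "\<And>x s t. cross m0 (\<lambda>i k. s * E i k x - t * B i k x) j = (\<Sum>m\<le>n. A m x * t ^ m * s ^ (n - m))"
      by (rule cross_family[where E = E and B = B and ?m0.0 = m0 and j = j, OF S.card E B]) blast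
    then show ?thesis unfolding F_def by blast
  qed
  then have "\<forall>j. \<exists>A. (\<forall>m. A m \<in> R) \<and> (\<forall>x s t. F x s t j = (\<Sum>m\<le>n. A m x * t ^ m * s ^ (n - m)))" ..
  from choice[OF this] obtain A where "\<forall>j. (\<forall>m. A j m \<in> R) \<and>
      (\<forall>x s t. F x s t j = (\<Sum>m\<le>n. A j m x * t ^ m * s ^ (n - m)))" by (elim exE)
  then have A: "A j m \<in> R" "F x s t j = (\<Sum>m\<le>n. A j m x * t ^ m * s ^ (n - m))" for j m x s t
    by blast+
  have dotF: "dot c (F x s t) = (\<Sum>m\<le>n. (\<Sum>j\<in>UNIV. c j * A j m x) * t ^ m * s ^ (n - m))" for c x s t
    unfolding dot_def A(2) sum_distrib_left sum_distrib_right by (subst sum.swap) (simp add: mult_ac)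
  define \<alpha> where "\<alpha> k x = contract (snd x 1) (fst x k)" for k and x :: "'m coords"
  have \<alpha>: "(\<lambda>x. \<alpha> k x j) \<in> R" if "k \<in> {1..l}" for k j
    unfolding \<alpha>_def contract_def using that by (intro closed v1 q_closed)
  have near2: "near x0 (\<lambda>x. snd x 1 m0 \<noteq> 0)"
    by (rule near_nonzero[OF v1]) (simp add: x0 S.v_def m0_def)
  have near3: "near x0 (\<lambda>x. \<forall>k\<in>{1..l}. \<alpha> k x i1 \<noteq> 0)"
  proof (rule near_ball)
    show "near x0 (\<lambda>x. \<alpha> k x i1 \<noteq> 0)" if "k \<in> {1..l}" for k
      by (rule near_nonzero[OF \<alpha>[OF that]]) (use that S.contract_q_i1 in \<open>simp add: \<alpha>_def x0 i1_def\<close>)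
  qed simp
  have near4: "near x0 (\<lambda>x. \<forall>k\<in>{2..p}. dot (proj m0 (snd x 1) i1) (snd x k) \<noteq> 0)"
  proof (rule near_ball)
    show "near x0 (\<lambda>x. dot (proj m0 (snd x 1) i1) (snd x k) \<noteq> 0)" if "k \<in> {2..p}" for k
    proof (rule near_nonzero)
      show "(\<lambda>x. dot (proj m0 (snd x 1) i1) (snd x k)) \<in> R"
        unfolding dot_proj using that by (intro closed v1 v_closed) auto
      have "dot (proj S.m0 (S.v 1) S.i1) (S.v k) = S.v k S.i1" using S.i1_m0 by (simp add: S.dot_proj_v1)
      also have "\<dots> = 1" using that by (simp add: S.v_def S.e_i1)
      finally show "dot (proj m0 (snd x0 1) i1) (snd x0 k) \<noteq> 0" by (simp add: x0 m0_def i1_def)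
    qed
  qed simp
  \<comment> \<open>Independence of the n + 1 coordinate forms, as triviality of the kernel of their
    coefficient matrix.\<close>
  have near5: "near x0 (\<lambda>x. \<forall>c\<in>sols UNIV ((\<lambda>m j. A j m) ` {..n}) x. \<forall>j\<in>UNIV. c j = 0)"
  proof (rule near_trivial_kernel)
    show "M j \<in> R" if "M \<in> (\<lambda>m j. A j m) ` {..n}" for M j using that A(1) by auto
    show "c i = 0" if "c \<in> sols UNIV ((\<lambda>m j. A j m) ` {..n}) x0" for c i
    proof (rule S.F_independent)
      have "(\<Sum>j\<in>UNIV. c j * A j m x0) = 0" if "m \<le> n" for m
        using \<open>c \<in> _\<close> that by (auto simp: sols_def mult.commute)
      then show "dot c (S.F z) = 0" for z unfolding Fx0[symmetric] dotF by simp
    qed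
  qed simp
  define \<beta> where "\<beta> k m x = (\<Sum>j\<in>UNIV. \<alpha> k x j * A j m x)" for k m x
  have near6: "near x0 (\<lambda>x. \<forall>k\<in>{1..l}. card {z. (\<Sum>m\<le>n - 1. \<beta> k m x * z ^ m) = 0} = n - 1)"
  proof (rule near_ball)
    fix k assume k: "k \<in> {1..l}"
    define f where "f j = (\<Sum>m\<le>n. monom (A j m x0) m)" for j
    obtain u where u: "u \<noteq> 0" "\<And>z j. S.F z j = u * z ^ e j"
    proof (rule S.F_constant)
      show "degree (f j) \<le> n" for j by (rule degree_le) (simp add: f_def coeff_sum coeff_monom)
      show "poly (f j) z = S.F z j" for j z
        unfolding Fx0[symmetric] A(2) by (simp add: f_def poly_sum poly_monom)
    qed blast
    \<comment> \<open>At the standard configuration the minors are a constant times the powers of z,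
      so the equation of the secant points is a nonzero multiple of
      \<open>trunc_exp n k\<close>.\<close>
    define g where "g = smult (- S.\<eta> k (n - 1) * u) (trunc_exp n k)"
    have \<eta>: "S.\<eta> k (n - 1) \<noteq> 0" using k S.n by (intro S.\<eta>_nonzero) auto
    have "(\<Sum>m\<le>n. monom (\<beta> k m x0) m) = g"
    proof (intro poly_eq_poly_eq_iff[THEN iffD1] ext)
      fix z
      have "poly (\<Sum>m\<le>n. monom (\<beta> k m x0) m) z = dot (\<alpha> k x0) (F x0 1 z)"
        unfolding dotF by (simp add: poly_sum poly_monom \<beta>_def)
      also have "\<dots> = (\<Sum>j\<in>UNIV. - S.\<eta> k (n - 1) * S.a k j * (u * z ^ e j))"
        unfolding Fx0 dot_def u(2) \<alpha>_def x0 S.contract_q ..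
      also have "\<dots> = - S.\<eta> k (n - 1) * u * (\<Sum>m\<le>n. S.\<eta> k m * z ^ m)"
        unfolding S.sum_e sum_distrib_left by (intro sum.cong) (auto simp: S.a_def S.e_ei)
      also have "(\<Sum>m\<le>n. S.\<eta> k m * z ^ m) = poly (trunc_exp n k) z"
        unfolding poly_trunc_exp by (simp add: S.\<eta>_n S.\<eta>_def[symmetric] flip: lessThan_Suc_atMost)
      finally show "poly (\<Sum>m\<le>n. monom (\<beta> k m x0) m) z = poly g z" by (simp add: g_def)
    qed
    then have coeff_g: "\<beta> k m x0 = coeff g m" if "m \<le> n" for m
      using that by (auto simp: coeff_sum coeff_monom)
    show "near x0 (\<lambda>x. card {z. (\<Sum>m\<le>n - 1. \<beta> k m x * z ^ m) = 0} = n - 1)"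
    proof (rule near_card_roots)
      show "n - 1 \<ge> 1" using S.n by simp
      show "\<beta> k m \<in> R" for m
        unfolding \<beta>_def[abs_def] using \<alpha>[OF k] A(1) by (intro closed)
      show "\<beta> k m x0 = coeff g m" if "m \<le> n - 1" for m using coeff_g that by simp
      show "degree g = n - 1" using \<eta> u(1) k S.n by (simp add: g_def degree_trunc_exp)
      show "rsquarefree g"
        using \<eta> u(1) k S.n rsquarefree_trunc_exp[of n k]
        unfolding g_def rsquarefree_roots pderiv_smult by simp
    qed
  qed simp
  show ?thesis
    unfolding x0_def[symmetric]
  proof (rule near_mono[OF near_conj[OF near1 near_conj[OF near2 near_conj[OF near3
          near_conj[OF near4 near_conj[OF near5 near6]]]]]], elim conjE, intro allI impI)
    fix x and \<Lambda> P :: "nat \<Rightarrow> (complex^'m) set"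
    assume line: "\<forall>y\<in>sols ?J ?M x. \<exists>c. \<forall>z\<in>?J. y z = c * Y z x" and m0: "snd x 1 m0 \<noteq> 0"
      and off: "\<forall>k\<in>{1..l}. \<alpha> k x i1 \<noteq> 0" and pts: "\<forall>k\<in>{2..p}. dot (proj m0 (snd x 1) i1) (snd x k) \<noteq> 0"
      and ind: "\<forall>c\<in>sols UNIV ((\<lambda>m j. A j m) ` {..n}) x. \<forall>j\<in>UNIV. c j = 0"
      and rts: "\<forall>k\<in>{1..l}. card {z. (\<Sum>m\<le>n - 1. \<beta> k m x * z ^ m) = 0} = n - 1"
      and \<Lambda>: "\<forall>k\<in>{1..l}. \<Lambda> k \<in> codim2_spaces \<and> pluecker_coords (fst x k) (\<Lambda> k)"
      and P: "\<forall>k\<in>{1..p}. homogeneous_coords (snd x k) (P k)"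
    have F: "cross m0 (\<lambda>i j. s * mat m0 i1 (\<lambda>z. Y z x) i j - t * proj m0 (snd x 1) i j) = F x s t" for s t
      by (simp add: F_def E_def B_def)
    show "\<exists>!C. solution_curve n p l \<Lambda> P C"
    proof (rule generic_dataI[OF i1 S.card S.n S.p S.pl, where Y = "\<lambda>z. Y z x" and x = x], unfold F)
      show "\<Lambda> k \<in> codim2_spaces" "pluecker_coords (fst x k) (\<Lambda> k)" if "k \<in> {1..l}" for k
        using \<Lambda> that by blast+
      show "homogeneous_coords (snd x k) (P k)" if "k \<in> {1..p}" for k using P that by blast
      show "\<forall>k\<in>{1..l}. \<exists>i. contract (snd x 1) (fst x k) i \<noteq> 0" using off unfolding \<alpha>_def by blast
      show "\<forall>k\<in>{2..p}. \<exists>i. dot (proj m0 (snd x 1) i) (snd x k) \<noteq> 0" using pts by blast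
      show "(\<lambda>s t. F x s t j) \<in> binary_forms n" for j unfolding A(2) by (rule binary_formI)
      show "c i = 0" if c: "\<And>s t. dot c (F x s t) = 0" for c i
      proof -
        define g where "g = (\<Sum>m\<le>n. monom (\<Sum>j\<in>UNIV. c j * A j m x) m)"
        have "poly g z = 0" for z
          using c[of 1 z] unfolding dotF by (simp add: g_def poly_sum poly_monom)
        then have "g = 0" using poly_all_0_iff_0 by blast
        then have coeff_g: "coeff g m = 0" for m by simp
        have "(\<Sum>j\<in>UNIV. c j * A j m x) = 0" if "m \<le> n" for m
          using coeff_g[of m] that by (simp add: g_def coeff_sum coeff_monom)
        then have "c \<in> sols UNIV ((\<lambda>m j. A j m) ` {..n}) x" by (auto simp: sols_def mult.commute)
        then show ?thesis using ind by blast
      qed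
      fix k assume k: "k \<in> {1..l}"
      have eq: "dot (\<alpha> k x) (F x 1 z) = (\<Sum>m\<le>n - 1. \<beta> k m x * z ^ m)" for z
      proof -
        \<comment> \<open>The top coefficient is the value at infinity, where the minors annihilate
          every form that vanishes at \<open>v 1\<close>; hence the degree is at most n - 1 for all
          data.\<close>
        have "\<beta> k n x = dot (\<alpha> k x) (F x 0 1)"
        proof -
          have "dot (\<alpha> k x) (F x 0 1) = (\<Sum>m\<le>n. if m = n then \<beta> k n x else 0)"
            unfolding dotF by (intro sum.cong) (auto simp: \<beta>_def)
          then show ?thesis by simp
        qed
        also have "\<dots> = 0"
          unfolding dot_def F_def
        proof (rule cross_dot_zero[where v = "snd x 1" and ?k0.0 = m0])
          show "(\<Sum>j\<in>UNIV. (0 * E i j x - 1 * B i j x) * snd x 1 j) = 0" for i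
            using dot_proj[of m0 "snd x 1" i "snd x 1"] by (simp add: B_def dot_def sum_negf)
          obtain a b :: "complex^'m" where "fst x k = wedge (\<lambda>i. a $ i) (\<lambda>i. b $ i)"
            using \<Lambda> k unfolding pluecker_coords_def wedge_def by blast
          then have "dot (\<alpha> k x) (snd x 1) = 0"
            by (simp add: \<alpha>_def contract_wedge[abs_def] dot_diff dot_scale)
          then show "(\<Sum>j\<in>UNIV. \<alpha> k x j * snd x 1 j) = 0" by (simp add: dot_def)
        qed (rule m0)
        finally have "\<beta> k n x = 0" .
        moreover have "dot (\<alpha> k x) (F x 1 z) = (\<Sum>m\<le>n. \<beta> k m x * z ^ m)"
          unfolding dotF by (simp add: \<beta>_def)
        moreover have "(\<Sum>m\<le>n. \<beta> k m x * z ^ m) = (\<Sum>m\<le>n - 1. \<beta> k m x * z ^ m) + \<beta> k n x * z ^ n"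
          using S.n by (cases n) auto
        ultimately show ?thesis by simp
      qed
      then show "card {z. dot (contract (snd x 1) (fst x k)) (F x 1 z) = 0} = n - 1"
        using rts k unfolding \<alpha>_def by simp
    qed (rule line m0)+
  qed
qed

end

section \<open>Zariski neighbourhoods in the data space\<close>

lemma multiform_degree_zero:
  assumes "multiform l p d e f"
  shows "k \<notin> {1..l} \<Longrightarrow> d k = 0" "k \<notin> {1..p} \<Longrightarrow> e k = 0"
  using assms by (induction rule: multiform.induct) auto

lemma prod_power_unit:
  assumes "finite K" "k \<in> K"
  shows "(\<Prod>k'\<in>K. (r k' :: complex) ^ ((\<lambda>_. 0)(k := 1)) k') = r k"
proof -
  have "(\<Prod>k'\<in>K. r k' ^ ((\<lambda>_. 0)(k := 1)) k') = (\<Prod>k'\<in>K. if k' = k then r k' else 1)"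
    by (intro prod.cong) auto
  then show ?thesis using assms by simp
qed

text \<open>The factor by which a form of multidegree \<delta> changes when the coordinates of each
  component are rescaled by \<open>c\<close>.\<close>

definition character where
  "character l p \<delta> c = (\<Prod>k\<in>{1..l}. fst c k ^ fst \<delta> k) * (\<Prod>k\<in>{1..p}. snd c k ^ snd \<delta> k)"
  for l p :: nat and \<delta> :: "(nat \<Rightarrow> nat) \<times> (nat \<Rightarrow> nat)" and c :: "(nat \<Rightarrow> complex) \<times> (nat \<Rightarrow> complex)"

lemma multiform_scale:
  assumes "multiform l p d e f"
  shows "f (\<lambda>k i j. fst c k * q k i j) (\<lambda>k i. snd c k * v k i) = character l p (d, e) c * f q v"
  using assms
proof (induction rule: multiform.induct)
  case (space_coord k i j)
  then show ?case by (simp add: character_def prod_power_unit del: fun_upd_apply)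
next
  case (point_coord k i)
  then show ?case by (simp add: character_def prod_power_unit del: fun_upd_apply)
qed (simp_all add: character_def power_add prod.distrib distrib_left distrib_right mult_ac)

text \<open>Dedekind's independence of characters, for the torus that rescales the coordinates.\<close>

lemma characters_independent:
  assumes "finite S"
    and supp: "\<And>d e k. (d, e) \<in> S \<Longrightarrow> (k \<notin> {1..l} \<longrightarrow> d k = 0) \<and> (k \<notin> {1..p} \<longrightarrow> e k = 0)"
    and zero: "\<And>c. (\<And>k. fst c k \<noteq> 0 \<and> snd c k \<noteq> 0) \<Longrightarrow> (\<Sum>\<delta>\<in>S. character l p \<delta> c * u \<delta>) = 0"
    and \<delta>: "\<delta> \<in> S"
  shows "u \<delta> = 0"
  using assms
proof (induction "card S" arbitrary: S u \<delta>)
  case 0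
  then show ?case by simp
next
  case (Suc N)
  show ?case
  proof (cases "S = {\<delta>}")
    case True
    then show ?thesis using Suc.prems(3)[of "(\<lambda>_. 1, \<lambda>_. 1)"] by (simp add: character_def)
  next
    case False
    then obtain \<epsilon> where \<epsilon>: "\<epsilon> \<in> S" "\<epsilon> \<noteq> \<delta>" using Suc.prems(4) by blast
    \<comment> \<open>Doubles the coordinates of one component in which the two multidegrees
      differ.\<close>
    obtain c0 where c0: "\<And>k. fst c0 k \<noteq> 0 \<and> snd c0 k \<noteq> 0"
      "character l p \<epsilon> c0 \<noteq> character l p \<delta> c0"
    proof -
      have pow: "(\<Prod>k'\<in>K. (if k' = k then 2 else 1 :: complex) ^ d k') = 2 ^ d k"
        if "finite K" "k \<in> K" for K and k :: nat and d
      proof -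
        have "(\<Prod>k'\<in>K. (if k' = k then 2 else 1 :: complex) ^ d k') = (\<Prod>k'\<in>K. if k' = k then 2 ^ d k' else 1)"
          by (intro prod.cong) auto
        then show ?thesis using that by simp
      qed
      have two: "(2 :: complex) ^ i = 2 ^ j \<longleftrightarrow> i = j" for i j :: nat
      proof -
        have "(2 :: complex) ^ i = of_nat (2 ^ i)" for i by simp
        then show ?thesis by (metis of_nat_eq_iff power_inject_exp one_less_numeral_iff semiring_norm(76))
      qed
      obtain k where k: "fst \<epsilon> k \<noteq> fst \<delta> k \<or> snd \<epsilon> k \<noteq> snd \<delta> k"
        using \<epsilon>(2) by (metis ext prod_eqI)
      have supp: "(k \<notin> {1..l} \<longrightarrow> fst \<epsilon> k = fst \<delta> k) \<and> (k \<notin> {1..p} \<longrightarrow> snd \<epsilon> k = snd \<delta> k)"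
        using Suc.prems(2)[of "fst \<epsilon>" "snd \<epsilon>" k] Suc.prems(2)[of "fst \<delta>" "snd \<delta>" k] Suc.prems(4) \<epsilon>(1) by simp
      show thesis
      proof (cases "fst \<epsilon> k = fst \<delta> k")
        case True
        then have "k \<in> {1..p}" "snd \<epsilon> k \<noteq> snd \<delta> k" using k supp by auto
        then show thesis
          using that[of "(\<lambda>_. 1, \<lambda>k'. if k' = k then 2 else 1)"] by (simp add: character_def pow two)
      next
        case False
        then have "k \<in> {1..l}" using supp by auto
        then show thesis
          using that[of "(\<lambda>k'. if k' = k then 2 else 1, \<lambda>_. 1)"] False by (simp add: character_def pow two)
      qed
    qed
    \<comment> \<open>Combining the relation at c times \<open>c0\<close> with the one at c cancels
      \<epsilon> and keeps \<delta>.\<close>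
    define w where "w \<delta> = (character l p \<delta> c0 - character l p \<epsilon> c0) * u \<delta>" for \<delta>
    have "w \<delta> = 0"
    proof (rule Suc.hyps(1)[of "S - {\<epsilon>}"])
      show "N = card (S - {\<epsilon>})" "finite (S - {\<epsilon>})" using Suc.hyps(2) Suc.prems(1) \<epsilon> by auto
      show "\<delta> \<in> S - {\<epsilon>}" using Suc.prems(4) \<epsilon> by auto
      show "(k \<notin> {1..l} \<longrightarrow> d k = 0) \<and> (k \<notin> {1..p} \<longrightarrow> e k = 0)" if "(d, e) \<in> S - {\<epsilon>}" for d e k
        using Suc.prems(2)[of d e k] that by blast
      fix c :: "(nat \<Rightarrow> complex) \<times> (nat \<Rightarrow> complex)"
      assume c: "\<And>k. fst c k \<noteq> 0 \<and> snd c k \<noteq> 0"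
      define cc where "cc = (\<lambda>k. fst c k * fst c0 k, \<lambda>k. snd c k * snd c0 k)"
      have cc: "character l p \<delta> cc = character l p \<delta> c * character l p \<delta> c0" for \<delta>
        by (simp add: character_def cc_def power_mult_distrib prod.distrib mult_ac)
      have "(\<Sum>\<delta>\<in>S. character l p \<delta> cc * u \<delta>) = 0"
        using c c0(1) by (intro Suc.prems(3)) (simp add: cc_def)
      moreover have "(\<Sum>\<delta>\<in>S. character l p \<delta> c * u \<delta>) = 0" using c by (intro Suc.prems(3))
      ultimately have "(\<Sum>\<delta>\<in>S. character l p \<delta> cc * u \<delta>) - character l p \<epsilon> c0 * (\<Sum>\<delta>\<in>S. character l p \<delta> c * u \<delta>) = 0"
        by simp
      then have "(\<Sum>\<delta>\<in>S. character l p \<delta> c * w \<delta>) = 0"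
        by (simp add: cc w_def sum_distrib_left sum_subtractf algebra_simps)
      then show "(\<Sum>\<delta>\<in>S - {\<epsilon>}. character l p \<delta> c * w \<delta>) = 0"
        using Suc.prems(1) \<epsilon>(1) by (simp add: sum.remove w_def)
    qed
    then show ?thesis using c0(2) by (simp add: w_def)
  qed
qed

text \<open>Multiforms of different multidegrees are not closed under addition as multiforms; their
  sums form the ring that the elimination needs.\<close>

inductive_set data_polys :: "nat \<Rightarrow> nat \<Rightarrow> ('m::finite coords \<Rightarrow> complex) set" for l p where
  multiform: "multiform l p d e f \<Longrightarrow> (\<lambda>x. f (fst x) (snd x)) \<in> data_polys l p"
| add: "f \<in> data_polys l p \<Longrightarrow> g \<in> data_polys l p \<Longrightarrow> (\<lambda>x. f x + g x) \<in> data_polys l p"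

lemma data_polys_mult:
  assumes "f \<in> data_polys l p" "g \<in> data_polys l p"
  shows "(\<lambda>x. f x * g x) \<in> data_polys l p"
  using assms(1)
proof (induction rule: data_polys.induct)
  case (multiform d e f)
  show ?case
    using assms(2)
  proof (induction rule: data_polys.induct)
    case (multiform d' e' g)
    show ?case using data_polys.multiform[OF multiform.mult[OF \<open>multiform l p d e f\<close> multiform]] by simp
  next
    case (add g1 g2)
    then show ?case using data_polys.add[OF add.IH] by (simp add: distrib_left)
  qed
next
  case (add f1 f2)
  then show ?case using data_polys.add[OF add.IH] by (simp add: distrib_right)
qed

interpretation data_polys: data_ring "data_polys l p :: ('m::finite coords \<Rightarrow> complex) set" l p
proof
  show "(\<lambda>_. c) \<in> data_polys l p" for c
    using data_polys.multiform[OF multiform.const[of l p c]] by simp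
  show "(\<lambda>x. f x + g x) \<in> data_polys l p" if "f \<in> data_polys l p" "g \<in> data_polys l p" for f g :: "'m coords \<Rightarrow> complex"
    using that by (rule data_polys.add)
  show "(\<lambda>x. f x * g x) \<in> data_polys l p" if "f \<in> data_polys l p" "g \<in> data_polys l p" for f g :: "'m coords \<Rightarrow> complex"
    using that by (rule data_polys_mult)
  show "(\<lambda>x. fst x k i j) \<in> data_polys l p" if "k \<in> {1..l}" for k and i j :: 'm
    using data_polys.multiform[OF multiform.space_coord[OF that, of p i j]] by simp
  show "(\<lambda>x. snd x k i) \<in> data_polys l p" if "k \<in> {1..p}" for k and i :: 'm
    using data_polys.multiform[OF multiform.point_coord[OF that, of l i]] by simp
qed

lemma data_polys_decompose:
  assumes "f \<in> data_polys l p"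
  obtains S u where "finite S" "\<And>\<delta>. \<delta> \<in> S \<Longrightarrow> multiform l p (fst \<delta>) (snd \<delta>) (u \<delta>)"
    "\<And>x. f x = (\<Sum>\<delta>\<in>S. u \<delta> (fst x) (snd x))"
proof -
  have "\<exists>S u. finite S \<and> (\<forall>\<delta>\<in>S. multiform l p (fst \<delta>) (snd \<delta>) (u \<delta>)) \<and>
      (\<forall>x. f x = (\<Sum>\<delta>\<in>S. u \<delta> (fst x) (snd x)))"
    using assms
  proof (induction rule: data_polys.induct)
    case (multiform d e f)
    then show ?case by (intro exI[of _ "{(d, e)}"] exI[of _ "\<lambda>_. f"]) simp
  next
    case (add f g)
    then obtain S u T w where S: "finite S" "\<And>\<delta>. \<delta> \<in> S \<Longrightarrow> multiform l p (fst \<delta>) (snd \<delta>) (u \<delta>)"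
      "\<And>x. f x = (\<Sum>\<delta>\<in>S. u \<delta> (fst x) (snd x))"
      and T: "finite T" "\<And>\<delta>. \<delta> \<in> T \<Longrightarrow> multiform l p (fst \<delta>) (snd \<delta>) (w \<delta>)"
      "\<And>x. g x = (\<Sum>\<delta>\<in>T. w \<delta> (fst x) (snd x))"
      by blast
    define r where "r \<delta> q v = (if \<delta> \<in> S then u \<delta> q v else 0) + (if \<delta> \<in> T then w \<delta> q v else 0)" for \<delta> q v
    have "multiform l p (fst \<delta>) (snd \<delta>) (r \<delta>)" if "\<delta> \<in> S \<union> T" for \<delta>
      using that S(2)[of \<delta>] T(2)[of \<delta>] multiform.add[of l p "fst \<delta>" "snd \<delta>" "u \<delta>" "w \<delta>"]
      by (cases "\<delta> \<in> S"; cases "\<delta> \<in> T") (auto simp: r_def[abs_def])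
    moreover have "f x + g x = (\<Sum>\<delta>\<in>S \<union> T. r \<delta> (fst x) (snd x))" for x
      unfolding r_def sum.distrib S(3) T(3) using S(1) T(1)
      by (intro arg_cong2[where f = "(+)"] sum.mono_neutral_cong_left) auto
    ultimately show ?case using S(1) T(1) by (intro exI[of _ "S \<union> T"] exI[of _ r]) simp
  qed
  then show thesis using that by blast
qed

lemma pluecker_coords_scale:
  assumes "pluecker_coords q W" "c \<noteq> 0"
  shows "pluecker_coords (\<lambda>i j. c * q i j) W"
proof -
  obtain a b :: "complex^'a" where ab: "W = {x. (\<Sum>i\<in>UNIV. a $ i * x $ i) = 0 \<and> (\<Sum>i\<in>UNIV. b $ i * x $ i) = 0}"
    "q = (\<lambda>i j. a $ i * b $ j - a $ j * b $ i)"
    using assms(1) unfolding pluecker_coords_def by blast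
  have "(\<Sum>i\<in>UNIV. (c *s a) $ i * x $ i) = c * (\<Sum>i\<in>UNIV. a $ i * x $ i)" for x
    by (simp add: sum_distrib_left mult_ac)
  then show ?thesis
    unfolding pluecker_coords_def using assms(2)
    by (intro exI[of _ "c *s a"] exI[of _ b]) (simp add: ab algebra_simps fun_eq_iff)
qed

lemma homogeneous_coords_scale:
  assumes "homogeneous_coords v L" "c \<noteq> 0"
  shows "homogeneous_coords (\<lambda>i. c * v i) L"
  using assms span_singleton_eqI[of "\<lambda>i. c * v i" c v] by (simp add: homogeneous_coords_def)

text \<open>The polynomial behind \<open>near\<close> need not be multihomogeneous, so the open set
  is defined by one of its components, chosen nonzero at \<open>x0\<close>. Where that component is
  nonzero, some rescaling of the coordinates makes the whole polynomial nonzero, and rescaling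
  changes neither points nor spaces.\<close>

lemma in_generic_positionI:
  fixes \<Lambda>0 P0 :: "nat \<Rightarrow> (complex^'m::finite) set"
  assumes near: "data_polys.near l p x0 (\<lambda>x. \<forall>\<Lambda> P. (\<forall>k\<in>{1..l}. \<Lambda> k \<in> codim2_spaces \<and> pluecker_coords (fst x k) (\<Lambda> k)) \<longrightarrow>
      (\<forall>k\<in>{1..p}. homogeneous_coords (snd x k) (P k)) \<longrightarrow> Q \<Lambda> P)"
    and \<Lambda>0: "\<And>k. k \<in> {1..l} \<Longrightarrow> \<Lambda>0 k \<in> codim2_spaces" "\<And>k. k \<in> {1..l} \<Longrightarrow> pluecker_coords (fst x0 k) (\<Lambda>0 k)"
    and P0: "\<And>k. k \<in> {1..p} \<Longrightarrow> P0 k \<in> proj_points" "\<And>k. k \<in> {1..p} \<Longrightarrow> homogeneous_coords (snd x0 k) (P0 k)"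
  shows "in_generic_position l p Q"
proof -
  obtain f where f: "f \<in> data_polys l p" "f x0 \<noteq> 0"
    "\<And>x. f x \<noteq> 0 \<Longrightarrow> \<forall>\<Lambda> P. (\<forall>k\<in>{1..l}. \<Lambda> k \<in> codim2_spaces \<and> pluecker_coords (fst x k) (\<Lambda> k)) \<longrightarrow>
      (\<forall>k\<in>{1..p}. homogeneous_coords (snd x k) (P k)) \<longrightarrow> Q \<Lambda> P"
    using near unfolding data_polys.near_def by blast
  obtain S u where S: "finite S" "\<And>\<delta>. \<delta> \<in> S \<Longrightarrow> multiform l p (fst \<delta>) (snd \<delta>) (u \<delta>)"
    "\<And>x. f x = (\<Sum>\<delta>\<in>S. u \<delta> (fst x) (snd x))"
    using data_polys_decompose[OF f(1)] by blast
  obtain \<delta> where \<delta>: "\<delta> \<in> S" "u \<delta> (fst x0) (snd x0) \<noteq> 0"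
    using f(2) unfolding S(3) by (metis sum.neutral)
  define U where "U = {(\<Lambda>, P) \<in> data_space l p. \<not> vanishes_at l p (u \<delta>) \<Lambda> P}"
  have "data_space l p - U = {(\<Lambda>, P) \<in> data_space l p. \<forall>f\<in>{u \<delta>}. vanishes_at l p f \<Lambda> P}"
    by (auto simp: U_def)
  then have "zariski_closed l p (data_space l p - U)"
    unfolding zariski_closed_def using S(2)[OF \<delta>(1)] by (intro exI[of _ "{u \<delta>}"]) blast
  moreover have "U \<subseteq> data_space l p" by (auto simp: U_def)
  ultimately have "zariski_open l p U" by (simp add: zariski_open_def)
  moreover have "(restrict \<Lambda>0 {1..l}, restrict P0 {1..p}) \<in> U"
  proof -
    have "(restrict \<Lambda>0 {1..l}, restrict P0 {1..p}) \<in> data_space l p"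
      using \<Lambda>0(1) P0(1) by (auto simp: data_space_def)
    moreover have "\<not> vanishes_at l p (u \<delta>) (restrict \<Lambda>0 {1..l}) (restrict P0 {1..p})"
      unfolding vanishes_at_def using \<Lambda>0(2) P0(2) \<delta>(2) by (auto intro!: exI[of _ "fst x0"] exI[of _ "snd x0"])
    ultimately show ?thesis by (simp add: U_def)
  qed
  moreover have "Q \<Lambda> P" if U: "(\<Lambda>, P) \<in> U" for \<Lambda> P
  proof -
    obtain q v where qv: "\<And>k. k \<in> {1..l} \<Longrightarrow> pluecker_coords (q k) (\<Lambda> k)"
      "\<And>k. k \<in> {1..p} \<Longrightarrow> homogeneous_coords (v k) (P k)" "u \<delta> q v \<noteq> 0"
      using U unfolding U_def vanishes_at_def by blast
    \<comment> \<open>If every rescaling gave zero, independence of characters would make all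
      components vanish.\<close>
    have "\<exists>c. (\<forall>k. fst c k \<noteq> 0 \<and> snd c k \<noteq> 0) \<and> (\<Sum>\<delta>\<in>S. character l p \<delta> c * u \<delta> q v) \<noteq> 0"
    proof (rule ccontr)
      assume none: "\<not> ?thesis"
      have "u \<delta> q v = 0"
      proof (rule characters_independent[of S l p "\<lambda>\<delta>. u \<delta> q v"])
        show "(k \<notin> {1..l} \<longrightarrow> d k = 0) \<and> (k \<notin> {1..p} \<longrightarrow> e k = 0)" if "(d, e) \<in> S" for d e k
          using multiform_degree_zero[OF S(2)[OF that]] by simp
        show "(\<Sum>\<delta>\<in>S. character l p \<delta> c * u \<delta> q v) = 0"
          if "\<And>k. fst c k \<noteq> 0 \<and> snd c k \<noteq> 0" for c using none that by blast
      qed (rule S(1) \<delta>(1))+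
      then show False using qv(3) by simp
    qed
    then obtain c where c: "\<And>k. fst c k \<noteq> 0 \<and> snd c k \<noteq> 0"
      "(\<Sum>\<delta>\<in>S. character l p \<delta> c * u \<delta> q v) \<noteq> 0" by blast
    define x where "x = (\<lambda>k i j. fst c k * q k i j, \<lambda>k i. snd c k * v k i)"
    have "f x = (\<Sum>\<delta>\<in>S. character l p \<delta> c * u \<delta> q v)"
      unfolding S(3) x_def fst_conv snd_conv
      by (intro sum.cong refl) (simp add: multiform_scale[OF S(2)])
    then have "f x \<noteq> 0" using c(2) by simp
    moreover have "\<Lambda> k \<in> codim2_spaces \<and> pluecker_coords (fst x k) (\<Lambda> k)" if k: "k \<in> {1..l}" for k
    proof
      show "\<Lambda> k \<in> codim2_spaces" using U k by (auto simp: U_def data_space_def)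
      show "pluecker_coords (fst x k) (\<Lambda> k)"
        using pluecker_coords_scale[OF qv(1)[OF k], of "fst c k"] c(1) by (simp add: x_def)
    qed
    moreover have "homogeneous_coords (snd x k) (P k)" if k: "k \<in> {1..p}" for k
      using homogeneous_coords_scale[OF qv(2)[OF k], of "snd c k"] c(1) by (simp add: x_def)
    ultimately show ?thesis using f(3) by blast
  qed
  ultimately show ?thesis unfolding in_generic_position_def by blast
qed

lemma zero_space_codim2:
  fixes a b :: "'m::finite \<Rightarrow> complex"
  assumes q: "wedge a b j r \<noteq> 0"
  shows "zero_space a b \<in> codim2_spaces" (is "?W \<in> _")
proof -
  have add: "(\<Sum>i\<in>UNIV. c i * (x + y) $ i) = (\<Sum>i\<in>UNIV. c i * x $ i) + (\<Sum>i\<in>UNIV. c i * y $ i)" for c and x y :: "complex^'m"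
    by (simp add: distrib_left sum.distrib)
  have scale: "(\<Sum>i\<in>UNIV. c i * (k *s x) $ i) = k * (\<Sum>i\<in>UNIV. c i * x $ i)" for c k and x :: "complex^'m"
    by (simp add: sum_distrib_left mult_ac)
  have sub: "vec.subspace {x. (\<Sum>i\<in>UNIV. c i * x $ i) = 0}" for c :: "'m \<Rightarrow> complex"
    unfolding vec.subspace_def Ball_def mem_Collect_eq add scale by simp
  have W: "vec.subspace ?W"
    using vec.subspace_inter[OF sub[of a] sub[of b]] by (simp add: Collect_conj_eq)
  \<comment> \<open>Vectors dual to \<open>a\<close> and \<open>b\<close>, found by Cramer's rule in
    the coordinates \<open>j\<close> and \<open>r\<close>. Adjoining both to the zero space raises
    its dimension by two and gives everything.\<close>
  define w1 w2 where "w1 = (\<chi> i. ((if i = j then b r else 0) - (if i = r then b j else 0)) / wedge a b j r)"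
    and "w2 = (\<chi> i. ((if i = r then a j else 0) - (if i = j then a r else 0)) / wedge a b j r)"
  have delta: "(\<Sum>i\<in>UNIV. c i * (((if i = j then x else 0) - (if i = r then y else 0)) / z)) = (c j * x - c r * y) / z"
    for c :: "'m \<Rightarrow> complex" and x y z j r
  proof -
    have "c i * (((if i = j then x else 0) - (if i = r then y else 0)) / z) =
        (if i = j then c i * x / z else 0) - (if i = r then c i * y / z else 0)" for i
      by (simp add: diff_divide_distrib right_diff_distrib)
    then show ?thesis by (simp add: sum_subtractf diff_divide_distrib)
  qed
  have w: "(\<Sum>i\<in>UNIV. a i * w1 $ i) = 1" "(\<Sum>i\<in>UNIV. b i * w1 $ i) = 0"
    "(\<Sum>i\<in>UNIV. a i * w2 $ i) = 0" "(\<Sum>i\<in>UNIV. b i * w2 $ i) = 1"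
    unfolding w1_def w2_def vec_lambda_beta delta
    using q by (simp_all add: wedge_def algebra_simps)
  have w2: "w2 \<notin> vec.span ?W"
    using W w(4) by (simp add: vec.span_eq_iff[THEN iffD2])
  have "vec.span (insert w2 ?W) \<subseteq> {x. (\<Sum>i\<in>UNIV. a i * x $ i) = 0}"
    by (rule vec.span_minimal) (use w(3) sub in auto)
  then have w1: "w1 \<notin> vec.span (insert w2 ?W)" using w(1) by auto
  have "x \<in> vec.span (insert w1 (insert w2 ?W))" for x
  proof -
    define y where "y = x + (- (\<Sum>i\<in>UNIV. a i * x $ i)) *s w1 + (- (\<Sum>i\<in>UNIV. b i * x $ i)) *s w2"
    have "y \<in> ?W" unfolding y_def mem_Collect_eq add scale by (simp add: w)
    have x: "x = y + (\<Sum>i\<in>UNIV. a i * x $ i) *s w1 + (\<Sum>i\<in>UNIV. b i * x $ i) *s w2"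
      by (simp add: y_def vec.scale_minus_left)
    have "y + k1 *s w1 + k2 *s w2 \<in> vec.span (insert w1 (insert w2 ?W))" for k1 k2
      using \<open>y \<in> ?W\<close> by (intro vec.span_add vec.span_scale) (auto intro: vec.span_base)
    then show ?thesis by (subst x)
  qed
  then have "vec.span (insert w1 (insert w2 ?W)) = UNIV" by blast
  then have "vec.dim (insert w1 (insert w2 ?W)) = CARD('m)"
    using vec.dim_span[of "insert w1 (insert w2 ?W)"] by (simp add: card_cart_basis)
  then show ?thesis using W w1 w2 by (simp add: codim2_spaces_def vec.dim_insert)
qed

lemma pluecker_coords_wedge:
  fixes a b :: "'m::finite \<Rightarrow> complex"
  shows "pluecker_coords (wedge a b) (zero_space a b)"
  unfolding pluecker_coords_def
  by (intro exI[of _ "vec_lambda a"] exI[of _ "vec_lambda b"]) (simp add: wedge_def fun_eq_iff)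

lemma span_in_proj_points:
  fixes v :: "'m::finite \<Rightarrow> complex"
  assumes "v i \<noteq> 0"
  shows "vec.span {vec_lambda v} \<in> proj_points"
proof -
  have "vec_lambda v \<noteq> 0" using assms by (auto simp: vec_eq_iff)
  then show ?thesis by (simp add: proj_points_def vec.dim_insert)
qed

section \<open>The cross-ratio obstruction\<close>

text \<open>The determinant of the images of \<open>P i\<close> and \<open>P j\<close> under the
  projection from \<open>\<Lambda> k\<close> to the projective line.\<close>

definition bracket :: "'m::finite coords \<Rightarrow> nat \<Rightarrow> nat \<Rightarrow> nat \<Rightarrow> complex" where
  "bracket x k i j = dot (contract (snd x i) (fst x k)) (snd x j)"

text \<open>Nonzero iff the cross-ratios of \<open>P\<^sub>1, \<dots>, P\<^sub>4\<close> seen from \<open>\<Lambda>\<^sub>1\<close> and from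
  \<open>\<Lambda>\<^sub>2\<close> differ.\<close>

definition cross_ratio_defect :: "'m::finite coords \<Rightarrow> complex" where
  "cross_ratio_defect x = bracket x 1 1 2 * bracket x 1 3 4 * (bracket x 2 1 3 * bracket x 2 2 4) -
     bracket x 2 1 2 * bracket x 2 3 4 * (bracket x 1 1 3 * bracket x 1 2 4)"

lemma bracket_wedge:
  assumes "fst x k = wedge a b"
  shows "bracket x k i j = dot a (snd x i) * dot b (snd x j) - dot b (snd x i) * dot a (snd x j)"
  by (simp add: bracket_def assms contract_wedge[abs_def] dot_diff dot_scale)

text \<open>Projecting a rational normal curve from an \<open>(n - 1)\<close>-secant space is an isomorphism onto the
  projective line, so it preserves cross-ratios.\<close>

lemma cross_ratio_defect_zero:
  fixes \<Lambda> P :: "nat \<Rightarrow> (complex^'m::finite) set"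
  assumes card: "CARD('m) = n + 1" and n: "n \<ge> 1" and C: "rational_normal_curve C"
    and \<Lambda>: "\<And>k. k \<in> {1, 2} \<Longrightarrow> pluecker_coords (fst x k) (\<Lambda> k)" "\<And>k. k \<in> {1, 2} \<Longrightarrow> secant (n - 1) (\<Lambda> k) C"
    and P: "\<And>k. k \<in> {1..4} \<Longrightarrow> homogeneous_coords (snd x k) (P k)" "\<And>k. k \<in> {1..4} \<Longrightarrow> P k \<in> C"
  shows "cross_ratio_defect x = 0"
proof -
  obtain G :: "'m \<Rightarrow> complex \<Rightarrow> complex \<Rightarrow> complex" where G: "form_basis n G" "C = curve G"
    using C card by (auto simp: rational_normal_curve_iff)
  interpret G: basis_curve n G by unfold_locales (use n G in auto)
  have "\<forall>k\<in>{1..4}. \<exists>\<tau>. \<forall>i. snd x k i = fst \<tau> * G i (fst (snd \<tau>)) (snd (snd \<tau>))"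
  proof
    fix k :: nat assume k: "k \<in> {1..4}"
    obtain s t where st: "(s, t) \<noteq> (0, 0)" "P k = vec.span {\<chi> i. G i s t}"
      using P(2)[OF k] G(2) by (auto simp: curve_def)
    obtain j where j: "G j s t \<noteq> 0" using G.pt_nonzero[OF st(1)] by blast
    have "vec.span {\<chi> i. G i s t} = vec.span {\<chi> i. snd x k i}"
      using P(1)[OF k] st(2) by (simp add: homogeneous_coords_def)
    then obtain c where c: "c \<noteq> 0" "\<And>i. G i s t = c * snd x k i"
      using span_singleton_eqD[of "G.pt s t" "snd x k" j] j by metis
    have "snd x k i = (1 / c) * G i s t" for i using c by simp
    then show "\<exists>\<tau>. \<forall>i. snd x k i = fst \<tau> * G i (fst (snd \<tau>)) (snd (snd \<tau>))"
      by (intro exI[of _ "(1 / c, s, t)"]) simp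
  qed
  then obtain \<tau> where \<tau>: "\<And>k i. k \<in> {1..4} \<Longrightarrow> snd x k i = fst (\<tau> k) * G i (fst (snd (\<tau> k))) (snd (snd (\<tau> k)))"
    by metis
  define W where "W i j = fst (snd (\<tau> i)) * snd (snd (\<tau> j)) - snd (snd (\<tau> i)) * fst (snd (\<tau> j))" for i j
  \<comment> \<open>Up to factors that depend on one point each and on the space, the bracket is the
    determinant \<open>W\<close> of the parameters. In both products of the defect every point
    occurs once for each space, so the factors agree.\<close>
  have br: "\<exists>g \<Delta>. \<forall>i\<in>{1..4}. \<forall>j\<in>{1..4}. bracket x k i j = g i * g j * \<Delta> * W i j" if k: "k \<in> {1, 2}" for k
  proof -
    obtain a b :: "complex^'m" where ab: "\<Lambda> k = {x. (\<Sum>i\<in>UNIV. a $ i * x $ i) = 0 \<and> (\<Sum>i\<in>UNIV. b $ i * x $ i) = 0}"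
      "fst x k = (\<lambda>i j. a $ i * b $ j - a $ j * b $ i)"
      using \<Lambda>(1)[OF k] unfolding pluecker_coords_def by blast
    obtain h a1 a2 b1 b2 where A: "\<And>s t. dot (\<lambda>i. a $ i) (G.pt s t) = h s t * (a1 * s + a2 * t)"
      and B: "\<And>s t. dot (\<lambda>i. b $ i) (G.pt s t) = h s t * (b1 * s + b2 * t)"
      by (rule G.secant_factor[OF ab(1) \<Lambda>(2)[OF k, unfolded G(2)]]) blast
    have "fst x k = wedge (\<lambda>i. a $ i) (\<lambda>i. b $ i)" by (simp add: ab(2) wedge_def fun_eq_iff)
    note bw = bracket_wedge[OF this]
    define g where "g i = fst (\<tau> i) * h (fst (snd (\<tau> i))) (snd (snd (\<tau> i)))" for i
    have v: "dot c (snd x i) = fst (\<tau> i) * dot c (G.pt (fst (snd (\<tau> i))) (snd (snd (\<tau> i))))" if "i \<in> {1..4}" for c i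
      using dot_scale(2)[of c "fst (\<tau> i)"] \<tau>[OF that] by presburger
    have "bracket x k i j = g i * g j * (a1 * b2 - a2 * b1) * W i j" if "i \<in> {1..4}" "j \<in> {1..4}" for i j
      unfolding bw v[OF that(1)] v[OF that(2)] A B g_def W_def by (simp add: algebra_simps)
    then show ?thesis by blast
  qed
  obtain g1 \<Delta>1 where "\<forall>i\<in>{1..4}. \<forall>j\<in>{1..4}. bracket x 1 i j = g1 i * g1 j * \<Delta>1 * W i j"
    using br[of 1] by blast
  then have 1: "bracket x 1 i j = g1 i * g1 j * \<Delta>1 * W i j" if "i \<in> {1..4}" "j \<in> {1..4}" for i j
    using that by blast
  obtain g2 \<Delta>2 where "\<forall>i\<in>{1..4}. \<forall>j\<in>{1..4}. bracket x 2 i j = g2 i * g2 j * \<Delta>2 * W i j"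
    using br[of 2] by blast
  then have 2: "bracket x 2 i j = g2 i * g2 j * \<Delta>2 * W i j" if "i \<in> {1..4}" "j \<in> {1..4}" for i j
    using that by blast
  show ?thesis unfolding cross_ratio_defect_def by (simp add: 1 2)
qed

text \<open>Only four points and two spaces matter, so any data with nonzero defect shows that the
  open set is nonempty.\<close>

lemma generic_no_curve:
  assumes card: "CARD('m::finite) = n + 1" and n: "n \<ge> 2" and p: "p \<ge> 4" and l: "l \<ge> 2"
  shows "in_generic_position l p (\<lambda>(\<Lambda> :: nat \<Rightarrow> (complex^'m) set) (P :: nat \<Rightarrow> (complex^'m) set).
    \<not> (\<exists>C. solution_curve n p l \<Lambda> P C))"
proof -
  obtain e where e: "bij_betw e (UNIV :: 'm set) {0..<n + 1}"
    using ex_bij_betw_finite_nat[of "UNIV :: 'm set"] card by auto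
  have inv: "e (inv_into UNIV e m) = m" if "m < n + 1" for m
    using bij_betw_inv_into_right[OF e, of m] that by simp
  define j0 j1 j2 where "j0 = inv_into UNIV e 0" and "j1 = inv_into UNIV e 1" and "j2 = inv_into UNIV e 2"
  have j: "j0 \<noteq> j1" "j0 \<noteq> j2" "j1 \<noteq> j2"
    using inv[of 0] inv[of 1] inv[of 2] n by (auto simp: j0_def j1_def j2_def)
  define \<delta> :: "'m \<Rightarrow> 'm \<Rightarrow> complex" where "\<delta> r i = (if i = r then 1 else 0)" for r i
  have dot_\<delta>: "dot (\<delta> r) x = x r" for r x
    by (simp add: dot_def \<delta>_def if_distrib[of "\<lambda>u. u * _"] cong: if_cong)
  \<comment> \<open>The first three points have images 0, infinity and 1 from both spaces, but the
    fourth has image 2 from the first space and 3 from the second.\<close>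
  define b where "b k = (if k = 1 then \<delta> j1 else (\<lambda>i. \<delta> j1 i + \<delta> j2 i))" for k :: nat
  define v where "v k = (if k = 2 then \<delta> j1 else if k = 3 then (\<lambda>i. \<delta> j0 i + \<delta> j1 i)
    else if k = 4 then (\<lambda>i. \<delta> j0 i + 2 * \<delta> j1 i + \<delta> j2 i) else \<delta> j0)" for k :: nat
  define x0 :: "'m coords" where "x0 = (\<lambda>k. wedge (\<delta> j0) (b k), v)"
  define \<Lambda>0 where "\<Lambda>0 k = zero_space (\<delta> j0) (b k)" for k
  have x0: "cross_ratio_defect x0 \<noteq> 0"
  proof -
    have "bracket x0 k r s = v r j0 * dot (b k) (v s) - dot (b k) (v r) * v s j0" for k r s
      using bracket_wedge[of x0 k "\<delta> j0" "b k"] by (simp add: x0_def dot_\<delta>)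
    then show ?thesis
      using j by (simp add: cross_ratio_defect_def b_def dot_add dot_\<delta> v_def) (simp add: \<delta>_def)
  qed
  show ?thesis
  proof (rule in_generic_positionI[where ?x0.0 = x0 and ?\<Lambda>0.0 = \<Lambda>0 and ?P0.0 = "\<lambda>k. vec.span {vec_lambda (v k)}"])
    show "\<Lambda>0 k \<in> codim2_spaces" for k
      unfolding \<Lambda>0_def by (rule zero_space_codim2[of _ _ j0 j1]) (use j in \<open>simp add: wedge_def b_def \<delta>_def\<close>)
    show "pluecker_coords (fst x0 k) (\<Lambda>0 k)" for k
      unfolding \<Lambda>0_def x0_def fst_conv by (rule pluecker_coords_wedge)
    show "homogeneous_coords (snd x0 k) (vec.span {vec_lambda (v k)})" for k
      by (simp add: x0_def homogeneous_coords_def)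
    show "vec.span {vec_lambda (v k)} \<in> proj_points" for k
      by (rule span_in_proj_points[of _ "if k = 2 then j1 else j0"]) (use j in \<open>simp add: v_def \<delta>_def\<close>)
    have "cross_ratio_defect \<in> (data_polys l p :: ('m coords \<Rightarrow> complex) set)"
      unfolding cross_ratio_defect_def[abs_def] bracket_def dot_def contract_def
      using p l by (intro data_polys.closed data_polys.q_closed data_polys.v_closed) auto
    then have "data_polys.near l p x0 (\<lambda>x. cross_ratio_defect x \<noteq> 0)"
      by (rule data_polys.near_nonzero) (rule x0)
    then show "data_polys.near l p x0 (\<lambda>x. \<forall>\<Lambda> P :: nat \<Rightarrow> (complex^'m) set.
        (\<forall>k\<in>{1..l}. \<Lambda> k \<in> codim2_spaces \<and> pluecker_coords (fst x k) (\<Lambda> k)) \<longrightarrow>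
        (\<forall>k\<in>{1..p}. homogeneous_coords (snd x k) (P k)) \<longrightarrow>
        \<not> (\<exists>C. solution_curve n p l \<Lambda> P C))"
    proof (rule data_polys.near_mono, intro allI impI notI)
      fix x :: "'m coords" and \<Lambda> P :: "nat \<Rightarrow> (complex^'m) set"
      assume H: "cross_ratio_defect x \<noteq> 0"
        "\<forall>k\<in>{1..l}. \<Lambda> k \<in> codim2_spaces \<and> pluecker_coords (fst x k) (\<Lambda> k)"
        "\<forall>k\<in>{1..p}. homogeneous_coords (snd x k) (P k)"
        "\<exists>C. solution_curve n p l \<Lambda> P C"
      then obtain C where C: "rational_normal_curve C" "\<forall>k\<in>{1..p}. P k \<in> C" "\<forall>k\<in>{1..l}. secant (n - 1) (\<Lambda> k) C"
        by blast
      have "cross_ratio_defect x = 0"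
        by (rule cross_ratio_defect_zero[OF card _ C(1), of x \<Lambda> P]) (use n p l H C in auto)
      then show False using H(1) by simp
    qed
  qed
qed

lemma generic_unique_curve:
  assumes card: "CARD('m::finite) = n + 1" and n: "n \<ge> 2" and p: "p \<ge> 1" and pl: "p + l = n + 3"
    and l: "l \<in> {0, 1, n, n + 1, n + 2}"
  shows "in_generic_position l p (\<lambda>(\<Lambda> :: nat \<Rightarrow> (complex^'m) set) (P :: nat \<Rightarrow> (complex^'m) set).
    \<exists>!C. solution_curve n p l \<Lambda> P C)"
proof -
  obtain e where "bij_betw e (UNIV :: 'm set) {0..<n + 1}"
    using ex_bij_betw_finite_nat[of "UNIV :: 'm set"] card by auto
  moreover have "{0..<n + 1} = {..n}" by auto
  ultimately interpret S: standard_configuration n p l e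
    using n p pl by unfold_locales auto
  show ?thesis
  proof (rule in_generic_positionI[OF data_polys.near_unique_curve[OF S.standard_configuration_axioms l],
        where ?\<Lambda>0.0 = "\<lambda>k. zero_space (S.a k) (S.b k)"
          and ?P0.0 = "\<lambda>k. vec.span {vec_lambda (S.v k)}"], unfold fst_conv snd_conv)
    show "zero_space (S.a k) (S.b k) \<in> codim2_spaces"
      if "k \<in> {1..l}" for k
      by (rule zero_space_codim2[of _ _ S.m0 S.i1])
        (use S.contract_q_i1[of k] that in \<open>simp add: S.contract_v1 S.q_def\<close>)
    show "pluecker_coords (S.q k) (zero_space (S.a k) (S.b k))" for k
      unfolding S.q_def by (rule pluecker_coords_wedge)
    show "homogeneous_coords (S.v k) (vec.span {vec_lambda (S.v k)})" for k
      by (simp add: homogeneous_coords_def)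
    show "vec.span {vec_lambda (S.v k)} \<in> proj_points" for k
      by (rule span_in_proj_points[of _ "if k = 1 then S.m0 else S.i1"]) (simp add: S.v_def S.e_i1)
  qed
qed

theorem theorem4p7:
  fixes n p l :: nat
  assumes dim: "CARD('m::finite) = n + 1"
    and n: "n \<ge> 3" and p: "p \<ge> 1" and l: "l \<ge> 0" and pl: "p + l = n + 3"
  defines "cases_i \<equiv> {(n + 3, 0), (n + 2, 1), (3, n), (2, n + 1), (1, n + 2)}"
  shows "((p, l) \<in> cases_i \<longrightarrow>
            in_generic_position l p
              (\<lambda>(\<Lambda> :: nat \<Rightarrow> (complex^'m) set) (P :: nat \<Rightarrow> (complex^'m) set).
                 \<exists>!C. rational_normal_curve C \<and> (\<forall>k\<in>{1..p}. P k \<in> C) \<and>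
                      (\<forall>k\<in>{1..l}. secant (n - 1) (\<Lambda> k) C)))
       \<and> ((p, l) \<notin> cases_i \<longleftrightarrow> p \<ge> 4 \<and> l \<ge> 2)
       \<and> (p \<ge> 4 \<and> l \<ge> 2 \<longrightarrow>
            in_generic_position l p
              (\<lambda>(\<Lambda> :: nat \<Rightarrow> (complex^'m) set) (P :: nat \<Rightarrow> (complex^'m) set).
                 \<not> (\<exists>C. rational_normal_curve C \<and> (\<forall>k\<in>{1..p}. P k \<in> C) \<and>
                      (\<forall>k\<in>{1..l}. secant (n - 1) (\<Lambda> k) C))))"
proof (intro conjI impI)
  assume "(p, l) \<in> cases_i"
  then have "l \<in> {0, 1, n, n + 1, n + 2}" by (auto simp: cases_i_def)
  then show "in_generic_position l p
      (\<lambda>(\<Lambda> :: nat \<Rightarrow> (complex^'m) set) (P :: nat \<Rightarrow> (complex^'m) set).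
         \<exists>!C. rational_normal_curve C \<and> (\<forall>k\<in>{1..p}. P k \<in> C) \<and> (\<forall>k\<in>{1..l}. secant (n - 1) (\<Lambda> k) C))"
    using generic_unique_curve[OF dim _ p pl] n by simp
next
  show "(p, l) \<notin> cases_i \<longleftrightarrow> p \<ge> 4 \<and> l \<ge> 2" using n p pl by (auto simp: cases_i_def)
next
  assume "p \<ge> 4 \<and> l \<ge> 2"
  then show "in_generic_position l p
      (\<lambda>(\<Lambda> :: nat \<Rightarrow> (complex^'m) set) (P :: nat \<Rightarrow> (complex^'m) set).
         \<not> (\<exists>C. rational_normal_curve C \<and> (\<forall>k\<in>{1..p}. P k \<in> C) \<and> (\<forall>k\<in>{1..l}. secant (n - 1) (\<Lambda> k) C)))"
    using generic_no_curve[OF dim] n by simp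
qed

end
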